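(* Let $\mathsf{C}$ be a category of groups with operations. Then the 2-category $\mathsf{XMod}(\mathsf{C})$, whose objects are crossed modules in $\mathsf{C}$, whose 1-cells are morphisms of crossed modules and whose 2-cells are homotopies of crossed module morphisms, and the 2-category $\mathsf{Cat}(\mathsf{C})$, whose objects are internal categories (equivalently, internal groupoids) in $\mathsf{C}$, whose 1-cells are internal functors and whose 2-cells are homotopies of internal functors, are equivalent 2-categories.
   Context: Category of groups with operations. $\mathsf{C}$ is a category of groups with a set of operations $\Omega=\Omega_0\cup\Omega_1\cup\Omega_2$ ($\Omega_i$ the $i$-ary operations) and a set $E$ of identities including the group laws; i.e. objects are all algebras with operations $\Omega$ satisfying $E$. The group operations are written additively (not assumed commutative): $0\in\Omega_0$, $-\in\Omega_1$, $+\in\Omega_2$, and $\Omega_0=\{0\}$. Put $\Omega_2'=\Omega_2\setminus\{+\}$, $\Omega_1'=\Omega_1\setminus\{-\}$. If $*\in\Omega_2'$ then the operation $*^{\circ}$ defined by $a*^{\circ}b=b*a$ is also in $\Omega_2'$. $E$ includes $a*(b+c)=a*b+a*c$, $\omega(a+b)=\omega(a)+\omega(b)$ and $\omega(a)*b=\omega(a*b)$ for all $*\in\Omega_2'$, $\omega\in\Omega_1'$. Morphisms are group homomorphisms preserving all operations in $\Omega_1$ and $\Omega_2$. Derived actions. Given a split extension $0\to A\xrightarrow{\imath} E\xrightarrow{p} B\to 0$ in $\mathsf{C}$ ($p$ surjective, $\imath$ the kernel of $p$) with section $s\colon B\to E$ a morphism in $\mathsf{C}$, $ps=1_B$, one gets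 actions $b\cdot a=s(b)+a-s(b)$ and $b*a=s(b)*a$ (for each $*\in\Omega_2'$) of $B$ on $A$; sets of actions arising in this way are called sets of derived actions. One writes $a*b$ for $b*^{\circ}a$. Crossed modules. A crossed module $(A,B,\alpha)$ in $\mathsf{C}$ is a morphism $\alpha\colon A\to B$ in $\mathsf{C}$ with a set of derived actions of $B$ on $A$ such that for all $a,a_1\in A$, $b\in B$, $*\in\Omega_2'$: (CM1) $\alpha(b\cdot a)=b+\alpha(a)-b$; (CM2) $\alpha(a)\cdot a_1=a+a_1-a$; (CM3) $\alpha(b*a)=b*\alpha(a)$, $\alpha(a*b)=\alpha(a)*b$; (CM4) $\alpha(a)*a_1=a*a_1=a*\alpha(a_1)$. A morphism $(f_1,f_0)\colon(A,B,\alpha)\to(A',B',\alpha')$ is a pair of morphisms $f_1\colon A\to A'$, $f_0\colon B\to B'$ in $\mathsf{C}$ with $f_0\alpha=\alpha'f_1$, $f_1(b\cdot a)=f_0(b)\cdot f_1(a)$ and $f_1(b*a)=f_0(b)*f_1(a)$ for all $a\in A$, $b\in B$, $*\in\Omega_2'$. Homotopies of crossed module morphisms. For morphisms $(f_1,f_0),(g_1,g_0)\colon(A,B,\alpha)\to(C,D,\gamma)$, a homotopy $d\colon(f_1,f_0)\Rightarrow(g_1,g_0)$ is a function $d\colon B\to C$ such that for all $a\in A$, $b,b_1\in B$, $*\in\Omega_2'$, $\omega\in\Omega_1'$: (i) $d(b+b_1)=d(b)+f_0(b)\cdot d(b_1)$; (ii) $d(b*b_1)=d(b)*d(b_1)+d(b)*f_0(b_1)+f_0(b)*d(b_1)$;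 (iii) $d(\omega(b))=\omega(d(b))$; (iv) $\gamma(d(b))=g_0(b)-f_0(b)$; (v) $d(\alpha(a))=g_1(a)-f_1(a)$. Identity 2-cells are the zero functions; the vertical composite of $d\colon f\Rightarrow g$ followed by $e\colon g\Rightarrow h$ is $b\mapsto e(b)+d(b)$; the horizontal composite of $d\colon f\Rightarrow g$ with a subsequent $e\colon h\Rightarrow k$ (where $h=(h_1,h_0)$ has as source the target of $f$) is $b\mapsto e(g_0(b))+h_1(d(b))$. Internal categories. An internal category $G$ in $\mathsf{C}$ consists of objects $G_1$ (morphisms) and $G_0$ (objects) of $\mathsf{C}$, initial and final point maps $d_0,d_1\colon G_1\to G_0$, an identity map $\varepsilon\colon G_0\to G_1$ and a partial composition $G_1\,{}_{d_0}\!\times_{d_1}G_1\to G_1$, $(b,a)\mapsto b\circ a$, all morphisms in $\mathsf{C}$, satisfying the usual category axioms. Every internal category in $\mathsf{C}$ is automatically an internal groupoid. Morphisms (internal functors) are functors that are morphisms in $\mathsf{C}$. For internal functors $f,g\colon G\to H$, a homotopy $\eta\colon f\simeq g$ is a natural isomorphism from $f$ to $g$ such that $\eta\colon G_0\to H_1$ is a morphism in $\mathsf{C}$. Vertical and horizontal composition of these 2-cells are the usual ones of natural transformations. *)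

theory Defs
  imports Main "HOL-Library.FuncSet"
begin

section \<open>Categories of groups with operations\<close>

text \<open>
  The symbols \<open>0\<close>, \<open>-\<close>, \<open>+\<close> are built into the terms; \<open>un_ops\<close> and \<open>bin_ops\<close> are the sets
  \<open>\<Omega>\<^sub>1'\<close> and \<open>\<Omega>\<^sub>2'\<close> of the remaining operation symbols (sets rather than types, since they may be
  empty), \<open>opp\<close> sends \<open>*\<close> to \<open>*\<^sup>\<circ>\<close>, and \<open>eqs\<close> is the set \<open>E\<close> of identities.
\<close>

datatype ('u, 'b) trm =
    Var nat
  | Zero
  | Neg "('u, 'b) trm"
  | Plus "('u, 'b) trm" "('u, 'b) trm"
  | UnOp 'u "('u, 'b) trm"
  | BinOp 'b "('u, 'b) trm" "('u, 'b) trm"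

record ('u, 'b) theory_sig =
  un_ops :: "'u set"
  bin_ops :: "'b set"
  opp :: "'b \<Rightarrow> 'b"
  eqs :: "(('u, 'b) trm \<times> ('u, 'b) trm) set"

primrec wf_trm :: "('u, 'b) theory_sig \<Rightarrow> ('u, 'b) trm \<Rightarrow> bool" where
  "wf_trm S (Var n) \<longleftrightarrow> True"
| "wf_trm S Zero \<longleftrightarrow> True"
| "wf_trm S (Neg t) \<longleftrightarrow> wf_trm S t"
| "wf_trm S (Plus t u) \<longleftrightarrow> wf_trm S t \<and> wf_trm S u"
| "wf_trm S (UnOp w t) \<longleftrightarrow> w \<in> un_ops S \<and> wf_trm S t"
| "wf_trm S (BinOp m t u) \<longleftrightarrow> m \<in> bin_ops S \<and> wf_trm S t \<and> wf_trm S u"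

definition group_eqs :: "(('u, 'b) trm \<times> ('u, 'b) trm) set" where
  "group_eqs = (let x = Var 0; y = Var 1; z = Var 2 in
     {(Plus (Plus x y) z, Plus x (Plus y z)),
      (Plus Zero x, x), (Plus x Zero, x),
      (Plus (Neg x) x, Zero), (Plus x (Neg x), Zero)})"

definition operation_eqs ::
    "('u, 'b) theory_sig \<Rightarrow> (('u, 'b) trm \<times> ('u, 'b) trm) set" where
  "operation_eqs S = (let x = Var 0; y = Var 1; z = Var 2 in
     {(BinOp m x (Plus y z), Plus (BinOp m x y) (BinOp m x z)) | m. m \<in> bin_ops S} \<union>
     {(UnOp w (Plus x y), Plus (UnOp w x) (UnOp w y)) | w. w \<in> un_ops S} \<union>
     {(BinOp m (UnOp w x) y, UnOp w (BinOp m x y)) | m w. m \<in> bin_ops S \<and> w \<in> un_ops S} \<union>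
     {(BinOp (opp S m) x y, BinOp m y x) | m. m \<in> bin_ops S})"

locale groups_with_operations =
  fixes S :: "('u, 'b) theory_sig"
  assumes opp_closed: "m \<in> bin_ops S \<Longrightarrow> opp S m \<in> bin_ops S"
    and eqs_wf: "(l, r) \<in> eqs S \<Longrightarrow> wf_trm S l \<and> wf_trm S r"
    and group_eqs: "group_eqs \<subseteq> eqs S"
    and operation_eqs: "operation_eqs S \<subseteq> eqs S"

record ('a, 'u, 'b) alg =
  carrier :: "'a set"
  zero :: 'a ("\<zero>\<index>")
  neg :: "'a \<Rightarrow> 'a"
  add :: "'a \<Rightarrow> 'a \<Rightarrow> 'a" (infixl "\<oplus>\<index>" 65)
  un :: "'u \<Rightarrow> 'a \<Rightarrow> 'a"
  bin :: "'b \<Rightarrow> 'a \<Rightarrow> 'a \<Rightarrow> 'a"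

definition diff :: "('a, 'u, 'b) alg \<Rightarrow> 'a \<Rightarrow> 'a \<Rightarrow> 'a" (infixl "\<ominus>\<index>" 65) where
  "x \<ominus>\<^bsub>A\<^esub> y = x \<oplus>\<^bsub>A\<^esub> neg A y"

primrec trm_val :: "('a, 'u, 'b) alg \<Rightarrow> (nat \<Rightarrow> 'a) \<Rightarrow> ('u, 'b) trm \<Rightarrow> 'a" where
  "trm_val A \<rho> (Var n) = \<rho> n"
| "trm_val A \<rho> Zero = \<zero>\<^bsub>A\<^esub>"
| "trm_val A \<rho> (Neg t) = neg A (trm_val A \<rho> t)"
| "trm_val A \<rho> (Plus t u) = trm_val A \<rho> t \<oplus>\<^bsub>A\<^esub> trm_val A \<rho> u"
| "trm_val A \<rho> (UnOp w t) = un A w (trm_val A \<rho> t)"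
| "trm_val A \<rho> (BinOp m t u) = bin A m (trm_val A \<rho> t) (trm_val A \<rho> u)"

text \<open>
  The objects of \<open>\<C>\<close>. As in HOL-Algebra, the values of operations outside the carrier are
  irrelevant and not normalised.  The carrier type \<open>'a\<close> plays the role of a universe: below, all
  algebras of one 2-category (and the split extensions witnessing derived actions) have carriers
  in the same type \<open>'a\<close>.  For infinite \<open>'a\<close> this universe is closed under binary products up to
  bijection.
\<close>

definition is_alg :: "('u, 'b) theory_sig \<Rightarrow> ('a, 'u, 'b) alg \<Rightarrow> bool" where
  "is_alg S A \<longleftrightarrow>
     \<zero>\<^bsub>A\<^esub> \<in> carrier A \<and>
     (\<forall>x\<in>carrier A. neg A x \<in> carrier A) \<and>
     (\<forall>x\<in>carrier A. \<forall>y\<in>carrier A. x \<oplus>\<^bsub>A\<^esub> y \<in> carrier A) \<and>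
     (\<forall>w\<in>un_ops S. \<forall>x\<in>carrier A. un A w x \<in> carrier A) \<and>
     (\<forall>m\<in>bin_ops S. \<forall>x\<in>carrier A. \<forall>y\<in>carrier A. bin A m x y \<in> carrier A) \<and>
     (\<forall>(l, r)\<in>eqs S. \<forall>\<rho>. (\<forall>n. \<rho> n \<in> carrier A) \<longrightarrow> trm_val A \<rho> l = trm_val A \<rho> r)"

text \<open>
  The morphisms of \<open>\<C>\<close>. They are extensional functions, so that HOL equality is equality of
  morphisms.
\<close>

definition alg_hom ::
    "('u, 'b) theory_sig \<Rightarrow> ('a, 'u, 'b) alg \<Rightarrow> ('c, 'u, 'b) alg \<Rightarrow> ('a \<Rightarrow> 'c) set" where
  "alg_hom S A B = {f \<in> carrier A \<rightarrow>\<^sub>E carrier B.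
     (\<forall>x\<in>carrier A. \<forall>y\<in>carrier A. f (x \<oplus>\<^bsub>A\<^esub> y) = f x \<oplus>\<^bsub>B\<^esub> f y) \<and>
     (\<forall>x\<in>carrier A. f (neg A x) = neg B (f x)) \<and>
     (\<forall>w\<in>un_ops S. \<forall>x\<in>carrier A. f (un A w x) = un B w (f x)) \<and>
     (\<forall>m\<in>bin_ops S. \<forall>x\<in>carrier A. \<forall>y\<in>carrier A. f (bin A m x y) = bin B m (f x) (f y))}"


section \<open>Strict 2-categories and their equivalences\<close>

text \<open>
  Cells are indexed by their boundary: \<open>cell2 K x y f g\<close> is the set of 2-cells \<open>f \<Rightarrow> g : x \<rightarrow> y\<close>.
  Compositions are written in functional order: \<open>comp1 K x y z g f\<close> is \<open>g \<circ> f\<close>;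
  \<open>vcomp K x y f g h e d\<close> is \<open>d : f \<Rightarrow> g\<close> followed by \<open>e : g \<Rightarrow> h\<close>; and
  \<open>hcomp K x y z f g h k e d\<close> is \<open>d : f \<Rightarrow> g : x \<rightarrow> y\<close> followed by \<open>e : h \<Rightarrow> k : y \<rightarrow> z\<close>.
\<close>

record ('o, 'm, 'c) two_cat =
  ob :: "'o set"
  cell1 :: "'o \<Rightarrow> 'o \<Rightarrow> 'm set"
  cell2 :: "'o \<Rightarrow> 'o \<Rightarrow> 'm \<Rightarrow> 'm \<Rightarrow> 'c set"
  id1 :: "'o \<Rightarrow> 'm"
  comp1 :: "'o \<Rightarrow> 'o \<Rightarrow> 'o \<Rightarrow> 'm \<Rightarrow> 'm \<Rightarrow> 'm"
  id2 :: "'o \<Rightarrow> 'o \<Rightarrow> 'm \<Rightarrow> 'c"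
  vcomp :: "'o \<Rightarrow> 'o \<Rightarrow> 'm \<Rightarrow> 'm \<Rightarrow> 'm \<Rightarrow> 'c \<Rightarrow> 'c \<Rightarrow> 'c"
  hcomp :: "'o \<Rightarrow> 'o \<Rightarrow> 'o \<Rightarrow> 'm \<Rightarrow> 'm \<Rightarrow> 'm \<Rightarrow> 'm \<Rightarrow> 'c \<Rightarrow> 'c \<Rightarrow> 'c"

locale two_category =
  fixes K :: "('o, 'm, 'c) two_cat"
  assumes id1_in: "x \<in> ob K \<Longrightarrow> id1 K x \<in> cell1 K x x"
    and comp1_in:
      "\<lbrakk>x \<in> ob K; y \<in> ob K; z \<in> ob K; f \<in> cell1 K x y; g \<in> cell1 K y z\<rbrakk>
       \<Longrightarrow> comp1 K x y z g f \<in> cell1 K x z"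
    and comp1_id_right:
      "\<lbrakk>x \<in> ob K; y \<in> ob K; f \<in> cell1 K x y\<rbrakk> \<Longrightarrow> comp1 K x x y f (id1 K x) = f"
    and comp1_id_left:
      "\<lbrakk>x \<in> ob K; y \<in> ob K; f \<in> cell1 K x y\<rbrakk> \<Longrightarrow> comp1 K x y y (id1 K y) f = f"
    and comp1_assoc:
      "\<lbrakk>x \<in> ob K; y \<in> ob K; z \<in> ob K; w \<in> ob K;
        f \<in> cell1 K x y; g \<in> cell1 K y z; h \<in> cell1 K z w\<rbrakk>
       \<Longrightarrow> comp1 K x z w h (comp1 K x y z g f) = comp1 K x y w (comp1 K y z w h g) f"
    and id2_in:
      "\<lbrakk>x \<in> ob K; y \<in> ob K; f \<in> cell1 K x y\<rbrakk> \<Longrightarrow> id2 K x y f \<in> cell2 K x y f f"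
    and vcomp_in:
      "\<lbrakk>x \<in> ob K; y \<in> ob K; f \<in> cell1 K x y; g \<in> cell1 K x y; h \<in> cell1 K x y;
        d \<in> cell2 K x y f g; e \<in> cell2 K x y g h\<rbrakk>
       \<Longrightarrow> vcomp K x y f g h e d \<in> cell2 K x y f h"
    and vcomp_id_right:
      "\<lbrakk>x \<in> ob K; y \<in> ob K; f \<in> cell1 K x y; g \<in> cell1 K x y; d \<in> cell2 K x y f g\<rbrakk>
       \<Longrightarrow> vcomp K x y f f g d (id2 K x y f) = d"
    and vcomp_id_left:
      "\<lbrakk>x \<in> ob K; y \<in> ob K; f \<in> cell1 K x y; g \<in> cell1 K x y; d \<in> cell2 K x y f g\<rbrakk>
       \<Longrightarrow> vcomp K x y f g g (id2 K x y g) d = d"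
    and vcomp_assoc:
      "\<lbrakk>x \<in> ob K; y \<in> ob K;
        f \<in> cell1 K x y; g \<in> cell1 K x y; h \<in> cell1 K x y; k \<in> cell1 K x y;
        c \<in> cell2 K x y f g; d \<in> cell2 K x y g h; e \<in> cell2 K x y h k\<rbrakk>
       \<Longrightarrow> vcomp K x y f h k e (vcomp K x y f g h d c) =
           vcomp K x y f g k (vcomp K x y g h k e d) c"
    and hcomp_in:
      "\<lbrakk>x \<in> ob K; y \<in> ob K; z \<in> ob K; f \<in> cell1 K x y; g \<in> cell1 K x y;
        h \<in> cell1 K y z; k \<in> cell1 K y z; d \<in> cell2 K x y f g; e \<in> cell2 K y z h k\<rbrakk>
       \<Longrightarrow> hcomp K x y z f g h k e d \<in> cell2 K x z (comp1 K x y z h f) (comp1 K x y z k g)"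
    and hcomp_id_right:
      "\<lbrakk>x \<in> ob K; y \<in> ob K; f \<in> cell1 K x y; g \<in> cell1 K x y; d \<in> cell2 K x y f g\<rbrakk>
       \<Longrightarrow> hcomp K x x y (id1 K x) (id1 K x) f g d (id2 K x x (id1 K x)) = d"
    and hcomp_id_left:
      "\<lbrakk>x \<in> ob K; y \<in> ob K; f \<in> cell1 K x y; g \<in> cell1 K x y; d \<in> cell2 K x y f g\<rbrakk>
       \<Longrightarrow> hcomp K x y y f g (id1 K y) (id1 K y) (id2 K y y (id1 K y)) d = d"
    and hcomp_assoc:
      "\<lbrakk>x \<in> ob K; y \<in> ob K; z \<in> ob K; w \<in> ob K;
        f \<in> cell1 K x y; f' \<in> cell1 K x y; g \<in> cell1 K y z; g' \<in> cell1 K y z;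
        h \<in> cell1 K z w; h' \<in> cell1 K z w;
        c \<in> cell2 K x y f f'; d \<in> cell2 K y z g g'; e \<in> cell2 K z w h h'\<rbrakk>
       \<Longrightarrow> hcomp K x z w (comp1 K x y z g f) (comp1 K x y z g' f') h h' e
             (hcomp K x y z f f' g g' d c) =
           hcomp K x y w f f' (comp1 K y z w h g) (comp1 K y z w h' g')
             (hcomp K y z w g g' h h' e d) c"
    and hcomp_id2:
      "\<lbrakk>x \<in> ob K; y \<in> ob K; z \<in> ob K; f \<in> cell1 K x y; g \<in> cell1 K y z\<rbrakk>
       \<Longrightarrow> hcomp K x y z f f g g (id2 K y z g) (id2 K x y f) = id2 K x z (comp1 K x y z g f)"
    and interchange:
      "\<lbrakk>x \<in> ob K; y \<in> ob K; z \<in> ob K;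
        f \<in> cell1 K x y; f' \<in> cell1 K x y; f'' \<in> cell1 K x y;
        g \<in> cell1 K y z; g' \<in> cell1 K y z; g'' \<in> cell1 K y z;
        c \<in> cell2 K x y f f'; c' \<in> cell2 K x y f' f'';
        d \<in> cell2 K y z g g'; d' \<in> cell2 K y z g' g''\<rbrakk>
       \<Longrightarrow> hcomp K x y z f f'' g g'' (vcomp K y z g g' g'' d' d) (vcomp K x y f f' f'' c' c) =
           vcomp K x z (comp1 K x y z g f) (comp1 K x y z g' f') (comp1 K x y z g'' f'')
             (hcomp K x y z f' f'' g' g'' d' c') (hcomp K x y z f f' g g' d c)"

record ('o, 'm, 'c, 'p, 'n, 'd) two_fun =
  F0 :: "'o \<Rightarrow> 'p"
  F1 :: "'o \<Rightarrow> 'o \<Rightarrow> 'm \<Rightarrow> 'n"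
  F2 :: "'o \<Rightarrow> 'o \<Rightarrow> 'm \<Rightarrow> 'm \<Rightarrow> 'c \<Rightarrow> 'd"

locale two_functor =
  fixes K :: "('o, 'm, 'c) two_cat"
    and L :: "('p, 'n, 'd) two_cat"
    and F :: "('o, 'm, 'c, 'p, 'n, 'd) two_fun"
  assumes F0_in: "x \<in> ob K \<Longrightarrow> F0 F x \<in> ob L"
    and F1_in:
      "\<lbrakk>x \<in> ob K; y \<in> ob K; f \<in> cell1 K x y\<rbrakk> \<Longrightarrow> F1 F x y f \<in> cell1 L (F0 F x) (F0 F y)"
    and F2_in:
      "\<lbrakk>x \<in> ob K; y \<in> ob K; f \<in> cell1 K x y; g \<in> cell1 K x y; d \<in> cell2 K x y f g\<rbrakk>
       \<Longrightarrow> F2 F x y f g d \<in> cell2 L (F0 F x) (F0 F y) (F1 F x y f) (F1 F x y g)"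
    and F1_id1: "x \<in> ob K \<Longrightarrow> F1 F x x (id1 K x) = id1 L (F0 F x)"
    and F1_comp1:
      "\<lbrakk>x \<in> ob K; y \<in> ob K; z \<in> ob K; f \<in> cell1 K x y; g \<in> cell1 K y z\<rbrakk>
       \<Longrightarrow> F1 F x z (comp1 K x y z g f) =
           comp1 L (F0 F x) (F0 F y) (F0 F z) (F1 F y z g) (F1 F x y f)"
    and F2_id2:
      "\<lbrakk>x \<in> ob K; y \<in> ob K; f \<in> cell1 K x y\<rbrakk>
       \<Longrightarrow> F2 F x y f f (id2 K x y f) = id2 L (F0 F x) (F0 F y) (F1 F x y f)"
    and F2_vcomp:
      "\<lbrakk>x \<in> ob K; y \<in> ob K; f \<in> cell1 K x y; g \<in> cell1 K x y; h \<in> cell1 K x y;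
        d \<in> cell2 K x y f g; e \<in> cell2 K x y g h\<rbrakk>
       \<Longrightarrow> F2 F x y f h (vcomp K x y f g h e d) =
           vcomp L (F0 F x) (F0 F y) (F1 F x y f) (F1 F x y g) (F1 F x y h)
             (F2 F x y g h e) (F2 F x y f g d)"
    and F2_hcomp:
      "\<lbrakk>x \<in> ob K; y \<in> ob K; z \<in> ob K; f \<in> cell1 K x y; g \<in> cell1 K x y;
        h \<in> cell1 K y z; k \<in> cell1 K y z; d \<in> cell2 K x y f g; e \<in> cell2 K y z h k\<rbrakk>
       \<Longrightarrow> F2 F x z (comp1 K x y z h f) (comp1 K x y z k g) (hcomp K x y z f g h k e d) =
           hcomp L (F0 F x) (F0 F y) (F0 F z) (F1 F x y f) (F1 F x y g) (F1 F y z h) (F1 F y z k)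
             (F2 F y z h k e) (F2 F x y f g d)"

definition id_two_fun :: "('o, 'm, 'c, 'o, 'm, 'c) two_fun" where
  "id_two_fun = \<lparr>F0 = (\<lambda>x. x), F1 = (\<lambda>x y f. f), F2 = (\<lambda>x y f g d. d)\<rparr>"

definition comp_two_fun ::
    "('p, 'n, 'd, 'q, 'l, 'e) two_fun \<Rightarrow> ('o, 'm, 'c, 'p, 'n, 'd) two_fun
     \<Rightarrow> ('o, 'm, 'c, 'q, 'l, 'e) two_fun" where
  "comp_two_fun G F = \<lparr>
     F0 = (\<lambda>x. F0 G (F0 F x)),
     F1 = (\<lambda>x y f. F1 G (F0 F x) (F0 F y) (F1 F x y f)),
     F2 = (\<lambda>x y f g d. F2 G (F0 F x) (F0 F y) (F1 F x y f) (F1 F x y g) (F2 F x y f g d))\<rparr>"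

definition iso1 :: "('o, 'm, 'c) two_cat \<Rightarrow> 'o \<Rightarrow> 'o \<Rightarrow> 'm \<Rightarrow> bool" where
  "iso1 K x y f \<longleftrightarrow> f \<in> cell1 K x y \<and>
     (\<exists>g\<in>cell1 K y x. comp1 K x y x g f = id1 K x \<and> comp1 K y x y f g = id1 K y)"

text \<open>2-natural isomorphisms \<open>\<tau> : F \<Rightarrow> G\<close> between 2-functors \<open>F, G : K \<rightarrow> L\<close>.\<close>

locale two_nat_iso =
  fixes K :: "('o, 'm, 'c) two_cat"
    and L :: "('p, 'n, 'd) two_cat"
    and F G :: "('o, 'm, 'c, 'p, 'n, 'd) two_fun"
    and \<tau> :: "'o \<Rightarrow> 'n"
  assumes component_iso: "x \<in> ob K \<Longrightarrow> iso1 L (F0 F x) (F0 G x) (\<tau> x)"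
    and naturality1:
      "\<lbrakk>x \<in> ob K; y \<in> ob K; f \<in> cell1 K x y\<rbrakk>
       \<Longrightarrow> comp1 L (F0 F x) (F0 G x) (F0 G y) (F1 G x y f) (\<tau> x) =
           comp1 L (F0 F x) (F0 F y) (F0 G y) (\<tau> y) (F1 F x y f)"
    and naturality2:
      "\<lbrakk>x \<in> ob K; y \<in> ob K; f \<in> cell1 K x y; g \<in> cell1 K x y; d \<in> cell2 K x y f g\<rbrakk>
       \<Longrightarrow> hcomp L (F0 F x) (F0 G x) (F0 G y) (\<tau> x) (\<tau> x) (F1 G x y f) (F1 G x y g)
             (F2 G x y f g d) (id2 L (F0 F x) (F0 G x) (\<tau> x)) =
           hcomp L (F0 F x) (F0 F y) (F0 G y) (F1 F x y f) (F1 F x y g) (\<tau> y) (\<tau> y)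
             (id2 L (F0 F y) (F0 G y) (\<tau> y)) (F2 F x y f g d)"

definition equivalent_two_categories ::
    "('o, 'm, 'c) two_cat \<Rightarrow> ('p, 'n, 'd) two_cat \<Rightarrow> bool" where
  "equivalent_two_categories K L \<longleftrightarrow>
     two_category K \<and> two_category L \<and>
     (\<exists>F G \<eta> \<epsilon>. two_functor K L F \<and> two_functor L K G \<and>
        two_nat_iso K K id_two_fun (comp_two_fun G F) \<eta> \<and>
        two_nat_iso L L (comp_two_fun F G) id_two_fun \<epsilon>)"


section \<open>The 2-category of crossed modules\<close>

text \<open>
  \<open>xm_act X b a\<close> is \<open>b \<cdot> a\<close> and \<open>xm_star X m b a\<close> is \<open>b * a\<close> for the operation \<open>m\<close>; hence \<open>a * b\<close>
  is \<open>xm_star X (opp S m) b a\<close>.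
\<close>

record ('a, 'u, 'b) xmod =
  xm_top :: "('a, 'u, 'b) alg"
  xm_base :: "('a, 'u, 'b) alg"
  xm_bd :: "'a \<Rightarrow> 'a"
  xm_act :: "'a \<Rightarrow> 'a \<Rightarrow> 'a"
  xm_star :: "'b \<Rightarrow> 'a \<Rightarrow> 'a \<Rightarrow> 'a"

definition split_extension ::
    "('u, 'b) theory_sig \<Rightarrow> ('a, 'u, 'b) alg \<Rightarrow> ('a, 'u, 'b) alg \<Rightarrow> ('a, 'u, 'b) alg
     \<Rightarrow> ('a \<Rightarrow> 'a) \<Rightarrow> ('a \<Rightarrow> 'a) \<Rightarrow> ('a \<Rightarrow> 'a) \<Rightarrow> bool" where
  "split_extension S A E B i p s \<longleftrightarrow>
     is_alg S A \<and> is_alg S E \<and> is_alg S B \<and>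
     i \<in> alg_hom S A E \<and> p \<in> alg_hom S E B \<and> s \<in> alg_hom S B E \<and>
     inj_on i (carrier A) \<and> i ` carrier A = {e \<in> carrier E. p e = \<zero>\<^bsub>B\<^esub>} \<and>
     p ` carrier E = carrier B \<and>
     (\<forall>b\<in>carrier B. p (s b) = b)"

definition derived_actions ::
    "('u, 'b) theory_sig \<Rightarrow> ('a, 'u, 'b) alg \<Rightarrow> ('a, 'u, 'b) alg
     \<Rightarrow> ('a \<Rightarrow> 'a \<Rightarrow> 'a) \<Rightarrow> ('b \<Rightarrow> 'a \<Rightarrow> 'a \<Rightarrow> 'a) \<Rightarrow> bool" where
  "derived_actions S B A act star \<longleftrightarrow>
     (\<forall>b\<in>carrier B. \<forall>a\<in>carrier A. act b a \<in> carrier A) \<and>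
     (\<forall>m\<in>bin_ops S. \<forall>b\<in>carrier B. \<forall>a\<in>carrier A. star m b a \<in> carrier A) \<and>
     (\<exists>E i p s. split_extension S A E B i p s \<and>
        (\<forall>b\<in>carrier B. \<forall>a\<in>carrier A. i (act b a) = s b \<oplus>\<^bsub>E\<^esub> i a \<ominus>\<^bsub>E\<^esub> s b) \<and>
        (\<forall>m\<in>bin_ops S. \<forall>b\<in>carrier B. \<forall>a\<in>carrier A. i (star m b a) = bin E m (s b) (i a)))"

definition crossed_module :: "('u, 'b) theory_sig \<Rightarrow> ('a, 'u, 'b) xmod \<Rightarrow> bool" where
  "crossed_module S X \<longleftrightarrow>
    (let A = xm_top X; B = xm_base X; \<alpha> = xm_bd X; act = xm_act X; star = xm_star X in
     is_alg S A \<and> is_alg S B \<and> \<alpha> \<in> alg_hom S A B \<and> derived_actions S B A act star \<and>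
     (\<forall>b\<in>carrier B. \<forall>a\<in>carrier A. \<alpha> (act b a) = b \<oplus>\<^bsub>B\<^esub> \<alpha> a \<ominus>\<^bsub>B\<^esub> b) \<and>
     (\<forall>a\<in>carrier A. \<forall>a1\<in>carrier A. act (\<alpha> a) a1 = a \<oplus>\<^bsub>A\<^esub> a1 \<ominus>\<^bsub>A\<^esub> a) \<and>
     (\<forall>m\<in>bin_ops S. \<forall>b\<in>carrier B. \<forall>a\<in>carrier A.
        \<alpha> (star m b a) = bin B m b (\<alpha> a) \<and>
        \<alpha> (star (opp S m) b a) = bin B m (\<alpha> a) b) \<and>
     (\<forall>m\<in>bin_ops S. \<forall>a\<in>carrier A. \<forall>a1\<in>carrier A.
        star m (\<alpha> a) a1 = bin A m a a1 \<and>
        bin A m a a1 = star (opp S m) (\<alpha> a1) a))"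

definition xmod_hom ::
    "('u, 'b) theory_sig \<Rightarrow> ('a, 'u, 'b) xmod \<Rightarrow> ('a, 'u, 'b) xmod
     \<Rightarrow> (('a \<Rightarrow> 'a) \<times> ('a \<Rightarrow> 'a)) set" where
  "xmod_hom S X Y = {(f1, f0).
     f1 \<in> alg_hom S (xm_top X) (xm_top Y) \<and>
     f0 \<in> alg_hom S (xm_base X) (xm_base Y) \<and>
     (\<forall>a\<in>carrier (xm_top X). f0 (xm_bd X a) = xm_bd Y (f1 a)) \<and>
     (\<forall>b\<in>carrier (xm_base X). \<forall>a\<in>carrier (xm_top X).
        f1 (xm_act X b a) = xm_act Y (f0 b) (f1 a)) \<and>
     (\<forall>m\<in>bin_ops S. \<forall>b\<in>carrier (xm_base X). \<forall>a\<in>carrier (xm_top X).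
        f1 (xm_star X m b a) = xm_star Y m (f0 b) (f1 a))}"

definition xmod_homotopy ::
    "('u, 'b) theory_sig \<Rightarrow> ('a, 'u, 'b) xmod \<Rightarrow> ('a, 'u, 'b) xmod
     \<Rightarrow> ('a \<Rightarrow> 'a) \<times> ('a \<Rightarrow> 'a) \<Rightarrow> ('a \<Rightarrow> 'a) \<times> ('a \<Rightarrow> 'a) \<Rightarrow> ('a \<Rightarrow> 'a) set" where
  "xmod_homotopy S X Y f g =
    (let A = xm_top X; B = xm_base X; C = xm_top Y; D = xm_base Y; (f1, f0) = f; (g1, g0) = g in
     {d \<in> carrier B \<rightarrow>\<^sub>E carrier C.
       (\<forall>b\<in>carrier B. \<forall>b1\<in>carrier B. d (b \<oplus>\<^bsub>B\<^esub> b1) = d b \<oplus>\<^bsub>C\<^esub> xm_act Y (f0 b) (d b1)) \<and>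
       (\<forall>m\<in>bin_ops S. \<forall>b\<in>carrier B. \<forall>b1\<in>carrier B.
          d (bin B m b b1) =
            bin C m (d b) (d b1) \<oplus>\<^bsub>C\<^esub> xm_star Y (opp S m) (f0 b1) (d b)
              \<oplus>\<^bsub>C\<^esub> xm_star Y m (f0 b) (d b1)) \<and>
       (\<forall>w\<in>un_ops S. \<forall>b\<in>carrier B. d (un B w b) = un C w (d b)) \<and>
       (\<forall>b\<in>carrier B. xm_bd Y (d b) = g0 b \<ominus>\<^bsub>D\<^esub> f0 b) \<and>
       (\<forall>a\<in>carrier A. d (xm_bd X a) = g1 a \<ominus>\<^bsub>C\<^esub> f1 a)})"

definition XMod ::
    "('u, 'b) theory_sig
     \<Rightarrow> (('a, 'u, 'b) xmod, ('a \<Rightarrow> 'a) \<times> ('a \<Rightarrow> 'a), 'a \<Rightarrow> 'a) two_cat" where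
  "XMod S = \<lparr>
     ob = {X. crossed_module S X},
     cell1 = xmod_hom S,
     cell2 = xmod_homotopy S,
     id1 = (\<lambda>X. (\<lambda>a\<in>carrier (xm_top X). a, \<lambda>b\<in>carrier (xm_base X). b)),
     comp1 = (\<lambda>X Y Z (g1, g0) (f1, f0).
       (compose (carrier (xm_top X)) g1 f1, compose (carrier (xm_base X)) g0 f0)),
     id2 = (\<lambda>X Y f. \<lambda>b\<in>carrier (xm_base X). \<zero>\<^bsub>xm_top Y\<^esub>),
     vcomp = (\<lambda>X Y f g h e d. \<lambda>b\<in>carrier (xm_base X). e b \<oplus>\<^bsub>xm_top Y\<^esub> d b),
     hcomp = (\<lambda>X Y Z (f1, f0) (g1, g0) (h1, h0) (k1, k0) e d.
       \<lambda>b\<in>carrier (xm_base X). e (g0 b) \<oplus>\<^bsub>xm_top Z\<^esub> h1 (d b))\<rparr>"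


section \<open>The 2-category of internal categories\<close>

record ('a, 'u, 'b) icat =
  ic_mor :: "('a, 'u, 'b) alg"
  ic_ob :: "('a, 'u, 'b) alg"
  src :: "'a \<Rightarrow> 'a"
  tgt :: "'a \<Rightarrow> 'a"
  ide :: "'a \<Rightarrow> 'a"
  cmp :: "'a \<times> 'a \<Rightarrow> 'a"

text \<open>The pullback of \<open>src\<close> and \<open>tgt\<close>, i.e. the pairs \<open>(b, a)\<close> for which \<open>b \<circ> a\<close> is defined.\<close>

definition composable_pairs :: "('a, 'u, 'b) icat \<Rightarrow> ('a \<times> 'a, 'u, 'b) alg" where
  "composable_pairs G = (let M = ic_mor G in \<lparr>
     carrier = {(b, a). b \<in> carrier M \<and> a \<in> carrier M \<and> src G b = tgt G a},
     zero = (\<zero>\<^bsub>M\<^esub>, \<zero>\<^bsub>M\<^esub>),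
     neg = (\<lambda>(b, a). (neg M b, neg M a)),
     add = (\<lambda>(b, a) (b', a'). (b \<oplus>\<^bsub>M\<^esub> b', a \<oplus>\<^bsub>M\<^esub> a')),
     un = (\<lambda>w (b, a). (un M w b, un M w a)),
     bin = (\<lambda>m (b, a) (b', a'). (bin M m b b', bin M m a a'))\<rparr>)"

definition internal_category :: "('u, 'b) theory_sig \<Rightarrow> ('a, 'u, 'b) icat \<Rightarrow> bool" where
  "internal_category S G \<longleftrightarrow>
    (let G1 = ic_mor G; G0 = ic_ob G in
     is_alg S G1 \<and> is_alg S G0 \<and>
     src G \<in> alg_hom S G1 G0 \<and> tgt G \<in> alg_hom S G1 G0 \<and> ide G \<in> alg_hom S G0 G1 \<and>
     cmp G \<in> alg_hom S (composable_pairs G) G1 \<and>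
     (\<forall>x\<in>carrier G0. src G (ide G x) = x \<and> tgt G (ide G x) = x) \<and>
     (\<forall>a\<in>carrier G1. \<forall>b\<in>carrier G1. src G b = tgt G a \<longrightarrow>
        src G (cmp G (b, a)) = src G a \<and> tgt G (cmp G (b, a)) = tgt G b) \<and>
     (\<forall>a\<in>carrier G1. cmp G (a, ide G (src G a)) = a \<and> cmp G (ide G (tgt G a), a) = a) \<and>
     (\<forall>a\<in>carrier G1. \<forall>b\<in>carrier G1. \<forall>c\<in>carrier G1.
        src G b = tgt G a \<longrightarrow> src G c = tgt G b \<longrightarrow>
        cmp G (c, cmp G (b, a)) = cmp G (cmp G (c, b), a)))"

text \<open>Internal functors are written \<open>(f1, f0)\<close>: the morphism part comes first.\<close>

definition internal_functor ::
    "('u, 'b) theory_sig \<Rightarrow> ('a, 'u, 'b) icat \<Rightarrow> ('a, 'u, 'b) icat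
     \<Rightarrow> (('a \<Rightarrow> 'a) \<times> ('a \<Rightarrow> 'a)) set" where
  "internal_functor S G H = {(f1, f0).
     f1 \<in> alg_hom S (ic_mor G) (ic_mor H) \<and>
     f0 \<in> alg_hom S (ic_ob G) (ic_ob H) \<and>
     (\<forall>a\<in>carrier (ic_mor G). src H (f1 a) = f0 (src G a) \<and> tgt H (f1 a) = f0 (tgt G a)) \<and>
     (\<forall>x\<in>carrier (ic_ob G). f1 (ide G x) = ide H (f0 x)) \<and>
     (\<forall>a\<in>carrier (ic_mor G). \<forall>b\<in>carrier (ic_mor G). src G b = tgt G a \<longrightarrow>
        f1 (cmp G (b, a)) = cmp H (f1 b, f1 a))}"

definition ic_invertible :: "('a, 'u, 'b) icat \<Rightarrow> 'a \<Rightarrow> bool" where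
  "ic_invertible G a \<longleftrightarrow> a \<in> carrier (ic_mor G) \<and>
     (\<exists>b\<in>carrier (ic_mor G). src G b = tgt G a \<and> tgt G b = src G a \<and>
        cmp G (b, a) = ide G (src G a) \<and> cmp G (a, b) = ide G (tgt G a))"

definition internal_homotopy ::
    "('u, 'b) theory_sig \<Rightarrow> ('a, 'u, 'b) icat \<Rightarrow> ('a, 'u, 'b) icat
     \<Rightarrow> ('a \<Rightarrow> 'a) \<times> ('a \<Rightarrow> 'a) \<Rightarrow> ('a \<Rightarrow> 'a) \<times> ('a \<Rightarrow> 'a) \<Rightarrow> ('a \<Rightarrow> 'a) set" where
  "internal_homotopy S G H f g =
    (let (f1, f0) = f; (g1, g0) = g in
     {\<eta> \<in> alg_hom S (ic_ob G) (ic_mor H).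
       (\<forall>x\<in>carrier (ic_ob G).
          src H (\<eta> x) = f0 x \<and> tgt H (\<eta> x) = g0 x \<and> ic_invertible H (\<eta> x)) \<and>
       (\<forall>a\<in>carrier (ic_mor G).
          cmp H (\<eta> (tgt G a), f1 a) = cmp H (g1 a, \<eta> (src G a)))})"

definition ICat ::
    "('u, 'b) theory_sig
     \<Rightarrow> (('a, 'u, 'b) icat, ('a \<Rightarrow> 'a) \<times> ('a \<Rightarrow> 'a), 'a \<Rightarrow> 'a) two_cat" where
  "ICat S = \<lparr>
     ob = {G. internal_category S G},
     cell1 = internal_functor S,
     cell2 = internal_homotopy S,
     id1 = (\<lambda>G. (\<lambda>a\<in>carrier (ic_mor G). a, \<lambda>x\<in>carrier (ic_ob G). x)),
     comp1 = (\<lambda>G H I (g1, g0) (f1, f0).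
       (compose (carrier (ic_mor G)) g1 f1, compose (carrier (ic_ob G)) g0 f0)),
     id2 = (\<lambda>G H (f1, f0). \<lambda>x\<in>carrier (ic_ob G). ide H (f0 x)),
     vcomp = (\<lambda>G H f g h e d. \<lambda>x\<in>carrier (ic_ob G). cmp H (e x, d x)),
     hcomp = (\<lambda>G H I (f1, f0) (g1, g0) (h1, h0) (k1, k0) e d.
       \<lambda>x\<in>carrier (ic_ob G). cmp I (e (g0 x), h1 (d x)))\<rparr>"

end

theory Submission
  imports Defs
begin

text \<open>
  The equivalence is induced by the 2-functor from internal categories to crossed modules that sends
  \<open>G\<close> to \<open>tgt : ker src \<rightarrow> ob G\<close>, on which \<open>ob G\<close> acts through identities.

  Everything rests on one split extension: the source map of \<open>G\<close> is split by the identity map. So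
  every morphism is uniquely \<open>k + 1\<^sub>x\<close> with \<open>k\<close> in the kernel of the source map, and the algebra of
  morphisms is the semidirect product of \<open>ob G\<close> with that kernel. Moreover composition is forced: since
  it is a morphism in \<open>\<C>\<close>, \<open>b \<circ> a = b - 1 + a\<close>, and such a formula is a morphism exactly when the
  kernels of source and target commute and annihilate each other under every \<open>*\<close>
  (\<open>internal_category_graph_category\<close>, \<open>kernels_annihilate\<close>). In the semidirect product this condition
  says precisely that the boundary \<open>\<alpha>\<close> satisfies the Peiffer laws \<open>\<alpha> a \<cdot> a1 = a + a1 - a\<close> and
  \<open>\<alpha> a * a1 = a * a1 = a * \<alpha> a1\<close>. Hence an extension that defines the actions of a crossed module
  carries an internal category whose kernel is the given crossed module: the 2-functor is essentially
  surjective (\<open>iso1_kernel_xmod\<close>).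

  It is also bijective on cells. A functor is determined by its restriction to the kernel and its effect
  on objects, and every compatible pair extends, since composition is a formula. For 2-cells, a map
  \<open>\<eta> = d + 1\<^sub>f\<close> into the semidirect product is a morphism of algebras if and only if \<open>d\<close> is a derivation
  (\<open>lift_hom_iff_derivation\<close>); the remaining two laws of a homotopy \<open>d\<close> are the target and the
  naturality of \<open>\<eta>\<close> (\<open>internal_homotopy_iff_xmod_homotopy\<close>).

  The laws of a 2-category are checked for crossed modules only, where 2-cells are added pointwise. They
  hold for internal categories because the 2-functor is injective on cells and carries every operation
  to its counterpart; the same bijections and a choice of preimages of objects give the inverse
  2-functor (\<open>equivalence_if_essentially_surjective\<close>).
\<close>

section \<open>Algebras and their morphisms\<close>

locale operation_algebra = groups_with_operations S
  for S :: "('u, 'b) theory_sig" +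
  fixes A :: "('a, 'u, 'b) alg" (structure)
  assumes is_alg: "is_alg S A"
begin

lemma zero_closed [simp]: "\<zero> \<in> carrier A"
  and neg_closed [simp]: "x \<in> carrier A \<Longrightarrow> neg A x \<in> carrier A"
  and add_closed [simp]: "\<lbrakk>x \<in> carrier A; y \<in> carrier A\<rbrakk> \<Longrightarrow> x \<oplus> y \<in> carrier A"
  and un_closed [simp]: "\<lbrakk>w \<in> un_ops S; x \<in> carrier A\<rbrakk> \<Longrightarrow> un A w x \<in> carrier A"
  and bin_closed [simp]:
    "\<lbrakk>m \<in> bin_ops S; x \<in> carrier A; y \<in> carrier A\<rbrakk> \<Longrightarrow> bin A m x y \<in> carrier A"
  using is_alg by (simp_all add: is_alg_def)

lemma diff_closed [simp]: "\<lbrakk>x \<in> carrier A; y \<in> carrier A\<rbrakk> \<Longrightarrow> x \<ominus> y \<in> carrier A"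
  by (simp add: diff_def)

text \<open>The group and distributivity laws use the variables 0, 1, 2, so three values give an instance.\<close>

lemma identity_holds:
  assumes "(l, r) \<in> eqs S" "x \<in> carrier A" "y \<in> carrier A" "z \<in> carrier A"
  shows "trm_val A (\<lambda>n. if n = 0 then x else if n = 1 then y else z) l =
         trm_val A (\<lambda>n. if n = 0 then x else if n = 1 then y else z) r"
proof -
  have "\<forall>\<rho>. (\<forall>n. \<rho> n \<in> carrier A) \<longrightarrow> trm_val A \<rho> l = trm_val A \<rho> r"
    using is_alg assms(1) unfolding is_alg_def by blast
  then show ?thesis using assms by simp
qed

lemma group_identity_holds:
  assumes "(l, r) \<in> group_eqs" "x \<in> carrier A" "y \<in> carrier A" "z \<in> carrier A"
  shows "trm_val A (\<lambda>n. if n = 0 then x else if n = 1 then y else z) l =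
         trm_val A (\<lambda>n. if n = 0 then x else if n = 1 then y else z) r"
  by (rule identity_holds[OF subsetD[OF group_eqs assms(1)] assms(2-4)])

lemma operation_identity_holds:
  assumes "(l, r) \<in> operation_eqs S" "x \<in> carrier A" "y \<in> carrier A" "z \<in> carrier A"
  shows "trm_val A (\<lambda>n. if n = 0 then x else if n = 1 then y else z) l =
         trm_val A (\<lambda>n. if n = 0 then x else if n = 1 then y else z) r"
  by (rule identity_holds[OF subsetD[OF operation_eqs assms(1)] assms(2-4)])

lemma add_assoc [simp]:
  "\<lbrakk>x \<in> carrier A; y \<in> carrier A; z \<in> carrier A\<rbrakk> \<Longrightarrow> x \<oplus> y \<oplus> z = x \<oplus> (y \<oplus> z)"
  using group_identity_holds[of "Plus (Plus (Var 0) (Var 1)) (Var 2)"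
      "Plus (Var 0) (Plus (Var 1) (Var 2))" x y z]
  by (simp add: group_eqs_def Let_def)

lemma add_zero_left [simp]: "x \<in> carrier A \<Longrightarrow> \<zero> \<oplus> x = x"
  using group_identity_holds[of "Plus Zero (Var 0)" "Var 0" x x x]
  by (simp add: group_eqs_def Let_def)

lemma add_zero_right [simp]: "x \<in> carrier A \<Longrightarrow> x \<oplus> \<zero> = x"
  using group_identity_holds[of "Plus (Var 0) Zero" "Var 0" x x x]
  by (simp add: group_eqs_def Let_def)

lemma neg_add_self [simp]: "x \<in> carrier A \<Longrightarrow> neg A x \<oplus> x = \<zero>"
  using group_identity_holds[of "Plus (Neg (Var 0)) (Var 0)" Zero x x x]
  by (simp add: group_eqs_def Let_def)

lemma add_neg_self [simp]: "x \<in> carrier A \<Longrightarrow> x \<oplus> neg A x = \<zero>"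
  using group_identity_holds[of "Plus (Var 0) (Neg (Var 0))" Zero x x x]
  by (simp add: group_eqs_def Let_def)

text \<open>
  With associativity and the laws of zero and inverses, the following lemmas are the convergent
  rewrite system for free groups, so simplification decides the word problem.
\<close>

lemma neg_add_cancel_left [simp]:
  "\<lbrakk>x \<in> carrier A; y \<in> carrier A\<rbrakk> \<Longrightarrow> neg A x \<oplus> (x \<oplus> y) = y"
  using add_assoc[of "neg A x" x y, symmetric] by (simp del: add_assoc)

lemma add_neg_cancel_left [simp]:
  "\<lbrakk>x \<in> carrier A; y \<in> carrier A\<rbrakk> \<Longrightarrow> x \<oplus> (neg A x \<oplus> y) = y"
  using add_assoc[of x "neg A x" y, symmetric] by (simp del: add_assoc)

lemma add_left_cancel:
  assumes "x \<in> carrier A" "y \<in> carrier A" "z \<in> carrier A"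
  shows "x \<oplus> y = x \<oplus> z \<longleftrightarrow> y = z"
proof
  assume "x \<oplus> y = x \<oplus> z"
  then have "neg A x \<oplus> (x \<oplus> y) = neg A x \<oplus> (x \<oplus> z)" by (rule arg_cong)
  then show "y = z" using assms by simp
qed simp

lemma add_right_cancel:
  assumes "x \<in> carrier A" "y \<in> carrier A" "z \<in> carrier A"
  shows "y \<oplus> x = z \<oplus> x \<longleftrightarrow> y = z"
proof
  assume "y \<oplus> x = z \<oplus> x"
  then have "y \<oplus> x \<oplus> neg A x = z \<oplus> x \<oplus> neg A x" by (rule arg_cong)
  then show "y = z" using assms by simp
qed simp

lemma neg_unique: "\<lbrakk>x \<in> carrier A; y \<in> carrier A; x \<oplus> y = \<zero>\<rbrakk> \<Longrightarrow> y = neg A x"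
  using neg_add_cancel_left[of x y] by simp

lemma neg_neg [simp]: "x \<in> carrier A \<Longrightarrow> neg A (neg A x) = x"
  by (rule neg_unique[symmetric]) simp_all

lemma neg_zero [simp]: "neg A \<zero> = \<zero>"
  using neg_unique[of \<zero> \<zero>] by simp

lemma neg_add [simp]:
  "\<lbrakk>x \<in> carrier A; y \<in> carrier A\<rbrakk> \<Longrightarrow> neg A (x \<oplus> y) = neg A y \<oplus> neg A x"
  by (rule neg_unique[symmetric]) simp_all

lemma idempotent_zero: "\<lbrakk>x \<in> carrier A; x \<oplus> x = x\<rbrakk> \<Longrightarrow> x = \<zero>"
  using add_left_cancel[of x x \<zero>] by simp

lemma diff_eq_iff:
  "\<lbrakk>x \<in> carrier A; y \<in> carrier A; z \<in> carrier A\<rbrakk> \<Longrightarrow> x = y \<ominus> z \<longleftrightarrow> x \<oplus> z = y"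
  by (auto simp: diff_def)

lemma un_add [simp]:
  "\<lbrakk>w \<in> un_ops S; x \<in> carrier A; y \<in> carrier A\<rbrakk> \<Longrightarrow> un A w (x \<oplus> y) = un A w x \<oplus> un A w y"
  using operation_identity_holds[of "UnOp w (Plus (Var 0) (Var 1))"
      "Plus (UnOp w (Var 0)) (UnOp w (Var 1))" x y y]
  by (simp add: operation_eqs_def Let_def)

lemma un_zero [simp]: "w \<in> un_ops S \<Longrightarrow> un A w \<zero> = \<zero>"
  by (rule idempotent_zero) (simp_all flip: un_add)

lemma un_neg [simp]: "\<lbrakk>w \<in> un_ops S; x \<in> carrier A\<rbrakk> \<Longrightarrow> un A w (neg A x) = neg A (un A w x)"
  by (rule neg_unique) (simp_all flip: un_add)

lemma bin_add_right [simp]: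
  "\<lbrakk>m \<in> bin_ops S; x \<in> carrier A; y \<in> carrier A; z \<in> carrier A\<rbrakk>
   \<Longrightarrow> bin A m x (y \<oplus> z) = bin A m x y \<oplus> bin A m x z"
  using operation_identity_holds[of "BinOp m (Var 0) (Plus (Var 1) (Var 2))"
      "Plus (BinOp m (Var 0) (Var 1)) (BinOp m (Var 0) (Var 2))" x y z]
  by (simp add: operation_eqs_def Let_def)

lemma bin_opp:
  "\<lbrakk>m \<in> bin_ops S; x \<in> carrier A; y \<in> carrier A\<rbrakk> \<Longrightarrow> bin A (opp S m) x y = bin A m y x"
  using operation_identity_holds[of "BinOp (opp S m) (Var 0) (Var 1)"
      "BinOp m (Var 1) (Var 0)" x y y]
  by (simp add: operation_eqs_def Let_def)

text \<open>Only right distributivity is an axiom; the left one is that of the opposite operation.\<close>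

lemma bin_add_left [simp]:
  assumes "m \<in> bin_ops S" "x \<in> carrier A" "y \<in> carrier A" "z \<in> carrier A"
  shows "bin A m (x \<oplus> y) z = bin A m x z \<oplus> bin A m y z"
proof -
  have "bin A m (x \<oplus> y) z = bin A (opp S m) z (x \<oplus> y)" using assms by (simp only: bin_opp add_closed)
  also have "\<dots> = bin A (opp S m) z x \<oplus> bin A (opp S m) z y" using assms by (simp add: opp_closed)
  finally show ?thesis using assms by (simp add: bin_opp)
qed

lemma bin_zero_right [simp]:
  "\<lbrakk>m \<in> bin_ops S; x \<in> carrier A\<rbrakk> \<Longrightarrow> bin A m x \<zero> = \<zero>"
  by (rule idempotent_zero) (simp_all flip: bin_add_right)

lemma bin_zero_left [simp]:
  "\<lbrakk>m \<in> bin_ops S; x \<in> carrier A\<rbrakk> \<Longrightarrow> bin A m \<zero> x = \<zero>"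
  by (rule idempotent_zero) (simp_all flip: bin_add_left)

lemma bin_neg_right [simp]:
  "\<lbrakk>m \<in> bin_ops S; x \<in> carrier A; y \<in> carrier A\<rbrakk>
   \<Longrightarrow> bin A m x (neg A y) = neg A (bin A m x y)"
  by (rule neg_unique) (simp_all flip: bin_add_right)

lemma bin_neg_left [simp]:
  "\<lbrakk>m \<in> bin_ops S; x \<in> carrier A; y \<in> carrier A\<rbrakk>
   \<Longrightarrow> bin A m (neg A x) y = neg A (bin A m x y)"
  by (rule neg_unique) (simp_all flip: bin_add_left)

end

locale alg_morphism = A: operation_algebra S A + B: operation_algebra S B
  for S :: "('u, 'b) theory_sig" and A :: "('a, 'u, 'b) alg" and B :: "('c, 'u, 'b) alg" +
  fixes f :: "'a \<Rightarrow> 'c"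
  assumes hom: "f \<in> alg_hom S A B"
begin

lemma closed [simp]: "x \<in> carrier A \<Longrightarrow> f x \<in> carrier B"
  and map_add [simp]:
    "\<lbrakk>x \<in> carrier A; y \<in> carrier A\<rbrakk> \<Longrightarrow> f (x \<oplus>\<^bsub>A\<^esub> y) = f x \<oplus>\<^bsub>B\<^esub> f y"
  and map_neg [simp]: "x \<in> carrier A \<Longrightarrow> f (neg A x) = neg B (f x)"
  and map_un [simp]: "\<lbrakk>w \<in> un_ops S; x \<in> carrier A\<rbrakk> \<Longrightarrow> f (un A w x) = un B w (f x)"
  and map_bin [simp]:
    "\<lbrakk>m \<in> bin_ops S; x \<in> carrier A; y \<in> carrier A\<rbrakk> \<Longrightarrow> f (bin A m x y) = bin B m (f x) (f y)"
  using hom by (auto simp: alg_hom_def)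

lemma map_zero [simp]: "f \<zero>\<^bsub>A\<^esub> = \<zero>\<^bsub>B\<^esub>"
  by (rule B.idempotent_zero) (simp_all flip: map_add)

lemma map_diff: "\<lbrakk>x \<in> carrier A; y \<in> carrier A\<rbrakk> \<Longrightarrow> f (x \<ominus>\<^bsub>A\<^esub> y) = f x \<ominus>\<^bsub>B\<^esub> f y"
  by (simp add: diff_def)

lemma extensional: "f \<in> extensional (carrier A)"
  using hom by (simp add: alg_hom_def PiE_def)

end

text \<open>Preservation of negatives is automatic between groups.\<close>

lemma alg_homI:
  assumes "operation_algebra S A" "operation_algebra S B"
    and "f \<in> carrier A \<rightarrow>\<^sub>E carrier B"
    and add: "\<And>x y. \<lbrakk>x \<in> carrier A; y \<in> carrier A\<rbrakk> \<Longrightarrow> f (x \<oplus>\<^bsub>A\<^esub> y) = f x \<oplus>\<^bsub>B\<^esub> f y"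
    and "\<And>w x. \<lbrakk>w \<in> un_ops S; x \<in> carrier A\<rbrakk> \<Longrightarrow> f (un A w x) = un B w (f x)"
    and "\<And>m x y. \<lbrakk>m \<in> bin_ops S; x \<in> carrier A; y \<in> carrier A\<rbrakk>
      \<Longrightarrow> f (bin A m x y) = bin B m (f x) (f y)"
  shows "f \<in> alg_hom S A B"
proof -
  interpret A: operation_algebra S A by fact
  interpret B: operation_algebra S B by fact
  have f_in [simp]: "f x \<in> carrier B" if "x \<in> carrier A" for x
    using assms(3) that by auto
  have zero: "f \<zero>\<^bsub>A\<^esub> = \<zero>\<^bsub>B\<^esub>"
    by (rule B.idempotent_zero) (simp_all flip: add)
  have "f (neg A x) = neg B (f x)" if "x \<in> carrier A" for x
    using that by (intro B.neg_unique) (simp_all add: zero flip: add)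
  then show ?thesis using assms by (simp add: alg_hom_def)
qed

lemma compose_alg_hom:
  assumes "is_alg S A" "f \<in> alg_hom S A B" "g \<in> alg_hom S B C"
  shows "compose (carrier A) g f \<in> alg_hom S A C"
proof -
  have "f x \<in> carrier B" if "x \<in> carrier A" for x
    using assms(2) that by (auto simp: alg_hom_def)
  moreover have "g y \<in> carrier C" if "y \<in> carrier B" for y
    using assms(3) that by (auto simp: alg_hom_def)
  ultimately show ?thesis using assms by (simp add: alg_hom_def is_alg_def compose_def)
qed

lemma identity_alg_hom: "is_alg S A \<Longrightarrow> (\<lambda>x\<in>carrier A. x) \<in> alg_hom S A A"
  by (simp add: alg_hom_def is_alg_def)

section \<open>Split extensions as semidirect products\<close>

locale split_ext =
  A: operation_algebra S A + E: operation_algebra S E + B: operation_algebra S B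
  for S :: "('u, 'b) theory_sig" and A E B :: "('a, 'u, 'b) alg" +
  fixes i p s :: "'a \<Rightarrow> 'a" and act :: "'a \<Rightarrow> 'a \<Rightarrow> 'a" and star :: "'b \<Rightarrow> 'a \<Rightarrow> 'a \<Rightarrow> 'a"
  assumes extension: "split_extension S A E B i p s"
    and act_closed [simp]: "\<lbrakk>b \<in> carrier B; a \<in> carrier A\<rbrakk> \<Longrightarrow> act b a \<in> carrier A"
    and star_closed [simp]:
      "\<lbrakk>m \<in> bin_ops S; b \<in> carrier B; a \<in> carrier A\<rbrakk> \<Longrightarrow> star m b a \<in> carrier A"
    and i_act: "\<lbrakk>b \<in> carrier B; a \<in> carrier A\<rbrakk> \<Longrightarrow> i (act b a) = s b \<oplus>\<^bsub>E\<^esub> i a \<ominus>\<^bsub>E\<^esub> s b"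
    and i_star:
      "\<lbrakk>m \<in> bin_ops S; b \<in> carrier B; a \<in> carrier A\<rbrakk> \<Longrightarrow> i (star m b a) = bin E m (s b) (i a)"
begin

sublocale i: alg_morphism S A E i
  by unfold_locales (use extension in \<open>simp add: split_extension_def\<close>)

sublocale p: alg_morphism S E B p
  by unfold_locales (use extension in \<open>simp add: split_extension_def\<close>)

sublocale s: alg_morphism S B E s
  by unfold_locales (use extension in \<open>simp add: split_extension_def\<close>)

lemma i_eq_iff: "\<lbrakk>a \<in> carrier A; a' \<in> carrier A\<rbrakk> \<Longrightarrow> i a = i a' \<longleftrightarrow> a = a'"
  using extension by (auto simp: split_extension_def inj_on_def)

lemma p_i [simp]: "a \<in> carrier A \<Longrightarrow> p (i a) = \<zero>\<^bsub>B\<^esub>"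
  using extension by (auto simp: split_extension_def)

lemma p_s [simp]: "b \<in> carrier B \<Longrightarrow> p (s b) = b"
  using extension by (auto simp: split_extension_def)

lemma in_image_i: "\<lbrakk>e \<in> carrier E; p e = \<zero>\<^bsub>B\<^esub>\<rbrakk> \<Longrightarrow> e \<in> i ` carrier A"
  using extension by (simp add: split_extension_def)

text \<open>The first coordinate in the semidirect product; the second one is \<open>p\<close>.\<close>

definition ker_part :: "'a \<Rightarrow> 'a" where
  "ker_part e = inv_into (carrier A) i (e \<ominus>\<^bsub>E\<^esub> s (p e))"

lemma
  assumes "e \<in> carrier E"
  shows ker_part_closed [simp]: "ker_part e \<in> carrier A"
    and i_ker_part: "i (ker_part e) = e \<ominus>\<^bsub>E\<^esub> s (p e)"
proof -
  have "e \<ominus>\<^bsub>E\<^esub> s (p e) \<in> i ` carrier A"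
    using assms by (intro in_image_i) (simp_all add: diff_def)
  then show "ker_part e \<in> carrier A" "i (ker_part e) = e \<ominus>\<^bsub>E\<^esub> s (p e)"
    unfolding ker_part_def by (rule inv_into_into, rule f_inv_into_f)
qed

lemma decompose [simp]: "e \<in> carrier E \<Longrightarrow> i (ker_part e) \<oplus>\<^bsub>E\<^esub> s (p e) = e"
  by (simp add: i_ker_part diff_def)

lemma pair_cases:
  assumes "e \<in> carrier E"
  obtains a b where "a \<in> carrier A" "b \<in> carrier B" "e = i a \<oplus>\<^bsub>E\<^esub> s b"
  using assms decompose[of e] by (metis ker_part_closed p.closed)

lemma ker_part_pair [simp]:
  "\<lbrakk>a \<in> carrier A; b \<in> carrier B\<rbrakk> \<Longrightarrow> ker_part (i a \<oplus>\<^bsub>E\<^esub> s b) = a"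
  by (simp add: i_ker_part diff_def flip: i_eq_iff)

lemma pair_eq_iff:
  assumes "a \<in> carrier A" "a' \<in> carrier A" "b \<in> carrier B" "b' \<in> carrier B"
  shows "i a \<oplus>\<^bsub>E\<^esub> s b = i a' \<oplus>\<^bsub>E\<^esub> s b' \<longleftrightarrow> a = a' \<and> b = b'"
proof
  assume eq: "i a \<oplus>\<^bsub>E\<^esub> s b = i a' \<oplus>\<^bsub>E\<^esub> s b'"
  show "a = a' \<and> b = b'"
    using arg_cong[OF eq, of ker_part] arg_cong[OF eq, of p] assms by simp
qed simp

lemma i_star_opp:
  "\<lbrakk>m \<in> bin_ops S; b \<in> carrier B; a \<in> carrier A\<rbrakk>
   \<Longrightarrow> i (star (opp S m) b a) = bin E m (i a) (s b)"
  by (simp add: i_star E.bin_opp A.opp_closed)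

text \<open>
  In coordinates \<open>(a, b) = i a + s b\<close> the operations of \<open>E\<close> are those of the semidirect product
  determined by the actions.
\<close>

lemma pair_add:
  "\<lbrakk>a \<in> carrier A; a' \<in> carrier A; b \<in> carrier B; b' \<in> carrier B\<rbrakk>
   \<Longrightarrow> (i a \<oplus>\<^bsub>E\<^esub> s b) \<oplus>\<^bsub>E\<^esub> (i a' \<oplus>\<^bsub>E\<^esub> s b') = i (a \<oplus>\<^bsub>A\<^esub> act b a') \<oplus>\<^bsub>E\<^esub> s (b \<oplus>\<^bsub>B\<^esub> b')"
  by (simp add: i_act diff_def)

lemma pair_un:
  "\<lbrakk>w \<in> un_ops S; a \<in> carrier A; b \<in> carrier B\<rbrakk>
   \<Longrightarrow> un E w (i a \<oplus>\<^bsub>E\<^esub> s b) = i (un A w a) \<oplus>\<^bsub>E\<^esub> s (un B w b)"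
  by simp

lemma pair_bin:
  "\<lbrakk>m \<in> bin_ops S; a \<in> carrier A; a' \<in> carrier A; b \<in> carrier B; b' \<in> carrier B\<rbrakk>
   \<Longrightarrow> bin E m (i a \<oplus>\<^bsub>E\<^esub> s b) (i a' \<oplus>\<^bsub>E\<^esub> s b') =
       i (bin A m a a' \<oplus>\<^bsub>A\<^esub> star (opp S m) b' a \<oplus>\<^bsub>A\<^esub> star m b a') \<oplus>\<^bsub>E\<^esub> s (bin B m b b')"
  by (subst E.bin_add_left) (simp_all add: i_star E.bin_opp A.opp_closed)

text \<open>
  The crossed homomorphisms over \<open>f\<close>. They are the first components of the algebra morphisms into
  the semidirect product whose second component is \<open>f\<close>.
\<close>

definition derivation :: "('a, 'u, 'b) alg \<Rightarrow> ('a \<Rightarrow> 'a) \<Rightarrow> ('a \<Rightarrow> 'a) \<Rightarrow> bool" where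
  "derivation D f d \<longleftrightarrow>
     (\<forall>b\<in>carrier D. \<forall>b1\<in>carrier D. d (b \<oplus>\<^bsub>D\<^esub> b1) = d b \<oplus>\<^bsub>A\<^esub> act (f b) (d b1)) \<and>
     (\<forall>m\<in>bin_ops S. \<forall>b\<in>carrier D. \<forall>b1\<in>carrier D.
        d (bin D m b b1) =
          bin A m (d b) (d b1) \<oplus>\<^bsub>A\<^esub> star (opp S m) (f b1) (d b) \<oplus>\<^bsub>A\<^esub> star m (f b) (d b1)) \<and>
     (\<forall>w\<in>un_ops S. \<forall>b\<in>carrier D. d (un D w b) = un A w (d b))"

definition lift :: "('a, 'u, 'b) alg \<Rightarrow> ('a \<Rightarrow> 'a) \<Rightarrow> ('a \<Rightarrow> 'a) \<Rightarrow> 'a \<Rightarrow> 'a" where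
  "lift D f d = (\<lambda>b\<in>carrier D. i (d b) \<oplus>\<^bsub>E\<^esub> s (f b))"

text \<open>
  Coordinates are unique, so each morphism law of the lift is the corresponding derivation law in the
  first coordinate; in the second it holds because \<open>f\<close> is a morphism.
\<close>

lemma lift_hom_iff_derivation:
  assumes f: "alg_morphism S D B f" and d: "\<And>b. b \<in> carrier D \<Longrightarrow> d b \<in> carrier A"
  shows "lift D f d \<in> alg_hom S D E \<longleftrightarrow> derivation D f d"
proof -
  interpret f: alg_morphism S D B f by fact
  note [simp] = d
  have add: "lift D f d (b \<oplus>\<^bsub>D\<^esub> b1) = lift D f d b \<oplus>\<^bsub>E\<^esub> lift D f d b1 \<longleftrightarrow>
      d (b \<oplus>\<^bsub>D\<^esub> b1) = d b \<oplus>\<^bsub>A\<^esub> act (f b) (d b1)"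
    if "b \<in> carrier D" "b1 \<in> carrier D" for b b1
    using that by (simp only: lift_def restrict_apply' pair_add pair_eq_iff d f.closed f.map_add
        f.A.add_closed A.add_closed B.add_closed act_closed simp_thms)
  have un: "lift D f d (un D w b) = un E w (lift D f d b) \<longleftrightarrow> d (un D w b) = un A w (d b)"
    if "w \<in> un_ops S" "b \<in> carrier D" for w b
    using that by (simp only: lift_def restrict_apply' pair_un pair_eq_iff d f.closed f.map_un
        f.A.un_closed A.un_closed B.un_closed simp_thms)
  have bin: "lift D f d (bin D m b b1) = bin E m (lift D f d b) (lift D f d b1) \<longleftrightarrow>
      d (bin D m b b1) =
        bin A m (d b) (d b1) \<oplus>\<^bsub>A\<^esub> star (opp S m) (f b1) (d b) \<oplus>\<^bsub>A\<^esub> star m (f b) (d b1)"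
    if "m \<in> bin_ops S" "b \<in> carrier D" "b1 \<in> carrier D" for m b b1
    using that by (simp only: lift_def restrict_apply' pair_bin pair_eq_iff d f.closed f.map_bin
        f.A.bin_closed A.bin_closed B.bin_closed A.add_closed star_closed A.opp_closed simp_thms)
  have "lift D f d \<in> carrier D \<rightarrow>\<^sub>E carrier E" by (simp add: lift_def)
  then have "lift D f d \<in> alg_hom S D E \<longleftrightarrow>
      (\<forall>b\<in>carrier D. \<forall>b1\<in>carrier D.
         lift D f d (b \<oplus>\<^bsub>D\<^esub> b1) = lift D f d b \<oplus>\<^bsub>E\<^esub> lift D f d b1) \<and>
      (\<forall>m\<in>bin_ops S. \<forall>b\<in>carrier D. \<forall>b1\<in>carrier D.
         lift D f d (bin D m b b1) = bin E m (lift D f d b) (lift D f d b1)) \<and>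
      (\<forall>w\<in>un_ops S. \<forall>b\<in>carrier D. lift D f d (un D w b) = un E w (lift D f d b))"
    using alg_homI[OF f.A.operation_algebra_axioms E.operation_algebra_axioms]
    by (auto simp: alg_hom_def)
  then show ?thesis unfolding derivation_def using add un bin by simp
qed

text \<open>The identity of the extension is the lift of the projection along its kernel part.\<close>

lemma derivation_ker_part: "derivation E p ker_part"
proof -
  have "lift E p ker_part = (\<lambda>e\<in>carrier E. e)"
    by (auto simp: lift_def)
  then have "lift E p ker_part \<in> alg_hom S E E"
    using identity_alg_hom[OF E.is_alg] by simp
  then show ?thesis
    using lift_hom_iff_derivation[OF p.alg_morphism_axioms] by simp
qed

end

lemma derived_actions_iff_split_ext:
  assumes "groups_with_operations S"
  shows "derived_actions S B A act star \<longleftrightarrow> (\<exists>E i p s. split_ext S A E B i p s act star)"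
proof
  interpret groups_with_operations S by fact
  show "derived_actions S B A act star" if "\<exists>E i p s. split_ext S A E B i p s act star"
    using that unfolding derived_actions_def split_ext_def split_ext_axioms_def by blast
  assume "derived_actions S B A act star"
  then obtain E i p s where *: "split_extension S A E B i p s"
    "\<forall>b\<in>carrier B. \<forall>a\<in>carrier A. i (act b a) = s b \<oplus>\<^bsub>E\<^esub> i a \<ominus>\<^bsub>E\<^esub> s b"
    "\<forall>m\<in>bin_ops S. \<forall>b\<in>carrier B. \<forall>a\<in>carrier A. i (star m b a) = bin E m (s b) (i a)"
    and "\<forall>b\<in>carrier B. \<forall>a\<in>carrier A. act b a \<in> carrier A"
    "\<forall>m\<in>bin_ops S. \<forall>b\<in>carrier B. \<forall>a\<in>carrier A. star m b a \<in> carrier A"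
    unfolding derived_actions_def by blast
  then have "split_ext S A E B i p s act star"
    by unfold_locales (simp_all add: split_extension_def)
  then show "\<exists>E i p s. split_ext S A E B i p s act star" by blast
qed

section \<open>Internal categories as reflexive graphs\<close>

locale reflexive_graph =
  M: operation_algebra S M + N: operation_algebra S N
  for S :: "('u, 'b) theory_sig" and M N :: "('a, 'u, 'b) alg" +
  fixes \<sigma> \<tau> \<iota> :: "'a \<Rightarrow> 'a"
  assumes source_hom: "\<sigma> \<in> alg_hom S M N" and target_hom: "\<tau> \<in> alg_hom S M N"
    and unit_hom: "\<iota> \<in> alg_hom S N M"
    and source_unit [simp]: "x \<in> carrier N \<Longrightarrow> \<sigma> (\<iota> x) = x"
    and target_unit [simp]: "x \<in> carrier N \<Longrightarrow> \<tau> (\<iota> x) = x"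
begin

sublocale \<sigma>: alg_morphism S M N \<sigma> by unfold_locales (rule source_hom)
sublocale \<tau>: alg_morphism S M N \<tau> by unfold_locales (rule target_hom)
sublocale \<iota>: alg_morphism S N M \<iota> by unfold_locales (rule unit_hom)

definition kernels_annihilate :: bool where
  "kernels_annihilate \<longleftrightarrow>
     (\<forall>x\<in>carrier M. \<forall>y\<in>carrier M. \<sigma> x = \<zero>\<^bsub>N\<^esub> \<longrightarrow> \<tau> y = \<zero>\<^bsub>N\<^esub> \<longrightarrow>
        x \<oplus>\<^bsub>M\<^esub> y = y \<oplus>\<^bsub>M\<^esub> x \<and> (\<forall>m\<in>bin_ops S. bin M m x y = \<zero>\<^bsub>M\<^esub>))"

lemma kernels_annihilateD:
  assumes kernels_annihilate "x \<in> carrier M" "y \<in> carrier M" "\<sigma> x = \<zero>\<^bsub>N\<^esub>" "\<tau> y = \<zero>\<^bsub>N\<^esub>"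
  shows "x \<oplus>\<^bsub>M\<^esub> y = y \<oplus>\<^bsub>M\<^esub> x" and "m \<in> bin_ops S \<Longrightarrow> bin M m x y = \<zero>\<^bsub>M\<^esub>"
  using assms unfolding kernels_annihilate_def by blast+

definition composite :: "'a \<Rightarrow> 'a \<Rightarrow> 'a" where
  "composite b a = b \<ominus>\<^bsub>M\<^esub> \<iota> (\<sigma> b) \<oplus>\<^bsub>M\<^esub> a"

definition graph_category :: "('a, 'u, 'b) icat" where
  "graph_category = \<lparr>ic_mor = M, ic_ob = N, src = \<sigma>, tgt = \<tau>, ide = \<iota>,
     cmp = (\<lambda>(b, a)\<in>{(b, a). b \<in> carrier M \<and> a \<in> carrier M \<and> \<sigma> b = \<tau> a}. composite b a)\<rparr>"

lemma composite_closed [simp]: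
  "\<lbrakk>b \<in> carrier M; a \<in> carrier M\<rbrakk> \<Longrightarrow> composite b a \<in> carrier M"
  by (simp add: composite_def)

lemma source_composite:
  "\<lbrakk>b \<in> carrier M; a \<in> carrier M\<rbrakk> \<Longrightarrow> \<sigma> (composite b a) = \<sigma> a"
  by (simp add: composite_def diff_def)

lemma target_composite:
  "\<lbrakk>b \<in> carrier M; a \<in> carrier M; \<sigma> b = \<tau> a\<rbrakk> \<Longrightarrow> \<tau> (composite b a) = \<tau> b"
  by (simp add: composite_def diff_def)

text \<open>
  Moving \<open>x = b' - 1\<close> past \<open>y = -1 + a\<close> turns \<open>(b + b') - (1 + 1') + (a + a')\<close> into the sum of the
  composites.
\<close>

lemma composite_add:
  assumes kernels_annihilate
    and [simp]: "b \<in> carrier M" "a \<in> carrier M" "b' \<in> carrier M" "a' \<in> carrier M"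
    and ends: "\<sigma> b = \<tau> a" "\<sigma> b' = \<tau> a'"
  shows "composite (b \<oplus>\<^bsub>M\<^esub> b') (a \<oplus>\<^bsub>M\<^esub> a') = composite b a \<oplus>\<^bsub>M\<^esub> composite b' a'"
proof -
  define x where "x = b' \<ominus>\<^bsub>M\<^esub> \<iota> (\<sigma> b')"
  define y where "y = neg M (\<iota> (\<tau> a)) \<oplus>\<^bsub>M\<^esub> a"
  have closed [simp]: "x \<in> carrier M" "y \<in> carrier M" by (simp_all add: x_def y_def)
  have "\<sigma> x = \<zero>\<^bsub>N\<^esub>" "\<tau> y = \<zero>\<^bsub>N\<^esub>" by (simp_all add: x_def y_def diff_def)
  then have xy: "x \<oplus>\<^bsub>M\<^esub> y = y \<oplus>\<^bsub>M\<^esub> x"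
    by (rule kernels_annihilateD(1)[OF assms(1) closed])
  have "composite (b \<oplus>\<^bsub>M\<^esub> b') (a \<oplus>\<^bsub>M\<^esub> a') = b \<oplus>\<^bsub>M\<^esub> (x \<oplus>\<^bsub>M\<^esub> y) \<oplus>\<^bsub>M\<^esub> a'"
    by (simp add: composite_def x_def y_def diff_def ends)
  then show ?thesis unfolding xy by (simp add: composite_def x_def y_def diff_def ends)
qed

text \<open>
  With \<open>b = x + u\<close> and \<open>a = u + y\<close> the composite is \<open>x + u + y\<close>; in the product of two of these the terms
  \<open>x * y'\<close> and \<open>y * x'\<close> vanish, and what is left is \<open>b * b' - u * u' + a * a'\<close>.
\<close>

lemma composite_bin:
  assumes kernels_annihilate and m: "m \<in> bin_ops S"
    and [simp]: "b \<in> carrier M" "a \<in> carrier M" "b' \<in> carrier M" "a' \<in> carrier M"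
    and ends: "\<sigma> b = \<tau> a" "\<sigma> b' = \<tau> a'"
  shows "composite (bin M m b b') (bin M m a a') = bin M m (composite b a) (composite b' a')"
proof -
  define u where "u = \<iota> (\<sigma> b)"
  define u' where "u' = \<iota> (\<sigma> b')"
  define x where "x = b \<ominus>\<^bsub>M\<^esub> u"
  define x' where "x' = b' \<ominus>\<^bsub>M\<^esub> u'"
  define y where "y = neg M u \<oplus>\<^bsub>M\<^esub> a"
  define y' where "y' = neg M u' \<oplus>\<^bsub>M\<^esub> a'"
  note defs = u_def u'_def x_def x'_def y_def y'_def
  have [simp]: "u \<in> carrier M" "u' \<in> carrier M" "x \<in> carrier M" "x' \<in> carrier M"
      "y \<in> carrier M" "y' \<in> carrier M"
    by (simp_all add: defs)
  have "\<sigma> x = \<zero>\<^bsub>N\<^esub>" "\<tau> y = \<zero>\<^bsub>N\<^esub>" "\<sigma> x' = \<zero>\<^bsub>N\<^esub>" "\<tau> y' = \<zero>\<^bsub>N\<^esub>"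
    by (simp_all add: defs ends diff_def)
  then have xy: "bin M m x y' = \<zero>\<^bsub>M\<^esub>" and "bin M (opp S m) x' y = \<zero>\<^bsub>M\<^esub>"
    using assms(1) m by (simp_all add: kernels_annihilate_def M.opp_closed)
  then have yx: "bin M m y x' = \<zero>\<^bsub>M\<^esub>" using m by (simp add: M.bin_opp)
  have split: "b = x \<oplus>\<^bsub>M\<^esub> u" "b' = x' \<oplus>\<^bsub>M\<^esub> u'" "a = u \<oplus>\<^bsub>M\<^esub> y" "a' = u' \<oplus>\<^bsub>M\<^esub> y'"
    by (simp_all add: defs diff_def)
  have uu: "\<iota> (\<sigma> (bin M m b b')) = bin M m u u'"
    using m by (simp add: u_def u'_def)
  have "bin M m b b' \<ominus>\<^bsub>M\<^esub> bin M m u u' \<oplus>\<^bsub>M\<^esub> bin M m a a' =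
        bin M m (x \<oplus>\<^bsub>M\<^esub> u \<oplus>\<^bsub>M\<^esub> y) (x' \<oplus>\<^bsub>M\<^esub> u' \<oplus>\<^bsub>M\<^esub> y')"
    unfolding split using m by (simp add: diff_def xy yx)
  then show ?thesis
    unfolding composite_def uu by (simp add: x_def x'_def y_def y'_def flip: u_def u'_def)
qed

lemma composite_un:
  "\<lbrakk>w \<in> un_ops S; b \<in> carrier M; a \<in> carrier M\<rbrakk>
   \<Longrightarrow> composite (un M w b) (un M w a) = un M w (composite b a)"
  by (simp add: composite_def diff_def)

lemma composite_neg:
  assumes kernels_annihilate
    and "b \<in> carrier M" "a \<in> carrier M" "\<sigma> b = \<tau> a"
  shows "composite (neg M b) (neg M a) = neg M (composite b a)"
proof (rule M.neg_unique)
  show "composite b a \<oplus>\<^bsub>M\<^esub> composite (neg M b) (neg M a) = \<zero>\<^bsub>M\<^esub>"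
    using assms by (simp add: composite_def[of "\<zero>\<^bsub>M\<^esub>" "\<zero>\<^bsub>M\<^esub>"] diff_def flip: composite_add)
qed (use assms in simp_all)

text \<open>
  The composite \<open>b - 1 + a\<close> is a morphism on composable pairs because \<open>b - 1\<close> lies in the kernel of
  the source map and \<open>-1 + a\<close> in that of the target map.
\<close>

theorem internal_category_graph_category:
  assumes kernels_annihilate
  shows "internal_category S graph_category"
proof -
  let ?P = "composable_pairs graph_category"
  have P: "carrier ?P = {(b, a). b \<in> carrier M \<and> a \<in> carrier M \<and> \<sigma> b = \<tau> a}"
    by (simp add: composable_pairs_def graph_category_def)
  have "cmp graph_category \<in> alg_hom S ?P M"
    unfolding alg_hom_def mem_Collect_eq P
    by (auto simp: composable_pairs_def graph_category_def Let_def
        composite_add[OF assms] composite_bin[OF assms] composite_neg[OF assms] composite_un)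
  then show ?thesis
    unfolding internal_category_def Let_def
    using source_hom target_hom unit_hom M.is_alg N.is_alg
    by (simp add: graph_category_def source_composite target_composite)
      (simp add: composite_def diff_def)
qed

text \<open>
  For vertical composition: \<open>\<theta>\<close> and \<open>\<eta>\<close> form a morphism into the composable pairs, on which composition
  is one.
\<close>

lemma composite_hom:
  assumes kernels_annihilate
    and "\<eta> \<in> alg_hom S D M" "\<theta> \<in> alg_hom S D M" "is_alg S D"
    and ends: "\<And>x. x \<in> carrier D \<Longrightarrow> \<sigma> (\<theta> x) = \<tau> (\<eta> x)"
  shows "(\<lambda>x\<in>carrier D. composite (\<theta> x) (\<eta> x)) \<in> alg_hom S D M"
proof -
  interpret D: operation_algebra S D by unfold_locales fact
  interpret \<eta>: alg_morphism S D M \<eta> by unfold_locales fact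
  interpret \<theta>: alg_morphism S D M \<theta> by unfold_locales fact
  show ?thesis
    by (rule alg_homI[OF D.operation_algebra_axioms M.operation_algebra_axioms])
      (simp_all add: composite_add[OF assms(1)] composite_bin[OF assms(1)] composite_un ends)
qed

end

text \<open>Conversely, every internal category arises in this way from its underlying reflexive graph.\<close>

locale internal_cat = groups_with_operations S
  for S :: "('u, 'b) theory_sig" +
  fixes G :: "('a, 'u, 'b) icat"
  assumes internal_category: "internal_category S G"
begin

sublocale reflexive_graph S "ic_mor G" "ic_ob G" "src G" "tgt G" "ide G"
  by unfold_locales (use internal_category in \<open>simp_all add: internal_category_def Let_def\<close>)

lemma cmp_hom: "cmp G \<in> alg_hom S (composable_pairs G) (ic_mor G)"
  using internal_category by (simp add: internal_category_def Let_def)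

lemma
  assumes "b \<in> carrier (ic_mor G)" "a \<in> carrier (ic_mor G)" "src G b = tgt G a"
    and "b' \<in> carrier (ic_mor G)" "a' \<in> carrier (ic_mor G)" "src G b' = tgt G a'"
  shows cmp_add:
      "cmp G (b \<oplus>\<^bsub>ic_mor G\<^esub> b', a \<oplus>\<^bsub>ic_mor G\<^esub> a') = cmp G (b, a) \<oplus>\<^bsub>ic_mor G\<^esub> cmp G (b', a')"
    and cmp_bin: "m \<in> bin_ops S \<Longrightarrow>
      cmp G (bin (ic_mor G) m b b', bin (ic_mor G) m a a') =
      bin (ic_mor G) m (cmp G (b, a)) (cmp G (b', a'))"
  using cmp_hom assms by (auto simp: alg_hom_def composable_pairs_def Let_def)

lemma cmp_unit:
  assumes "a \<in> carrier (ic_mor G)"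
  shows "cmp G (a, ide G (src G a)) = a" "cmp G (ide G (tgt G a), a) = a"
  using internal_category assms by (simp_all add: internal_category_def Let_def)

text \<open>
  The Eckmann-Hilton argument: \<open>x = x \<circ> 0\<close> and \<open>y = 0 \<circ> y\<close>, and composition is compatible with sums
  and products, so that \<open>x + y\<close> and \<open>y + x\<close> are both \<open>x \<circ> y\<close> while \<open>x * y = 0 \<circ> 0\<close>.
\<close>

lemma kernels_annihilate: kernels_annihilate
  unfolding kernels_annihilate_def
proof (intro ballI impI conjI)
  fix x y assume [simp]: "x \<in> carrier (ic_mor G)" "y \<in> carrier (ic_mor G)"
    "src G x = \<zero>\<^bsub>ic_ob G\<^esub>" "tgt G y = \<zero>\<^bsub>ic_ob G\<^esub>"
  have [simp]: "cmp G (x, \<zero>\<^bsub>ic_mor G\<^esub>) = x" "cmp G (\<zero>\<^bsub>ic_mor G\<^esub>, y) = y"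
    "cmp G (\<zero>\<^bsub>ic_mor G\<^esub>, \<zero>\<^bsub>ic_mor G\<^esub>) = \<zero>\<^bsub>ic_mor G\<^esub>"
    using cmp_unit(1)[of x] cmp_unit(2)[of y] cmp_unit(1)[of "\<zero>\<^bsub>ic_mor G\<^esub>"] by simp_all
  show "x \<oplus>\<^bsub>ic_mor G\<^esub> y = y \<oplus>\<^bsub>ic_mor G\<^esub> x"
    using cmp_add[of x "\<zero>\<^bsub>ic_mor G\<^esub>" "\<zero>\<^bsub>ic_mor G\<^esub>" y] cmp_add[of "\<zero>\<^bsub>ic_mor G\<^esub>" y x "\<zero>\<^bsub>ic_mor G\<^esub>"]
    by simp
  show "bin (ic_mor G) m x y = \<zero>\<^bsub>ic_mor G\<^esub>" if "m \<in> bin_ops S" for m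
    using cmp_bin[of x "\<zero>\<^bsub>ic_mor G\<^esub>" "\<zero>\<^bsub>ic_mor G\<^esub>" y m] that by simp
qed

text \<open>The composite is forced: split \<open>(b, a)\<close> as \<open>(b - 1, 0) + (1, a)\<close>.\<close>

lemma cmp_eq_composite:
  assumes [simp]: "b \<in> carrier (ic_mor G)" "a \<in> carrier (ic_mor G)" "src G b = tgt G a"
  shows "cmp G (b, a) = composite b a"
proof -
  let ?u = "ide G (src G b)" let ?x = "b \<ominus>\<^bsub>ic_mor G\<^esub> ?u"
  have "cmp G (?x \<oplus>\<^bsub>ic_mor G\<^esub> ?u, \<zero>\<^bsub>ic_mor G\<^esub> \<oplus>\<^bsub>ic_mor G\<^esub> a) =
        cmp G (?x, \<zero>\<^bsub>ic_mor G\<^esub>) \<oplus>\<^bsub>ic_mor G\<^esub> cmp G (?u, a)"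
    by (rule cmp_add) (simp_all add: diff_def)
  moreover have "cmp G (?x, \<zero>\<^bsub>ic_mor G\<^esub>) = ?x" using cmp_unit(1)[of ?x] by (simp add: diff_def)
  moreover have "cmp G (?u, a) = a" using cmp_unit(2)[of a] by simp
  ultimately show ?thesis by (simp add: composite_def diff_def)
qed

end

section \<open>The internal category of a crossed module\<close>

locale xmod_split =
  split_ext S "xm_top X" E "xm_base X" i p s "xm_act X" "xm_star X"
  for S :: "('u, 'b) theory_sig" and X :: "('a, 'u, 'b) xmod" and E i p s +
  assumes crossed_module: "crossed_module S X"
begin

sublocale bd: alg_morphism S "xm_top X" "xm_base X" "xm_bd X"
  by unfold_locales (use crossed_module in \<open>simp add: crossed_module_def Let_def\<close>)

lemma
  assumes "b \<in> carrier (xm_base X)" "a \<in> carrier (xm_top X)"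
  shows bd_act: "xm_bd X (xm_act X b a) = b \<oplus>\<^bsub>xm_base X\<^esub> xm_bd X a \<ominus>\<^bsub>xm_base X\<^esub> b"
    and bd_star: "m \<in> bin_ops S \<Longrightarrow> xm_bd X (xm_star X m b a) = bin (xm_base X) m b (xm_bd X a)"
  using crossed_module assms by (simp_all add: crossed_module_def Let_def)

lemma
  assumes "a \<in> carrier (xm_top X)" "a1 \<in> carrier (xm_top X)"
  shows act_bd: "xm_act X (xm_bd X a) a1 = a \<oplus>\<^bsub>xm_top X\<^esub> a1 \<ominus>\<^bsub>xm_top X\<^esub> a"
    and star_opp_bd:
      "m \<in> bin_ops S \<Longrightarrow> xm_star X (opp S m) (xm_bd X a1) a = bin (xm_top X) m a a1"
  using crossed_module assms by (simp_all add: crossed_module_def Let_def)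

text \<open>The extension becomes a reflexive graph with source map \<open>p\<close>; the target of \<open>(a, b)\<close> is \<open>\<alpha> a + b\<close>.\<close>

definition target :: "'a \<Rightarrow> 'a" where
  "target = (\<lambda>e\<in>carrier E. xm_bd X (ker_part e) \<oplus>\<^bsub>xm_base X\<^esub> p e)"

lemma target_pair [simp]:
  "\<lbrakk>a \<in> carrier (xm_top X); b \<in> carrier (xm_base X)\<rbrakk>
   \<Longrightarrow> target (i a \<oplus>\<^bsub>E\<^esub> s b) = xm_bd X a \<oplus>\<^bsub>xm_base X\<^esub> b"
  by (simp add: target_def)

lemma target_i [simp]: "a \<in> carrier (xm_top X) \<Longrightarrow> target (i a) = xm_bd X a"
  using target_pair[of a "\<zero>\<^bsub>xm_base X\<^esub>"] by simp

lemma target_s: "b \<in> carrier (xm_base X) \<Longrightarrow> target (s b) = b"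
  using target_pair[of "\<zero>\<^bsub>xm_top X\<^esub>" b] by simp

lemma target_hom: "target \<in> alg_hom S E (xm_base X)"
proof (rule alg_homI[OF E.operation_algebra_axioms B.operation_algebra_axioms])
  show "target \<in> carrier E \<rightarrow>\<^sub>E carrier (xm_base X)" by (simp add: target_def)
next
  fix x y assume "x \<in> carrier E" "y \<in> carrier E"
  then show "target (x \<oplus>\<^bsub>E\<^esub> y) = target x \<oplus>\<^bsub>xm_base X\<^esub> target y"
    by (elim pair_cases) (simp add: pair_add bd_act diff_def del: E.add_assoc i.map_add s.map_add)
next
  fix w x assume "w \<in> un_ops S" "x \<in> carrier E"
  then show "target (un E w x) = un (xm_base X) w (target x)"
    by (elim pair_cases) (simp add: pair_un del: E.un_add i.map_un s.map_un)
next
  fix m x y assume m: "m \<in> bin_ops S" and "x \<in> carrier E" "y \<in> carrier E"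
  then show "target (bin E m x y) = bin (xm_base X) m (target x) (target y)"
    by (elim pair_cases, simp add: pair_bin bd_star A.opp_closed B.bin_opp
        del: E.bin_add_left E.bin_add_right i.map_add i.map_bin s.map_bin B.bin_add_right) simp
qed

sublocale graph: reflexive_graph S E "xm_base X" p target s
  by unfold_locales (simp_all add: p.hom s.hom target_hom target_s)

text \<open>
  An element of the kernel of \<open>target\<close> is \<open>(c, - \<alpha> c)\<close>. The contributions of \<open>c\<close> and \<open>- \<alpha> c\<close> to
  conjugation and to products with elements of \<open>A\<close> cancel by the Peiffer laws.
\<close>

lemma kernels_annihilate: graph.kernels_annihilate
  unfolding graph.kernels_annihilate_def
proof (intro ballI impI conjI)
  fix x y assume xy: "x \<in> carrier E" "y \<in> carrier E"
    "p x = \<zero>\<^bsub>xm_base X\<^esub>" "target y = \<zero>\<^bsub>xm_base X\<^esub>"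
  obtain a where a [simp]: "a \<in> carrier (xm_top X)" and x: "x = i a"
    using in_image_i[OF xy(1,3)] by blast
  obtain c b where c [simp]: "c \<in> carrier (xm_top X)" and b: "b \<in> carrier (xm_base X)"
    and y: "y = i c \<oplus>\<^bsub>E\<^esub> s b"
    using xy(2) by (rule pair_cases)
  have b_eq: "b = xm_bd X (neg (xm_top X) c)"
    using xy(4) b by (simp add: y B.neg_unique)
  have "i (xm_act X b a) = s b \<oplus>\<^bsub>E\<^esub> i a \<ominus>\<^bsub>E\<^esub> s b" by (rule i_act[OF b a])
  then have "s b \<oplus>\<^bsub>E\<^esub> i a = i (xm_act X b a) \<oplus>\<^bsub>E\<^esub> s b"
    using b by (simp add: diff_def)
  also have "xm_act X b a = neg (xm_top X) c \<oplus>\<^bsub>xm_top X\<^esub> a \<oplus>\<^bsub>xm_top X\<^esub> c"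
    unfolding b_eq by (subst act_bd) (simp_all add: diff_def)
  finally show "x \<oplus>\<^bsub>E\<^esub> y = y \<oplus>\<^bsub>E\<^esub> x" using b by (simp add: x y)
  fix m assume m: "m \<in> bin_ops S"
  have "bin E m (i a) (s b) = i (xm_star X (opp S m) b a)" by (rule i_star_opp[OF m b a, symmetric])
  also have "xm_star X (opp S m) b a = neg (xm_top X) (bin (xm_top X) m a c)"
    unfolding b_eq using m by (subst star_opp_bd) simp_all
  finally show "bin E m x y = \<zero>\<^bsub>E\<^esub>" using b m by (simp add: x y)
qed

lemma internal_cat_graph_category: "internal_cat S graph.graph_category"
  by unfold_locales (rule graph.internal_category_graph_category[OF kernels_annihilate])

end

lemma (in groups_with_operations) crossed_module_split:
  assumes "crossed_module S X"
  obtains E i p s where "xmod_split S X E i p s"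
proof -
  have "derived_actions S (xm_base X) (xm_top X) (xm_act X) (xm_star X)"
    using assms by (simp add: crossed_module_def Let_def)
  then show ?thesis
    using that assms unfolding derived_actions_iff_split_ext[OF groups_with_operations_axioms]
    by (blast intro: xmod_split.intro xmod_split_axioms.intro)
qed

section \<open>The 2-category of crossed modules\<close>

lemma (in groups_with_operations) crossed_module_closed:
  assumes "crossed_module S X"
  shows "is_alg S (xm_top X)" "is_alg S (xm_base X)"
    "\<lbrakk>b \<in> carrier (xm_base X); a \<in> carrier (xm_top X)\<rbrakk> \<Longrightarrow> xm_act X b a \<in> carrier (xm_top X)"
    "\<lbrakk>m \<in> bin_ops S; b \<in> carrier (xm_base X); a \<in> carrier (xm_top X)\<rbrakk>
     \<Longrightarrow> xm_star X m b a \<in> carrier (xm_top X)"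
    "a \<in> carrier (xm_top X) \<Longrightarrow> xm_bd X a \<in> carrier (xm_base X)"
  using assms by (auto simp: crossed_module_def derived_actions_def alg_hom_def Let_def)

locale xmod_map = groups_with_operations S
  for S :: "('u, 'b) theory_sig" +
  fixes X Y :: "('a, 'u, 'b) xmod" and f1 f0 :: "'a \<Rightarrow> 'a"
  assumes domain: "crossed_module S X" and codomain: "crossed_module S Y"
    and map: "(f1, f0) \<in> xmod_hom S X Y"
begin

sublocale top: alg_morphism S "xm_top X" "xm_top Y" f1
  by unfold_locales (use domain codomain map in \<open>simp_all add: crossed_module_closed xmod_hom_def\<close>)

sublocale base: alg_morphism S "xm_base X" "xm_base Y" f0
  by unfold_locales (use domain codomain map in \<open>simp_all add: crossed_module_closed xmod_hom_def\<close>)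

lemma map_bd [simp]: "a \<in> carrier (xm_top X) \<Longrightarrow> f0 (xm_bd X a) = xm_bd Y (f1 a)"
  and map_act [simp]:
    "\<lbrakk>b \<in> carrier (xm_base X); a \<in> carrier (xm_top X)\<rbrakk>
     \<Longrightarrow> f1 (xm_act X b a) = xm_act Y (f0 b) (f1 a)"
  and map_star [simp]:
    "\<lbrakk>m \<in> bin_ops S; b \<in> carrier (xm_base X); a \<in> carrier (xm_top X)\<rbrakk>
     \<Longrightarrow> f1 (xm_star X m b a) = xm_star Y m (f0 b) (f1 a)"
  using map by (simp_all add: xmod_hom_def)

end

context groups_with_operations
begin

lemma identity_xmod_hom:
  assumes "crossed_module S X"
  shows "(\<lambda>a\<in>carrier (xm_top X). a, \<lambda>b\<in>carrier (xm_base X). b) \<in> xmod_hom S X X"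
  using assms by (simp add: xmod_hom_def crossed_module_closed identity_alg_hom)

lemma compose_xmod_hom:
  assumes "xmod_map S X Y f1 f0" "xmod_map S Y Z g1 g0"
  shows "(compose (carrier (xm_top X)) g1 f1, compose (carrier (xm_base X)) g0 f0)
    \<in> xmod_hom S X Z"
proof -
  interpret f: xmod_map S X Y f1 f0 by fact
  interpret g: xmod_map S Y Z g1 g0 by fact
  have "compose (carrier (xm_top X)) g1 f1 \<in> alg_hom S (xm_top X) (xm_top Z)"
    "compose (carrier (xm_base X)) g0 f0 \<in> alg_hom S (xm_base X) (xm_base Z)"
    by (rule compose_alg_hom[OF _ f.top.hom g.top.hom] compose_alg_hom[OF _ f.base.hom g.base.hom];
        rule f.top.A.is_alg f.base.A.is_alg)+
  then show ?thesis
    using f.domain by (simp add: xmod_hom_def compose_def crossed_module_closed)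
qed

lemma xmod_homotopyD:
  assumes "d \<in> xmod_homotopy S X Y (f1, f0) (g1, g0)"
  shows "d \<in> extensional (carrier (xm_base X))"
    and "b \<in> carrier (xm_base X) \<Longrightarrow> d b \<in> carrier (xm_top Y)"
    and "\<lbrakk>b \<in> carrier (xm_base X); b1 \<in> carrier (xm_base X)\<rbrakk>
      \<Longrightarrow> d (b \<oplus>\<^bsub>xm_base X\<^esub> b1) = d b \<oplus>\<^bsub>xm_top Y\<^esub> xm_act Y (f0 b) (d b1)"
    and "\<lbrakk>m \<in> bin_ops S; b \<in> carrier (xm_base X); b1 \<in> carrier (xm_base X)\<rbrakk>
      \<Longrightarrow> d (bin (xm_base X) m b b1) = bin (xm_top Y) m (d b) (d b1)
            \<oplus>\<^bsub>xm_top Y\<^esub> xm_star Y (opp S m) (f0 b1) (d b) \<oplus>\<^bsub>xm_top Y\<^esub> xm_star Y m (f0 b) (d b1)"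
    and "\<lbrakk>w \<in> un_ops S; b \<in> carrier (xm_base X)\<rbrakk>
      \<Longrightarrow> d (un (xm_base X) w b) = un (xm_top Y) w (d b)"
    and "b \<in> carrier (xm_base X) \<Longrightarrow> xm_bd Y (d b) = g0 b \<ominus>\<^bsub>xm_base Y\<^esub> f0 b"
    and "a \<in> carrier (xm_top X) \<Longrightarrow> d (xm_bd X a) = g1 a \<ominus>\<^bsub>xm_top Y\<^esub> f1 a"
  using assms by (auto simp: xmod_homotopy_def Let_def PiE_def)

end

lemma (in xmod_split) xmod_homotopy_iff:
  "d \<in> xmod_homotopy S Y X (f1, f0) (g1, g0) \<longleftrightarrow>
     d \<in> carrier (xm_base Y) \<rightarrow>\<^sub>E carrier (xm_top X) \<and> derivation (xm_base Y) f0 d \<and>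
     (\<forall>b\<in>carrier (xm_base Y). xm_bd X (d b) = g0 b \<ominus>\<^bsub>xm_base X\<^esub> f0 b) \<and>
     (\<forall>a\<in>carrier (xm_top Y). d (xm_bd Y a) = g1 a \<ominus>\<^bsub>xm_top X\<^esub> f1 a)"
  by (simp add: xmod_homotopy_def derivation_def Let_def)

context groups_with_operations
begin

lemma zero_xmod_homotopy:
  assumes "xmod_map S X Y f1 f0"
  shows "(\<lambda>b\<in>carrier (xm_base X). \<zero>\<^bsub>xm_top Y\<^esub>) \<in> xmod_homotopy S X Y (f1, f0) (f1, f0)"
proof -
  interpret f: xmod_map S X Y f1 f0 by fact
  obtain E i p s where "xmod_split S Y E i p s" using f.codomain by (rule crossed_module_split)
  then interpret Y: xmod_split S Y E i p s .
  let ?d = "\<lambda>b\<in>carrier (xm_base X). \<zero>\<^bsub>xm_top Y\<^esub>"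
  have "Y.lift (xm_base X) f0 ?d = compose (carrier (xm_base X)) s f0"
    by (auto simp: Y.lift_def compose_def)
  also have "\<dots> \<in> alg_hom S (xm_base X) E"
    by (rule compose_alg_hom[OF f.base.A.is_alg f.base.hom Y.s.hom])
  finally have "Y.derivation (xm_base X) f0 ?d"
    by (subst (asm) Y.lift_hom_iff_derivation[OF f.base.alg_morphism_axioms]) simp_all
  then show ?thesis
    using f.domain by (simp add: Y.xmod_homotopy_iff diff_def crossed_module_closed)
qed

text \<open>
  The lift of a sum of homotopies is the pointwise composite of their lifts in the internal category
  of the target, so it is a morphism because composition is one.
\<close>

lemma vcomp_xmod_homotopy:
  assumes "xmod_map S X Y f1 f0" "xmod_map S X Y g1 g0" "xmod_map S X Y h1 h0"
    and d: "d \<in> xmod_homotopy S X Y (f1, f0) (g1, g0)"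
    and e: "e \<in> xmod_homotopy S X Y (g1, g0) (h1, h0)"
  shows "(\<lambda>b\<in>carrier (xm_base X). e b \<oplus>\<^bsub>xm_top Y\<^esub> d b)
    \<in> xmod_homotopy S X Y (f1, f0) (h1, h0)" (is "?c \<in> _")
proof -
  interpret f: xmod_map S X Y f1 f0 by fact
  interpret g: xmod_map S X Y g1 g0 by fact
  interpret h: xmod_map S X Y h1 h0 by fact
  obtain E i p s where "xmod_split S Y E i p s" using f.codomain by (rule crossed_module_split)
  then interpret Y: xmod_split S Y E i p s .
  let ?B = "xm_base X"
  note [simp] = xmod_homotopyD(2,6,7)[OF d] xmod_homotopyD(2,6,7)[OF e]
  have "Y.derivation ?B f0 d" "Y.derivation ?B g0 e"
    using d e by (simp_all add: Y.xmod_homotopy_iff)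
  then have "Y.lift ?B f0 d \<in> alg_hom S ?B E" "Y.lift ?B g0 e \<in> alg_hom S ?B E"
    by (simp_all add: Y.lift_hom_iff_derivation f.base.alg_morphism_axioms
        g.base.alg_morphism_axioms)
  then have "(\<lambda>b\<in>carrier ?B. Y.graph.composite (Y.lift ?B g0 e b) (Y.lift ?B f0 d b))
      \<in> alg_hom S ?B E"
    by (rule Y.graph.composite_hom[OF Y.kernels_annihilate _ _ f.base.A.is_alg])
      (simp add: Y.lift_def diff_def)
  also have "(\<lambda>b\<in>carrier ?B. Y.graph.composite (Y.lift ?B g0 e b) (Y.lift ?B f0 d b)) =
      Y.lift ?B f0 ?c"
    by (auto simp: Y.lift_def Y.graph.composite_def diff_def)
  finally have "Y.derivation ?B f0 ?c"
    by (subst (asm) Y.lift_hom_iff_derivation[OF f.base.alg_morphism_axioms]) simp_all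
  then show ?thesis
    using f.domain by (simp add: Y.xmod_homotopy_iff diff_def crossed_module_closed)
qed

lemma whisker_right_xmod_homotopy:
  assumes "xmod_map S X Y f1 f0" "xmod_map S Y Z g1 g0" "xmod_map S Y Z h1 h0"
    and e: "e \<in> xmod_homotopy S Y Z (g1, g0) (h1, h0)"
  shows "(\<lambda>b\<in>carrier (xm_base X). e (f0 b)) \<in> xmod_homotopy S X Z
    (compose (carrier (xm_top X)) g1 f1, compose (carrier (xm_base X)) g0 f0)
    (compose (carrier (xm_top X)) h1 f1, compose (carrier (xm_base X)) h0 f0)"
proof -
  interpret f: xmod_map S X Y f1 f0 by fact
  show ?thesis
    using f.domain f.codomain
    by (simp add: xmod_homotopy_def Let_def compose_def xmod_homotopyD[OF e] crossed_module_closed)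
qed

lemma whisker_left_xmod_homotopy:
  assumes "xmod_map S X Y f1 f0" "xmod_map S X Y g1 g0" "xmod_map S Y Z h1 h0"
    and d: "d \<in> xmod_homotopy S X Y (f1, f0) (g1, g0)"
  shows "(\<lambda>b\<in>carrier (xm_base X). h1 (d b)) \<in> xmod_homotopy S X Z
    (compose (carrier (xm_top X)) h1 f1, compose (carrier (xm_base X)) h0 f0)
    (compose (carrier (xm_top X)) h1 g1, compose (carrier (xm_base X)) h0 g0)"
proof -
  interpret f: xmod_map S X Y f1 f0 by fact
  interpret g: xmod_map S X Y g1 g0 by fact
  interpret h: xmod_map S Y Z h1 h0 by fact
  have "xm_bd Z (h1 (d b)) = h0 (g0 b) \<ominus>\<^bsub>xm_base Z\<^esub> h0 (f0 b)" if "b \<in> carrier (xm_base X)" for b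
    using that by (simp add: xmod_homotopyD[OF d] h.base.map_diff flip: h.map_bd)
  then show ?thesis
    using f.domain f.codomain h.codomain
    by (simp add: xmod_homotopy_def Let_def compose_def xmod_homotopyD(2-5,7)[OF d]
        crossed_module_closed h.top.map_diff opp_closed)
qed

text \<open>
  Naturality of \<open>d\<close> along the homotopy \<open>c\<close>, the reason for the interchange law: write \<open>f0' b\<close> as
  \<open>\<alpha> (c b) + f0 b\<close>, expand \<open>d\<close> by the derivation law and use that \<open>\<alpha> a\<close> acts as conjugation by \<open>a\<close>.
\<close>

lemma xmod_homotopy_exchange:
  assumes "xmod_map S X Y f1 f0" "xmod_map S X Y f1' f0'"
    and "xmod_map S Y Z g1 g0" "xmod_map S Y Z g1' g0'"
    and c: "c \<in> xmod_homotopy S X Y (f1, f0) (f1', f0')"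
    and d: "d \<in> xmod_homotopy S Y Z (g1, g0) (g1', g0')"
    and b: "b \<in> carrier (xm_base X)"
  shows "d (f0' b) \<oplus>\<^bsub>xm_top Z\<^esub> g1 (c b) = g1' (c b) \<oplus>\<^bsub>xm_top Z\<^esub> d (f0 b)"
proof -
  interpret f: xmod_map S X Y f1 f0 by fact
  interpret f': xmod_map S X Y f1' f0' by fact
  interpret g: xmod_map S Y Z g1 g0 by fact
  interpret g': xmod_map S Y Z g1' g0' by fact
  obtain E i p s where "xmod_split S Z E i p s" using g.codomain by (rule crossed_module_split)
  then interpret Z: xmod_split S Z E i p s .
  note [simp] = b xmod_homotopyD(2)[OF c] xmod_homotopyD(2)[OF d]
    crossed_module_closed(5)[OF f.codomain]
  have "f0' b = xm_bd Y (c b) \<oplus>\<^bsub>xm_base Y\<^esub> f0 b"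
    by (simp add: xmod_homotopyD(6)[OF c] diff_def)
  then have "d (f0' b) = d (xm_bd Y (c b)) \<oplus>\<^bsub>xm_top Z\<^esub> xm_act Z (xm_bd Z (g1 (c b))) (d (f0 b))"
    by (simp add: xmod_homotopyD(3)[OF d])
  then show ?thesis by (simp add: xmod_homotopyD(7)[OF d] Z.act_bd diff_def)
qed

text \<open>A horizontal composite is the vertical composite of two whiskerings.\<close>

lemma hcomp_xmod_homotopy:
  assumes f: "xmod_map S X Y f1 f0" and g: "xmod_map S X Y g1 g0"
    and h: "xmod_map S Y Z h1 h0" and k: "xmod_map S Y Z k1 k0"
    and d: "d \<in> xmod_homotopy S X Y (f1, f0) (g1, g0)"
    and e: "e \<in> xmod_homotopy S Y Z (h1, h0) (k1, k0)"
  shows "(\<lambda>b\<in>carrier (xm_base X). e (g0 b) \<oplus>\<^bsub>xm_top Z\<^esub> h1 (d b)) \<in> xmod_homotopy S X Z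
    (compose (carrier (xm_top X)) h1 f1, compose (carrier (xm_base X)) h0 f0)
    (compose (carrier (xm_top X)) k1 g1, compose (carrier (xm_base X)) k0 g0)"
proof -
  have XZ: "crossed_module S X" "crossed_module S Z"
    using f h by (simp_all add: xmod_map_def xmod_map_axioms_def)
  have comp: "xmod_map S X Z (compose (carrier (xm_top X)) g1 f1)
      (compose (carrier (xm_base X)) g0 f0)"
    if "xmod_map S X Y f1 f0" "xmod_map S Y Z g1 g0" for f1 f0 g1 g0
    by unfold_locales (use XZ compose_xmod_hom[OF that] in auto)
  show ?thesis
    using vcomp_xmod_homotopy[OF comp[OF f h] comp[OF g h] comp[OF g k]
      whisker_left_xmod_homotopy[OF f g h d] whisker_right_xmod_homotopy[OF g h k e]]
    by (simp cong: restrict_cong)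
qed

lemma xmod_map_iff:
  "xmod_map S X Y f1 f0 \<longleftrightarrow>
     crossed_module S X \<and> crossed_module S Y \<and> (f1, f0) \<in> xmod_hom S X Y"
  using groups_with_operations_axioms by (auto simp: xmod_map_def xmod_map_axioms_def)

lemma xmod_hom_funcset:
  assumes "(f1, f0) \<in> xmod_hom S X Y"
  shows "f1 \<in> carrier (xm_top X) \<rightarrow> carrier (xm_top Y)" "f1 \<in> extensional (carrier (xm_top X))"
    "f0 \<in> carrier (xm_base X) \<rightarrow> carrier (xm_base Y)" "f0 \<in> extensional (carrier (xm_base X))"
  using assms by (auto simp: xmod_hom_def alg_hom_def PiE_def)

theorem two_category_XMod: "two_category (XMod S :: (('a, 'u, 'b) xmod, _, _) two_cat)"
proof (unfold_locales; clarsimp simp: XMod_def simp del: restrict_apply)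
  fix X :: "('a, 'u, 'b) xmod" assume "crossed_module S X"
  then show "(\<lambda>a\<in>carrier (xm_top X). a, \<lambda>b\<in>carrier (xm_base X). b) \<in> xmod_hom S X X"
    by (rule identity_xmod_hom)
next
  fix X Y Z :: "('a, 'u, 'b) xmod" and f1 f0 g1 g0
  assume "crossed_module S X" "crossed_module S Y" "crossed_module S Z"
    and "(f1, f0) \<in> xmod_hom S X Y" "(g1, g0) \<in> xmod_hom S Y Z"
  then show "(compose (carrier (xm_top X)) g1 f1, compose (carrier (xm_base X)) g0 f0)
      \<in> xmod_hom S X Z"
    by (intro compose_xmod_hom) (simp_all add: xmod_map_iff)
next
  fix X Y :: "('a, 'u, 'b) xmod" and f1 f0
  assume f: "(f1, f0) \<in> xmod_hom S X Y"
  show "compose (carrier (xm_top X)) f1 (\<lambda>a\<in>carrier (xm_top X). a) = f1 \<and>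
      compose (carrier (xm_base X)) f0 (\<lambda>b\<in>carrier (xm_base X). b) = f0"
    using xmod_hom_funcset[OF f] by (simp add: compose_Id)
  show "compose (carrier (xm_top X)) (\<lambda>a\<in>carrier (xm_top Y). a) f1 = f1 \<and>
      compose (carrier (xm_base X)) (\<lambda>b\<in>carrier (xm_base Y). b) f0 = f0"
    using xmod_hom_funcset[OF f] by (simp add: Id_compose)
next
  fix X Y Z W :: "('a, 'u, 'b) xmod" and f1 f0 g1 g0 h1 h0
  assume f: "(f1, f0) \<in> xmod_hom S X Y"
  show "compose (carrier (xm_top X)) h1 (compose (carrier (xm_top X)) g1 f1) =
        compose (carrier (xm_top X)) (compose (carrier (xm_top Y)) h1 g1) f1 \<and>
      compose (carrier (xm_base X)) h0 (compose (carrier (xm_base X)) g0 f0) =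
        compose (carrier (xm_base X)) (compose (carrier (xm_base Y)) h0 g0) f0"
    using xmod_hom_funcset[OF f] by (auto intro: compose_assoc)
next
  fix X Y :: "('a, 'u, 'b) xmod" and f1 f0
  assume "crossed_module S X" "crossed_module S Y" "(f1, f0) \<in> xmod_hom S X Y"
  then show "(\<lambda>b\<in>carrier (xm_base X). \<zero>\<^bsub>xm_top Y\<^esub>) \<in> xmod_homotopy S X Y (f1, f0) (f1, f0)"
    by (intro zero_xmod_homotopy) (simp add: xmod_map_iff)
next
  fix X Y :: "('a, 'u, 'b) xmod" and f1 f0 g1 g0 h1 h0 d e
  assume "crossed_module S X" "crossed_module S Y" "(f1, f0) \<in> xmod_hom S X Y"
    "(g1, g0) \<in> xmod_hom S X Y" "(h1, h0) \<in> xmod_hom S X Y"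
    "d \<in> xmod_homotopy S X Y (f1, f0) (g1, g0)" "e \<in> xmod_homotopy S X Y (g1, g0) (h1, h0)"
  then show "(\<lambda>b\<in>carrier (xm_base X). e b \<oplus>\<^bsub>xm_top Y\<^esub> d b)
      \<in> xmod_homotopy S X Y (f1, f0) (h1, h0)"
    by (intro vcomp_xmod_homotopy[of X Y f1 f0 g1 g0]) (simp_all add: xmod_map_iff)
next
  fix X Y :: "('a, 'u, 'b) xmod" and f1 f0 g1 g0 d
  assume Y: "crossed_module S Y" and d: "d \<in> xmod_homotopy S X Y (f1, f0) (g1, g0)"
  interpret Y: operation_algebra S "xm_top Y"
    by unfold_locales (rule crossed_module_closed[OF Y])
  note [simp] = xmod_homotopyD(2)[OF d]
  have d_ext: "(\<lambda>b\<in>carrier (xm_base X). d b) = d"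
    using xmod_homotopyD(1)[OF d] by (rule extensional_restrict)
  then show "(\<lambda>b\<in>carrier (xm_base X).
        d b \<oplus>\<^bsub>xm_top Y\<^esub> (\<lambda>b\<in>carrier (xm_base X). \<zero>\<^bsub>xm_top Y\<^esub>) b) = d"
    and "(\<lambda>b\<in>carrier (xm_base X).
        (\<lambda>b\<in>carrier (xm_base X). \<zero>\<^bsub>xm_top Y\<^esub>) b \<oplus>\<^bsub>xm_top Y\<^esub> d b) = d"
    by (simp_all cong: restrict_cong)
next
  fix X Y :: "('a, 'u, 'b) xmod" and f1 f0 g1 g0 h1 h0 k1 k0 c d e
  assume Y: "crossed_module S Y"
    and c: "c \<in> xmod_homotopy S X Y (f1, f0) (g1, g0)"
    and d: "d \<in> xmod_homotopy S X Y (g1, g0) (h1, h0)"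
    and e: "e \<in> xmod_homotopy S X Y (h1, h0) (k1, k0)"
  interpret Y: operation_algebra S "xm_top Y"
    by unfold_locales (rule crossed_module_closed[OF Y])
  note [simp] = xmod_homotopyD(2)[OF c] xmod_homotopyD(2)[OF d] xmod_homotopyD(2)[OF e]
  show "(\<lambda>b\<in>carrier (xm_base X). e b \<oplus>\<^bsub>xm_top Y\<^esub>
        (\<lambda>b\<in>carrier (xm_base X). d b \<oplus>\<^bsub>xm_top Y\<^esub> c b) b) =
      (\<lambda>b\<in>carrier (xm_base X).
        (\<lambda>b\<in>carrier (xm_base X). e b \<oplus>\<^bsub>xm_top Y\<^esub> d b) b \<oplus>\<^bsub>xm_top Y\<^esub> c b)"
    by (simp cong: restrict_cong)
next
  fix X Y Z :: "('a, 'u, 'b) xmod" and f1 f0 g1 g0 h1 h0 k1 k0 d e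
  assume "crossed_module S X" "crossed_module S Y" "crossed_module S Z"
    "(f1, f0) \<in> xmod_hom S X Y" "(g1, g0) \<in> xmod_hom S X Y"
    "(h1, h0) \<in> xmod_hom S Y Z" "(k1, k0) \<in> xmod_hom S Y Z"
    "d \<in> xmod_homotopy S X Y (f1, f0) (g1, g0)" "e \<in> xmod_homotopy S Y Z (h1, h0) (k1, k0)"
  then show "(\<lambda>b\<in>carrier (xm_base X). e (g0 b) \<oplus>\<^bsub>xm_top Z\<^esub> h1 (d b)) \<in> xmod_homotopy S X Z
      (compose (carrier (xm_top X)) h1 f1, compose (carrier (xm_base X)) h0 f0)
      (compose (carrier (xm_top X)) k1 g1, compose (carrier (xm_base X)) k0 g0)"
    by (intro hcomp_xmod_homotopy[where Y = Y]) (simp_all add: xmod_map_iff)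
next
  fix X Y :: "('a, 'u, 'b) xmod" and f1 f0 g1 g0 d
  assume "crossed_module S X" "crossed_module S Y"
    and "(f1, f0) \<in> xmod_hom S X Y" and "(g1, g0) \<in> xmod_hom S X Y"
    and d: "d \<in> xmod_homotopy S X Y (f1, f0) (g1, g0)"
  then interpret f: xmod_map S X Y f1 f0 by (simp add: xmod_map_iff)
  interpret g: xmod_map S X Y g1 g0
    by (simp add: xmod_map_iff) (intro conjI; fact)
  note [simp] = xmod_homotopyD(2)[OF d]
  have d_ext: "(\<lambda>b\<in>carrier (xm_base X). d b) = d"
    using xmod_homotopyD(1)[OF d] by (rule extensional_restrict)
  then show "(\<lambda>b\<in>carrier (xm_base X). d ((\<lambda>b\<in>carrier (xm_base X). b) b) \<oplus>\<^bsub>xm_top Y\<^esub>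
        f1 ((\<lambda>b\<in>carrier (xm_base X). \<zero>\<^bsub>xm_top X\<^esub>) b)) = d"
    and "(\<lambda>b\<in>carrier (xm_base X). (\<lambda>b\<in>carrier (xm_base Y). \<zero>\<^bsub>xm_top Y\<^esub>) (g0 b)
        \<oplus>\<^bsub>xm_top Y\<^esub> (\<lambda>a\<in>carrier (xm_top Y). a) (d b)) = d"
    by (simp_all cong: restrict_cong)
next
  fix X Y Z W :: "('a, 'u, 'b) xmod" and f1 f0 f1' f0' g1 g0 g1' g0' h1 h0 h1' h0' c d e
  assume "crossed_module S Z" "crossed_module S W"
    and f': "(f1', f0') \<in> xmod_hom S X Y" and g: "(g1, g0) \<in> xmod_hom S Y Z"
    and g': "(g1', g0') \<in> xmod_hom S Y Z" and "(h1, h0) \<in> xmod_hom S Z W"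
    and c: "c \<in> xmod_homotopy S X Y (f1, f0) (f1', f0')"
    and d: "d \<in> xmod_homotopy S Y Z (g1, g0) (g1', g0')"
    and e: "e \<in> xmod_homotopy S Z W (h1, h0) (h1', h0')"
  then interpret h: xmod_map S Z W h1 h0 by (simp add: xmod_map_iff)
  note [simp] = xmod_homotopyD(2)[OF c] xmod_homotopyD(2)[OF d] xmod_homotopyD(2)[OF e]
    xmod_hom_funcset(3)[OF f', THEN funcset_mem] xmod_hom_funcset(3)[OF g', THEN funcset_mem]
    xmod_hom_funcset(1)[OF g, THEN funcset_mem]
  show "(\<lambda>b\<in>carrier (xm_base X). e (compose (carrier (xm_base X)) g0' f0' b) \<oplus>\<^bsub>xm_top W\<^esub>
        h1 ((\<lambda>b\<in>carrier (xm_base X). d (f0' b) \<oplus>\<^bsub>xm_top Z\<^esub> g1 (c b)) b)) =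
      (\<lambda>b\<in>carrier (xm_base X).
        (\<lambda>b\<in>carrier (xm_base Y). e (g0' b) \<oplus>\<^bsub>xm_top W\<^esub> h1 (d b)) (f0' b) \<oplus>\<^bsub>xm_top W\<^esub>
        compose (carrier (xm_top Y)) h1 g1 (c b))"
    by (simp add: compose_eq cong: restrict_cong)
next
  fix X Y Z :: "('a, 'u, 'b) xmod" and f1 f0 g1 g0
  assume "crossed_module S Y" "crossed_module S Z"
    and f: "(f1, f0) \<in> xmod_hom S X Y" and "(g1, g0) \<in> xmod_hom S Y Z"
  then interpret g: xmod_map S Y Z g1 g0 by (simp add: xmod_map_iff)
  show "(\<lambda>b\<in>carrier (xm_base X). (\<lambda>b\<in>carrier (xm_base Y). \<zero>\<^bsub>xm_top Z\<^esub>) (f0 b) \<oplus>\<^bsub>xm_top Z\<^esub>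
        g1 ((\<lambda>b\<in>carrier (xm_base X). \<zero>\<^bsub>xm_top Y\<^esub>) b)) =
      (\<lambda>b\<in>carrier (xm_base X). \<zero>\<^bsub>xm_top Z\<^esub>)"
    using xmod_hom_funcset(3)[OF f, THEN funcset_mem] by (simp cong: restrict_cong)
next
  fix X Y Z :: "('a, 'u, 'b) xmod"
    and f1 f0 f1' f0' f1'' f0'' g1 g0 g1' g0' g1'' g0'' c c' d d'
  assume XYZ: "crossed_module S X" "crossed_module S Y" "crossed_module S Z"
    and f': "(f1', f0') \<in> xmod_hom S X Y" and f'': "(f1'', f0'') \<in> xmod_hom S X Y"
    and g: "(g1, g0) \<in> xmod_hom S Y Z" and g': "(g1', g0') \<in> xmod_hom S Y Z"
    and c: "c \<in> xmod_homotopy S X Y (f1, f0) (f1', f0')"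
    and c': "c' \<in> xmod_homotopy S X Y (f1', f0') (f1'', f0'')"
    and d: "d \<in> xmod_homotopy S Y Z (g1, g0) (g1', g0')"
    and d': "d' \<in> xmod_homotopy S Y Z (g1', g0') (g1'', g0'')"
  interpret g: xmod_map S Y Z g1 g0 using XYZ g by (simp add: xmod_map_iff)
  interpret g': xmod_map S Y Z g1' g0' using XYZ g' by (simp add: xmod_map_iff)
  note [simp] = xmod_homotopyD(2)[OF c] xmod_homotopyD(2)[OF d]
    xmod_homotopyD(2)[OF c'] xmod_homotopyD(2)[OF d']
    xmod_hom_funcset(3)[OF f', THEN funcset_mem] xmod_hom_funcset(3)[OF f'', THEN funcset_mem]
  have exchange: "d (f0'' b) \<oplus>\<^bsub>xm_top Z\<^esub> (g1 (c' b) \<oplus>\<^bsub>xm_top Z\<^esub> g1 (c b)) =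
      g1' (c' b) \<oplus>\<^bsub>xm_top Z\<^esub> (d (f0' b) \<oplus>\<^bsub>xm_top Z\<^esub> g1 (c b))"
    if b: "b \<in> carrier (xm_base X)" for b
    using xmod_homotopy_exchange[OF _ _ g.xmod_map_axioms g'.xmod_map_axioms c' d b] b XYZ f' f''
    by (simp add: xmod_map_iff flip: g.top.B.add_assoc)
  show "(\<lambda>b\<in>carrier (xm_base X).
        (\<lambda>b\<in>carrier (xm_base Y). d' b \<oplus>\<^bsub>xm_top Z\<^esub> d b) (f0'' b) \<oplus>\<^bsub>xm_top Z\<^esub>
        g1 ((\<lambda>b\<in>carrier (xm_base X). c' b \<oplus>\<^bsub>xm_top Y\<^esub> c b) b)) =
      (\<lambda>b\<in>carrier (xm_base X).
        (\<lambda>b\<in>carrier (xm_base X). d' (f0'' b) \<oplus>\<^bsub>xm_top Z\<^esub> g1' (c' b)) b \<oplus>\<^bsub>xm_top Z\<^esub>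
        (\<lambda>b\<in>carrier (xm_base X). d (f0' b) \<oplus>\<^bsub>xm_top Z\<^esub> g1 (c b)) b)"
    by (simp add: exchange cong: restrict_cong)
qed

end

section \<open>The crossed module of an internal category\<close>

lemma diff_carrier_update [simp]: "diff (A\<lparr>carrier := K\<rparr>) = diff A"
  by (intro ext) (simp add: diff_def)

lemma trm_val_carrier_update [simp]: "trm_val (A\<lparr>carrier := K\<rparr>) \<rho> t = trm_val A \<rho> t"
  by (induction t) simp_all

definition source_kernel :: "('a, 'u, 'b) icat \<Rightarrow> 'a set" where
  "source_kernel G = {a \<in> carrier (ic_mor G). src G a = \<zero>\<^bsub>ic_ob G\<^esub>}"

definition kernel_xmod :: "('a, 'u, 'b) icat \<Rightarrow> ('a, 'u, 'b) xmod" where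
  "kernel_xmod G = \<lparr>
     xm_top = (ic_mor G)\<lparr>carrier := source_kernel G\<rparr>,
     xm_base = ic_ob G,
     xm_bd = restrict (tgt G) (source_kernel G),
     xm_act = (\<lambda>b a. ide G b \<oplus>\<^bsub>ic_mor G\<^esub> a \<ominus>\<^bsub>ic_mor G\<^esub> ide G b),
     xm_star = (\<lambda>m b a. bin (ic_mor G) m (ide G b) a)\<rparr>"

lemma kernel_xmod_simps [simp]:
  "xm_top (kernel_xmod G) = (ic_mor G)\<lparr>carrier := source_kernel G\<rparr>"
  "xm_base (kernel_xmod G) = ic_ob G"
  "xm_bd (kernel_xmod G) = restrict (tgt G) (source_kernel G)"
  "xm_act (kernel_xmod G) b a = ide G b \<oplus>\<^bsub>ic_mor G\<^esub> a \<ominus>\<^bsub>ic_mor G\<^esub> ide G b"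
  "xm_star (kernel_xmod G) m b a = bin (ic_mor G) m (ide G b) a"
  by (simp_all add: kernel_xmod_def)

context internal_cat
begin

lemma source_kernelD [dest]:
  "a \<in> source_kernel G \<Longrightarrow> a \<in> carrier (ic_mor G)"
  "a \<in> source_kernel G \<Longrightarrow> src G a = \<zero>\<^bsub>ic_ob G\<^esub>"
  by (simp_all add: source_kernel_def)

lemma is_alg_source_kernel: "is_alg S ((ic_mor G)\<lparr>carrier := source_kernel G\<rparr>)"
  using M.is_alg by (simp add: is_alg_def source_kernel_def) blast

text \<open>The kernel of the target map commutes with that of the source map; apply this to \<open>- 1 + a\<close>.\<close>

lemma conjugate_unit_target:
  assumes "a \<in> source_kernel G" "a1 \<in> source_kernel G"
  shows "ide G (tgt G a) \<oplus>\<^bsub>ic_mor G\<^esub> a1 \<ominus>\<^bsub>ic_mor G\<^esub> ide G (tgt G a) =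
         a \<oplus>\<^bsub>ic_mor G\<^esub> a1 \<ominus>\<^bsub>ic_mor G\<^esub> a"
proof -
  have [simp]: "a \<in> carrier (ic_mor G)" "a1 \<in> carrier (ic_mor G)" using assms by auto
  let ?u = "ide G (tgt G a)" let ?y = "neg (ic_mor G) ?u \<oplus>\<^bsub>ic_mor G\<^esub> a"
  have "a1 \<oplus>\<^bsub>ic_mor G\<^esub> ?y = ?y \<oplus>\<^bsub>ic_mor G\<^esub> a1"
    by (rule kernels_annihilateD(1)[OF kernels_annihilate]) (use assms in \<open>simp_all add: source_kernelD\<close>)
  then have "?u \<oplus>\<^bsub>ic_mor G\<^esub> (a1 \<oplus>\<^bsub>ic_mor G\<^esub> ?y) \<oplus>\<^bsub>ic_mor G\<^esub> neg (ic_mor G) a =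
      ?u \<oplus>\<^bsub>ic_mor G\<^esub> (?y \<oplus>\<^bsub>ic_mor G\<^esub> a1) \<oplus>\<^bsub>ic_mor G\<^esub> neg (ic_mor G) a" by (simp only:)
  then show ?thesis by (simp add: diff_def)
qed

text \<open>Likewise \<open>- 1 + a\<close> is annihilated by products with the kernel of the source map.\<close>

lemma bin_unit_target:
  assumes m: "m \<in> bin_ops S" and "a \<in> source_kernel G" "a1 \<in> source_kernel G"
  shows "bin (ic_mor G) m (ide G (tgt G a)) a1 = bin (ic_mor G) m a a1"
    and "bin (ic_mor G) m a1 (ide G (tgt G a)) = bin (ic_mor G) m a1 a"
proof -
  have [simp]: "a \<in> carrier (ic_mor G)" "a1 \<in> carrier (ic_mor G)" using assms by auto
  let ?u = "ide G (tgt G a)" let ?y = "neg (ic_mor G) ?u \<oplus>\<^bsub>ic_mor G\<^esub> a"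
  have eq: "bin (ic_mor G) m a1 ?u = bin (ic_mor G) m a1 a" if m: "m \<in> bin_ops S" for m
  proof -
    have "bin (ic_mor G) m a1 ?y = \<zero>\<^bsub>ic_mor G\<^esub>"
      by (rule kernels_annihilateD(2)[OF kernels_annihilate])
        (use assms m in \<open>simp_all add: source_kernelD\<close>)
    then have "bin (ic_mor G) m a1 a = neg (ic_mor G) (neg (ic_mor G) (bin (ic_mor G) m a1 ?u))"
      using m by (intro M.neg_unique) simp_all
    then show ?thesis using m by simp
  qed
  show "bin (ic_mor G) m a1 ?u = bin (ic_mor G) m a1 a" by (rule eq[OF m])
  show "bin (ic_mor G) m ?u a1 = bin (ic_mor G) m a a1"
    using eq[OF opp_closed[OF m]] m by (simp add: M.bin_opp)
qed

lemma split_ext_kernel: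
  "split_ext S (xm_top (kernel_xmod G)) (ic_mor G) (xm_base (kernel_xmod G))
     (\<lambda>a\<in>source_kernel G. a) (src G) (ide G) (xm_act (kernel_xmod G)) (xm_star (kernel_xmod G))"
proof -
  have "split_extension S (xm_top (kernel_xmod G)) (ic_mor G) (xm_base (kernel_xmod G))
      (\<lambda>a\<in>source_kernel G. a) (src G) (ide G)"
    using is_alg_source_kernel M.is_alg N.is_alg \<sigma>.hom \<iota>.hom
    by (auto simp: split_extension_def alg_hom_def is_alg_def source_kernel_def image_iff
        intro!: inj_onI image_eqI[where x = "ide G _"])
  then show ?thesis
    by unfold_locales
      (use is_alg_source_kernel N.is_alg in \<open>auto simp: source_kernel_def diff_def\<close>)
qed

lemma crossed_module_kernel: "crossed_module S (kernel_xmod G)"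
proof -
  have "derived_actions S (ic_ob G) (xm_top (kernel_xmod G)) (xm_act (kernel_xmod G))
      (xm_star (kernel_xmod G))"
    using split_ext_kernel derived_actions_iff_split_ext[OF groups_with_operations_axioms]
    by fastforce
  moreover have "restrict (tgt G) (source_kernel G) \<in> alg_hom S (xm_top (kernel_xmod G)) (ic_ob G)"
    using is_alg_source_kernel \<tau>.hom by (auto simp: alg_hom_def is_alg_def source_kernel_def)
  moreover have "ide G b \<oplus>\<^bsub>ic_mor G\<^esub> a \<ominus>\<^bsub>ic_mor G\<^esub> ide G b \<in> source_kernel G"
    "m \<in> bin_ops S \<Longrightarrow> bin (ic_mor G) m (ide G b) a \<in> source_kernel G"
    "m \<in> bin_ops S \<Longrightarrow> bin (ic_mor G) m a (ide G b) \<in> source_kernel G"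
    if "b \<in> carrier (ic_ob G)" "a \<in> source_kernel G" for a b m
    using that by (auto simp: source_kernel_def diff_def)
  moreover have "tgt G (ide G b \<oplus>\<^bsub>ic_mor G\<^esub> a \<ominus>\<^bsub>ic_mor G\<^esub> ide G b) =
      b \<oplus>\<^bsub>ic_ob G\<^esub> tgt G a \<ominus>\<^bsub>ic_ob G\<^esub> b"
    if "b \<in> carrier (ic_ob G)" "a \<in> source_kernel G" for a b
    using that by (auto simp: diff_def)
  ultimately show ?thesis
    using is_alg_source_kernel N.is_alg
    by (simp add: crossed_module_def Let_def conjugate_unit_target bin_unit_target opp_closed
        M.bin_opp source_kernelD)
qed

sublocale kernel: xmod_split S "kernel_xmod G" "ic_mor G" "\<lambda>a\<in>source_kernel G. a" "src G" "ide G"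
  by (intro xmod_split.intro xmod_split_axioms.intro split_ext_kernel crossed_module_kernel)

definition kernel_component :: "'a \<Rightarrow> 'a" where
  "kernel_component e = e \<ominus>\<^bsub>ic_mor G\<^esub> ide G (src G e)"

lemma kernel_component_in [simp]:
  "e \<in> carrier (ic_mor G) \<Longrightarrow> kernel_component e \<in> source_kernel G"
  by (simp add: kernel_component_def source_kernel_def diff_def)

lemma tgt_kernel_component:
  "e \<in> carrier (ic_mor G) \<Longrightarrow> tgt G (kernel_component e) = tgt G e \<ominus>\<^bsub>ic_ob G\<^esub> src G e"
  by (simp add: kernel_component_def diff_def)

lemma kernel_component_decompose:
  "e \<in> carrier (ic_mor G) \<Longrightarrow> kernel_component e \<oplus>\<^bsub>ic_mor G\<^esub> ide G (src G e) = e"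
  by (simp add: kernel_component_def diff_def)

lemma derivation_kernel_component: "kernel.derivation (ic_mor G) (src G) kernel_component"
proof -
  have "kernel.ker_part e = kernel_component e" if "e \<in> carrier (ic_mor G)" for e
    using kernel.i_ker_part[OF that] kernel.ker_part_closed[OF that]
    by (simp add: kernel_component_def)
  then show ?thesis
    using kernel.derivation_ker_part
    by (simp add: kernel.derivation_def del: kernel_xmod_simps)
qed

end

text \<open>Every internal category is a groupoid: the inverse of \<open>a : x \<rightarrow> y\<close> is \<open>1\<^sub>x - a + 1\<^sub>y\<close>.\<close>

lemma (in internal_cat) all_invertible:
  assumes [simp]: "a \<in> carrier (ic_mor G)"
  shows "ic_invertible G a"
proof -
  define b where "b = ide G (src G a) \<ominus>\<^bsub>ic_mor G\<^esub> a \<oplus>\<^bsub>ic_mor G\<^esub> ide G (tgt G a)"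
  have b: "b \<in> carrier (ic_mor G)" "src G b = tgt G a" "tgt G b = src G a"
    by (simp_all add: b_def diff_def)
  moreover have "cmp G (b, a) = ide G (src G a)" "cmp G (a, b) = ide G (tgt G a)"
    using b by (simp_all add: cmp_eq_composite composite_def) (simp_all add: b_def diff_def)
  ultimately show ?thesis unfolding ic_invertible_def by auto
qed

locale icat_pair = G: internal_cat S G + H: internal_cat S H
  for S :: "('u, 'b) theory_sig" and G H :: "('a, 'u, 'b) icat"
begin

lemma functor_morphisms:
  assumes "(f1, f0) \<in> internal_functor S G H"
  shows "alg_morphism S (ic_mor G) (ic_mor H) f1" "alg_morphism S (ic_ob G) (ic_ob H) f0"
  by (unfold_locales; use assms in \<open>simp add: internal_functor_def\<close>)+

lemma functor_laws:
  assumes "(f1, f0) \<in> internal_functor S G H"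
  shows "a \<in> carrier (ic_mor G) \<Longrightarrow> src H (f1 a) = f0 (src G a)"
    "a \<in> carrier (ic_mor G) \<Longrightarrow> tgt H (f1 a) = f0 (tgt G a)"
    "x \<in> carrier (ic_ob G) \<Longrightarrow> f1 (ide G x) = ide H (f0 x)"
    "a \<in> source_kernel G \<Longrightarrow> f1 a \<in> source_kernel H"
proof -
  interpret f1: alg_morphism S "ic_mor G" "ic_mor H" f1 by (rule functor_morphisms[OF assms])
  interpret f0: alg_morphism S "ic_ob G" "ic_ob H" f0 by (rule functor_morphisms[OF assms])
  show *: "a \<in> carrier (ic_mor G) \<Longrightarrow> src H (f1 a) = f0 (src G a)"
    "a \<in> carrier (ic_mor G) \<Longrightarrow> tgt H (f1 a) = f0 (tgt G a)"
    "x \<in> carrier (ic_ob G) \<Longrightarrow> f1 (ide G x) = ide H (f0 x)"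
    using assms by (simp_all add: internal_functor_def)
  show "a \<in> source_kernel G \<Longrightarrow> f1 a \<in> source_kernel H"
    by (simp add: source_kernel_def *(1))
qed

text \<open>Composition in both categories is given by a formula, so it is preserved for free.\<close>

lemma internal_functorI:
  assumes "f1 \<in> alg_hom S (ic_mor G) (ic_mor H)" "f0 \<in> alg_hom S (ic_ob G) (ic_ob H)"
    and ends: "\<And>a. a \<in> carrier (ic_mor G) \<Longrightarrow> src H (f1 a) = f0 (src G a)"
    "\<And>a. a \<in> carrier (ic_mor G) \<Longrightarrow> tgt H (f1 a) = f0 (tgt G a)"
    and unit: "\<And>x. x \<in> carrier (ic_ob G) \<Longrightarrow> f1 (ide G x) = ide H (f0 x)"
  shows "(f1, f0) \<in> internal_functor S G H"
proof -
  interpret f1: alg_morphism S "ic_mor G" "ic_mor H" f1 by unfold_locales fact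
  interpret f0: alg_morphism S "ic_ob G" "ic_ob H" f0 by unfold_locales fact
  have "f1 (cmp G (b, a)) = cmp H (f1 b, f1 a)"
    if "a \<in> carrier (ic_mor G)" "b \<in> carrier (ic_mor G)" "src G b = tgt G a" for a b
    using that by (simp add: G.cmp_eq_composite H.cmp_eq_composite G.composite_def H.composite_def
        diff_def ends unit)
  then show ?thesis using assms by (simp add: internal_functor_def)
qed

lemma restrict_functor_to_kernel:
  assumes "(f1, f0) \<in> internal_functor S G H"
  shows "(restrict f1 (source_kernel G), f0) \<in> xmod_hom S (kernel_xmod G) (kernel_xmod H)"
proof -
  interpret f1: alg_morphism S "ic_mor G" "ic_mor H" f1 by (rule functor_morphisms[OF assms])
  interpret f0: alg_morphism S "ic_ob G" "ic_ob H" f0 by (rule functor_morphisms[OF assms])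
  note laws = functor_laws[OF assms]
  have "restrict f1 (source_kernel G)
      \<in> alg_hom S (xm_top (kernel_xmod G)) (xm_top (kernel_xmod H))"
    by (rule alg_homI)
      (use G.kernel.A.operation_algebra_axioms H.kernel.A.operation_algebra_axioms
        G.kernel.A.add_closed G.kernel.A.un_closed G.kernel.A.bin_closed laws
        in \<open>auto simp: G.source_kernelD\<close>)
  moreover have "f0 \<in> alg_hom S (xm_base (kernel_xmod G)) (xm_base (kernel_xmod H))"
    by (simp add: f0.hom)
  moreover have "f1 (xm_act (kernel_xmod G) b a) = xm_act (kernel_xmod H) (f0 b) (f1 a)"
    if "b \<in> carrier (ic_ob G)" "a \<in> source_kernel G" for a b
    using that by (simp add: G.source_kernelD laws f1.map_diff)
  ultimately show ?thesis
    using G.kernel.act_closed G.kernel.star_closed laws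
    by (simp add: xmod_hom_def G.source_kernelD)
qed

text \<open>
  The extension is the lift of \<open>k\<close> composed with the kernel component, which is a derivation because
  \<open>k\<close> respects the actions.
\<close>

definition extend_to_functor :: "('a \<Rightarrow> 'a) \<Rightarrow> ('a \<Rightarrow> 'a) \<Rightarrow> 'a \<Rightarrow> 'a" where
  "extend_to_functor k f0 =
     (\<lambda>e\<in>carrier (ic_mor G). k (G.kernel_component e) \<oplus>\<^bsub>ic_mor H\<^esub> ide H (f0 (src G e)))"

lemma extend_to_functor:
  assumes k: "(k, f0) \<in> xmod_hom S (kernel_xmod G) (kernel_xmod H)"
  shows "(extend_to_functor k f0, f0) \<in> internal_functor S G H"
    and "restrict (extend_to_functor k f0) (source_kernel G) = k"
proof -
  interpret k: xmod_map S "kernel_xmod G" "kernel_xmod H" k f0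
    by unfold_locales (rule G.crossed_module_kernel H.crossed_module_kernel k)+
  interpret f0: alg_morphism S "ic_ob G" "ic_ob H" f0
    using k.base.alg_morphism_axioms by simp
  have k_in: "k a \<in> source_kernel H" if "a \<in> source_kernel G" for a
    using k.top.closed[of a] that by simp
  have k_mor [simp]: "k a \<in> carrier (ic_mor H)" "src H (k a) = \<zero>\<^bsub>ic_ob H\<^esub>"
    "tgt H (k a) = f0 (tgt G a)" if "a \<in> source_kernel G" for a
    using k_in[OF that] k.map_bd[of a] that by (simp_all add: H.source_kernelD)
  let ?p = "compose (carrier (ic_mor G)) f0 (src G)"
  let ?d = "compose (carrier (ic_mor G)) k G.kernel_component"
  have p: "alg_morphism S (ic_mor G) (ic_ob H) ?p"
    by unfold_locales (rule compose_alg_hom[OF G.M.is_alg G.\<sigma>.hom f0.hom])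
  have "extend_to_functor k f0 = H.kernel.lift (ic_mor G) ?p ?d"
    by (auto simp: extend_to_functor_def H.kernel.lift_def compose_eq k_in)
  moreover have "G.kernel_component e \<in> carrier (xm_top (kernel_xmod G))"
    if "e \<in> carrier (ic_mor G)" for e
    using that by simp
  then have "H.kernel.derivation (ic_mor G) ?p ?d"
    using G.derivation_kernel_component
    by (simp add: G.kernel.derivation_def H.kernel.derivation_def compose_eq G.opp_closed
        del: kernel_xmod_simps)
  ultimately have hom: "extend_to_functor k f0 \<in> alg_hom S (ic_mor G) (ic_mor H)"
    using H.kernel.lift_hom_iff_derivation[of "ic_mor G" ?p ?d] p
    by (simp add: compose_eq k_in)
  have "tgt H (extend_to_functor k f0 e) = f0 (tgt G e)" if "e \<in> carrier (ic_mor G)" for e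
    using that by (simp add: extend_to_functor_def G.tgt_kernel_component diff_def)
  then show "(extend_to_functor k f0, f0) \<in> internal_functor S G H"
  proof (intro internal_functorI hom f0.hom)
    show "src H (extend_to_functor k f0 e) = f0 (src G e)" if "e \<in> carrier (ic_mor G)" for e
      using that by (simp add: extend_to_functor_def)
    show "extend_to_functor k f0 (ide G x) = ide H (f0 x)" if "x \<in> carrier (ic_ob G)" for x
      using that k.top.map_zero
      by (simp add: extend_to_functor_def G.kernel_component_def diff_def)
  qed
  show "restrict (extend_to_functor k f0) (source_kernel G) = k"
  proof
    fix a
    show "restrict (extend_to_functor k f0) (source_kernel G) a = k a"
      using k.top.extensional
      by (cases "a \<in> source_kernel G")
        (simp_all add: extend_to_functor_def extensional_def G.kernel_component_def
          G.source_kernelD diff_def)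
  qed
qed

text \<open>
  For \<open>a = k + 1\<close> with \<open>k\<close> in the kernel of the source map, naturality at \<open>a\<close> reduces to naturality
  at \<open>k\<close>: in \<open>H\<close>, conjugating \<open>d = \<eta> x - 1\<close> by \<open>f1 k\<close> has the same effect as conjugating it by the
  identity \<open>u\<close> on the target of \<open>f1 k\<close>. At \<open>k\<close> itself the source is \<open>0\<close>, where \<open>\<eta>\<close> vanishes.
\<close>

lemma natural_iff_natural_on_kernel:
  assumes f: "(f1, f0) \<in> internal_functor S G H" and g: "(g1, g0) \<in> internal_functor S G H"
    and \<eta>: "alg_morphism S (ic_ob G) (ic_mor H) \<eta>"
    and src: "\<And>x. x \<in> carrier (ic_ob G) \<Longrightarrow> src H (\<eta> x) = f0 x"
    and tgt: "\<And>x. x \<in> carrier (ic_ob G) \<Longrightarrow> tgt H (\<eta> x) = g0 x"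
  shows "(\<forall>a\<in>carrier (ic_mor G). cmp H (\<eta> (tgt G a), f1 a) = cmp H (g1 a, \<eta> (src G a))) \<longleftrightarrow>
     (\<forall>a\<in>source_kernel G.
        \<eta> (tgt G a) \<ominus>\<^bsub>ic_mor H\<^esub> ide H (f0 (tgt G a)) = g1 a \<ominus>\<^bsub>ic_mor H\<^esub> f1 a)"
    (is "?nat \<longleftrightarrow> ?ker")
proof -
  interpret f1: alg_morphism S "ic_mor G" "ic_mor H" f1 by (rule functor_morphisms[OF f])
  interpret f0: alg_morphism S "ic_ob G" "ic_ob H" f0 by (rule functor_morphisms[OF f])
  interpret g1: alg_morphism S "ic_mor G" "ic_mor H" g1 by (rule functor_morphisms[OF g])
  interpret g0: alg_morphism S "ic_ob G" "ic_ob H" g0 by (rule functor_morphisms[OF g])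
  interpret \<eta>: alg_morphism S "ic_ob G" "ic_mor H" \<eta> by fact
  note [simp] = functor_laws(1-3)[OF f] functor_laws(1-3)[OF g] src tgt
  have nat: "cmp H (\<eta> (tgt G a), f1 a) = cmp H (g1 a, \<eta> (src G a)) \<longleftrightarrow>
      \<eta> (tgt G a) \<ominus>\<^bsub>ic_mor H\<^esub> ide H (f0 (tgt G a)) \<oplus>\<^bsub>ic_mor H\<^esub> f1 a =
      g1 a \<ominus>\<^bsub>ic_mor H\<^esub> ide H (g0 (src G a)) \<oplus>\<^bsub>ic_mor H\<^esub> \<eta> (src G a)"
    if "a \<in> carrier (ic_mor G)" for a
    using that by (simp add: H.cmp_eq_composite H.composite_def)
  show ?thesis
  proof
    assume ?nat
    then have "\<eta> (tgt G a) \<ominus>\<^bsub>ic_mor H\<^esub> ide H (f0 (tgt G a)) \<oplus>\<^bsub>ic_mor H\<^esub> f1 a = g1 a"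
      if "a \<in> source_kernel G" for a
      using nat[of a] that by (simp add: G.source_kernelD diff_def)
    then show ?ker by (simp add: H.M.diff_eq_iff G.source_kernelD)
  next
    assume ker: ?ker
    show ?nat
    proof
      fix a assume a: "a \<in> carrier (ic_mor G)"
      define x where "x = src G a"
      define k where "k = G.kernel_component a"
      define u where "u = ide H (f0 (tgt G k))"
      define d where "d = \<eta> x \<ominus>\<^bsub>ic_mor H\<^esub> ide H (f0 x)"
      have x [simp]: "x \<in> carrier (ic_ob G)" using a by (simp add: x_def)
      have k_in: "k \<in> source_kernel G" using a by (simp add: k_def)
      then have k [simp]: "k \<in> carrier (ic_mor G)" "src G k = \<zero>\<^bsub>ic_ob G\<^esub>"
        by (auto simp: G.source_kernelD)
      have a_eq: "a = k \<oplus>\<^bsub>ic_mor G\<^esub> ide G x"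
        using a by (simp add: k_def x_def G.kernel_component_decompose)
      have [simp]: "u \<in> carrier (ic_mor H)" "d \<in> carrier (ic_mor H)"
        by (simp_all add: u_def d_def)
      have \<eta>x: "\<eta> x = d \<oplus>\<^bsub>ic_mor H\<^esub> ide H (f0 x)" by (simp add: d_def diff_def)
      have "\<eta> (tgt G k) \<ominus>\<^bsub>ic_mor H\<^esub> u = g1 k \<ominus>\<^bsub>ic_mor H\<^esub> f1 k"
        using ker k_in by (simp add: u_def)
      then have \<eta>k: "\<eta> (tgt G k) = g1 k \<oplus>\<^bsub>ic_mor H\<^esub> (neg (ic_mor H) (f1 k) \<oplus>\<^bsub>ic_mor H\<^esub> u)"
        using H.M.diff_eq_iff[of "g1 k \<ominus>\<^bsub>ic_mor H\<^esub> f1 k" "\<eta> (tgt G k)" u]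
        by (simp add: diff_def)
      have "d \<in> source_kernel H" by (simp add: d_def source_kernel_def diff_def)
      then have "u \<oplus>\<^bsub>ic_mor H\<^esub> d \<ominus>\<^bsub>ic_mor H\<^esub> u = f1 k \<oplus>\<^bsub>ic_mor H\<^esub> d \<ominus>\<^bsub>ic_mor H\<^esub> f1 k"
        using H.conjugate_unit_target[of "f1 k" d] functor_laws(4)[OF f k_in] by (simp add: u_def)
      then have "g1 k \<oplus>\<^bsub>ic_mor H\<^esub> neg (ic_mor H) (f1 k) \<oplus>\<^bsub>ic_mor H\<^esub>
            (u \<oplus>\<^bsub>ic_mor H\<^esub> d \<ominus>\<^bsub>ic_mor H\<^esub> u) \<oplus>\<^bsub>ic_mor H\<^esub> f1 k \<oplus>\<^bsub>ic_mor H\<^esub> ide H (f0 x) =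
          g1 k \<oplus>\<^bsub>ic_mor H\<^esub> neg (ic_mor H) (f1 k) \<oplus>\<^bsub>ic_mor H\<^esub>
            (f1 k \<oplus>\<^bsub>ic_mor H\<^esub> d \<ominus>\<^bsub>ic_mor H\<^esub> f1 k) \<oplus>\<^bsub>ic_mor H\<^esub> f1 k \<oplus>\<^bsub>ic_mor H\<^esub> ide H (f0 x)"
        by (simp only:)
      then show "cmp H (\<eta> (tgt G a), f1 a) = cmp H (g1 a, \<eta> (src G a))"
        unfolding nat[OF a] unfolding a_eq
        by (simp add: diff_def \<eta>k \<eta>x flip: u_def)
    qed
  qed
qed

text \<open>
  Subtracting units turns natural transformations into homotopies: the law of derivations says that
  \<open>\<eta>\<close> is a morphism of algebras, the two boundary laws are its target and its naturality.
\<close>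

lemma internal_homotopy_iff_xmod_homotopy:
  assumes f: "(f1, f0) \<in> internal_functor S G H" and g: "(g1, g0) \<in> internal_functor S G H"
    and \<eta>: "\<eta> \<in> carrier (ic_ob G) \<rightarrow>\<^sub>E carrier (ic_mor H)"
    and src: "\<And>x. x \<in> carrier (ic_ob G) \<Longrightarrow> src H (\<eta> x) = f0 x"
  shows "\<eta> \<in> internal_homotopy S G H (f1, f0) (g1, g0) \<longleftrightarrow>
     (\<lambda>x\<in>carrier (ic_ob G). \<eta> x \<ominus>\<^bsub>ic_mor H\<^esub> ide H (f0 x))
       \<in> xmod_homotopy S (kernel_xmod G) (kernel_xmod H)
           (restrict f1 (source_kernel G), f0) (restrict g1 (source_kernel G), g0)"
proof -
  interpret f0: alg_morphism S "ic_ob G" "ic_ob H" f0 by (rule functor_morphisms[OF f])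
  interpret g0: alg_morphism S "ic_ob G" "ic_ob H" g0 by (rule functor_morphisms[OF g])
  have \<eta>_in [simp]: "\<eta> x \<in> carrier (ic_mor H)" if "x \<in> carrier (ic_ob G)" for x
    using \<eta> that by auto
  define d where "d = (\<lambda>x\<in>carrier (ic_ob G). \<eta> x \<ominus>\<^bsub>ic_mor H\<^esub> ide H (f0 x))"
  have d_in: "d x \<in> source_kernel H" if "x \<in> carrier (ic_ob G)" for x
    using that by (simp add: d_def source_kernel_def diff_def src)
  then have d_PiE: "d \<in> carrier (ic_ob G) \<rightarrow>\<^sub>E source_kernel H"
    by (auto simp: d_def)
  have "H.kernel.lift (ic_ob G) f0 d = \<eta>"
  proof
    show "H.kernel.lift (ic_ob G) f0 d x = \<eta> x" for x
      using \<eta> d_in[of x]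
      by (cases "x \<in> carrier (ic_ob G)")
        (simp_all add: H.kernel.lift_def d_def diff_def PiE_arb[OF \<eta>])
  qed
  then have hom: "\<eta> \<in> alg_hom S (ic_ob G) (ic_mor H) \<longleftrightarrow> H.kernel.derivation (ic_ob G) f0 d"
    using H.kernel.lift_hom_iff_derivation[of "ic_ob G" f0 d] f0.alg_morphism_axioms d_in
    by simp
  have tgt: "tgt H (d x) = g0 x \<ominus>\<^bsub>ic_ob H\<^esub> f0 x \<longleftrightarrow> tgt H (\<eta> x) = g0 x"
    if "x \<in> carrier (ic_ob G)" for x
    using that by (simp add: H.N.diff_eq_iff d_def) (simp add: diff_def)
  have nat: "(\<forall>a\<in>carrier (ic_mor G). cmp H (\<eta> (tgt G a), f1 a) = cmp H (g1 a, \<eta> (src G a))) \<longleftrightarrow>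
     (\<forall>a\<in>source_kernel G. d (tgt G a) = g1 a \<ominus>\<^bsub>ic_mor H\<^esub> f1 a)"
    if "\<eta> \<in> alg_hom S (ic_ob G) (ic_mor H)" "\<forall>x\<in>carrier (ic_ob G). tgt H (\<eta> x) = g0 x"
  proof -
    have "alg_morphism S (ic_ob G) (ic_mor H) \<eta>" by unfold_locales fact
    then show ?thesis
      using natural_iff_natural_on_kernel[OF f g _ src] that by (simp add: d_def G.source_kernelD)
  qed
  have "d \<in> xmod_homotopy S (kernel_xmod G) (kernel_xmod H)
        (restrict f1 (source_kernel G), f0) (restrict g1 (source_kernel G), g0) \<longleftrightarrow>
      H.kernel.derivation (ic_ob G) f0 d \<and>
      (\<forall>x\<in>carrier (ic_ob G). tgt H (d x) = g0 x \<ominus>\<^bsub>ic_ob H\<^esub> f0 x) \<and>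
      (\<forall>a\<in>source_kernel G. d (tgt G a) = g1 a \<ominus>\<^bsub>ic_mor H\<^esub> f1 a)"
    using d_PiE d_in by (simp add: H.kernel.xmod_homotopy_iff)
  also have "\<dots> \<longleftrightarrow> \<eta> \<in> alg_hom S (ic_ob G) (ic_mor H) \<and>
      (\<forall>x\<in>carrier (ic_ob G). tgt H (\<eta> x) = g0 x) \<and>
      (\<forall>a\<in>carrier (ic_mor G). cmp H (\<eta> (tgt G a), f1 a) = cmp H (g1 a, \<eta> (src G a)))"
    by (intro conj_cong hom[symmetric] ball_cong[OF refl tgt] nat[symmetric])
  also have "\<dots> \<longleftrightarrow> \<eta> \<in> internal_homotopy S G H (f1, f0) (g1, g0)"
    by (auto simp: internal_homotopy_def src H.all_invertible)
  finally show ?thesis by (simp add: d_def)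
qed

end

section \<open>Equivalences from locally bijective maps\<close>

text \<open>
  A bare category, used twice below: for the 1-cells of a 2-category, and for its 2-cells, bundled with
  their boundaries, under horizontal composition.
\<close>

locale plain_category =
  fixes obj :: "'o set" and hom :: "'o \<Rightarrow> 'o \<Rightarrow> 'm set" and idt :: "'o \<Rightarrow> 'm"
    and comp :: "'o \<Rightarrow> 'o \<Rightarrow> 'o \<Rightarrow> 'm \<Rightarrow> 'm \<Rightarrow> 'm"
  assumes idt_in: "x \<in> obj \<Longrightarrow> idt x \<in> hom x x"
    and comp_in: "\<lbrakk>x \<in> obj; y \<in> obj; z \<in> obj; f \<in> hom x y; g \<in> hom y z\<rbrakk> \<Longrightarrow> comp x y z g f \<in> hom x z"
    and idt_right: "\<lbrakk>x \<in> obj; y \<in> obj; f \<in> hom x y\<rbrakk> \<Longrightarrow> comp x x y f (idt x) = f"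
    and idt_left: "\<lbrakk>x \<in> obj; y \<in> obj; f \<in> hom x y\<rbrakk> \<Longrightarrow> comp x y y (idt y) f = f"
    and assoc: "\<lbrakk>x \<in> obj; y \<in> obj; z \<in> obj; w \<in> obj; f \<in> hom x y; g \<in> hom y z; h \<in> hom z w\<rbrakk>
      \<Longrightarrow> comp x y w (comp y z w h g) f = comp x z w h (comp x y z g f)"

text \<open>Transport along a family of isomorphisms \<open>u x : x \<rightarrow> t x\<close> with inverses \<open>v x\<close>.\<close>

locale conjugation = plain_category +
  fixes t :: "'a \<Rightarrow> 'a" and u v :: "'a \<Rightarrow> 'b"
  assumes t_in: "x \<in> obj \<Longrightarrow> t x \<in> obj"
    and u_in: "x \<in> obj \<Longrightarrow> u x \<in> hom x (t x)"
    and v_in: "x \<in> obj \<Longrightarrow> v x \<in> hom (t x) x"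
    and v_u: "x \<in> obj \<Longrightarrow> comp x (t x) x (v x) (u x) = idt x"
    and u_v: "x \<in> obj \<Longrightarrow> comp (t x) x (t x) (u x) (v x) = idt (t x)"
begin

definition conjugate :: "'a \<Rightarrow> 'a \<Rightarrow> 'b \<Rightarrow> 'b" where
  "conjugate x y f = comp (t x) x (t y) (comp x y (t y) (u y) f) (v x)"

lemmas category_simps = idt_in comp_in idt_right idt_left assoc t_in u_in v_in v_u u_v

lemma v_u_cancel:
  "\<lbrakk>x \<in> obj; y \<in> obj; f \<in> hom x y\<rbrakk> \<Longrightarrow> comp x (t y) y (v y) (comp x y (t y) (u y) f) = f"
  using assoc[of x y "t y" y f "u y" "v y"] by (simp add: category_simps)

lemma conjugate_in: "\<lbrakk>x \<in> obj; y \<in> obj; f \<in> hom x y\<rbrakk> \<Longrightarrow> conjugate x y f \<in> hom (t x) (t y)"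
  by (simp add: conjugate_def category_simps)

lemma conjugate_idt: "x \<in> obj \<Longrightarrow> conjugate x x (idt x) = idt (t x)"
  by (simp add: conjugate_def category_simps)

lemma conjugate_comp:
  "\<lbrakk>x \<in> obj; y \<in> obj; z \<in> obj; f \<in> hom x y; g \<in> hom y z\<rbrakk>
   \<Longrightarrow> conjugate x z (comp x y z g f) = comp (t x) (t y) (t z) (conjugate y z g) (conjugate x y f)"
  by (simp add: conjugate_def category_simps v_u_cancel)

lemma conjugate_u:
  "\<lbrakk>x \<in> obj; y \<in> obj; f \<in> hom x y\<rbrakk>
   \<Longrightarrow> comp x (t x) (t y) (conjugate x y f) (u x) = comp x y (t y) (u y) f"
  by (simp add: conjugate_def category_simps)

lemma v_conjugate:
  "\<lbrakk>x \<in> obj; y \<in> obj; f \<in> hom x y\<rbrakk>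
   \<Longrightarrow> comp (t x) (t y) y (v y) (conjugate x y f) = comp (t x) x y f (v x)"
  by (simp add: conjugate_def category_simps v_u_cancel)

end

context two_category
begin

sublocale cells1: plain_category "ob K" "cell1 K" "id1 K" "comp1 K"
  by unfold_locales
    (simp_all add: id1_in comp1_in comp1_id_right comp1_id_left comp1_assoc)

definition bundled_cell2 :: "'o \<Rightarrow> 'o \<Rightarrow> ('m \<times> 'm \<times> 'c) set" where
  "bundled_cell2 x y = {(f, g, d). f \<in> cell1 K x y \<and> g \<in> cell1 K x y \<and> d \<in> cell2 K x y f g}"

definition bundled_hcomp :: "'o \<Rightarrow> 'o \<Rightarrow> 'o \<Rightarrow> 'm \<times> 'm \<times> 'c \<Rightarrow> 'm \<times> 'm \<times> 'c \<Rightarrow> 'm \<times> 'm \<times> 'c" where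
  "bundled_hcomp x y z = (\<lambda>(h, k, e) (f, g, d).
     (comp1 K x y z h f, comp1 K x y z k g, hcomp K x y z f g h k e d))"

sublocale cells2: plain_category "ob K" bundled_cell2
  "\<lambda>x. (id1 K x, id1 K x, id2 K x x (id1 K x))" bundled_hcomp
  by unfold_locales
    (auto simp: bundled_cell2_def bundled_hcomp_def id1_in comp1_in comp1_id_right comp1_id_left
      comp1_assoc id2_in hcomp_in hcomp_id_right hcomp_id_left hcomp_assoc)

lemma whisker_left_vcomp:
  assumes "x \<in> ob K" "y \<in> ob K" "z \<in> ob K" "w \<in> cell1 K y z"
    "f \<in> cell1 K x y" "g \<in> cell1 K x y" "h \<in> cell1 K x y"
    "d \<in> cell2 K x y f g" "e \<in> cell2 K x y g h"
  shows "hcomp K x y z f h w w (id2 K y z w) (vcomp K x y f g h e d) =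
    vcomp K x z (comp1 K x y z w f) (comp1 K x y z w g) (comp1 K x y z w h)
      (hcomp K x y z g h w w (id2 K y z w) e) (hcomp K x y z f g w w (id2 K y z w) d)"
  using interchange[of x y z f g h w w w d e "id2 K y z w" "id2 K y z w"] assms
  by (simp add: id2_in vcomp_id_left)

lemma whisker_right_vcomp:
  assumes "x \<in> ob K" "y \<in> ob K" "z \<in> ob K" "w \<in> cell1 K x y"
    "f \<in> cell1 K y z" "g \<in> cell1 K y z" "h \<in> cell1 K y z"
    "d \<in> cell2 K y z f g" "e \<in> cell2 K y z g h"
  shows "hcomp K x y z w w f h (vcomp K y z f g h e d) (id2 K x y w) =
    vcomp K x z (comp1 K x y z f w) (comp1 K x y z g w) (comp1 K x y z h w)
      (hcomp K x y z w w g h e (id2 K x y w)) (hcomp K x y z w w f g d (id2 K x y w))"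
  using interchange[of x y z w w w f g h "id2 K x y w" "id2 K x y w" d e] assms
  by (simp add: id2_in vcomp_id_left)

end

locale two_conjugation = two_category K +
  one: conjugation "ob K" "cell1 K" "id1 K" "comp1 K" t u v
  for K :: "('o, 'm, 'c) two_cat" and t u v
begin

sublocale two: conjugation "ob K" bundled_cell2
  "\<lambda>x. (id1 K x, id1 K x, id2 K x x (id1 K x))" bundled_hcomp
  t "\<lambda>x. (u x, u x, id2 K x (t x) (u x))" "\<lambda>x. (v x, v x, id2 K (t x) x (v x))"
  by unfold_locales
    (auto simp: bundled_cell2_def bundled_hcomp_def id2_in hcomp_id2
      one.t_in one.u_in one.v_in one.u_v one.v_u)

definition conjugate2 :: "'o \<Rightarrow> 'o \<Rightarrow> 'm \<Rightarrow> 'm \<Rightarrow> 'c \<Rightarrow> 'c" where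
  "conjugate2 x y f g d = hcomp K (t x) x (t y) (v x) (v x)
     (comp1 K x y (t y) (u y) f) (comp1 K x y (t y) (u y) g)
     (hcomp K x y (t y) f g (u y) (u y) (id2 K y (t y) (u y)) d) (id2 K (t x) x (v x))"

text \<open>
  The statements about conjugation in a bare category, read for bundled 2-cells, give naturality and
  compatibility with horizontal composition; identities and vertical composites need whiskering.
\<close>

lemma bundled_conjugate: "two.conjugate x y (f, g, d) = (one.conjugate x y f, one.conjugate x y g, conjugate2 x y f g d)"
  by (simp add: two.conjugate_def one.conjugate_def conjugate2_def bundled_hcomp_def)

lemma conjugate2_in:
  "\<lbrakk>x \<in> ob K; y \<in> ob K; f \<in> cell1 K x y; g \<in> cell1 K x y; d \<in> cell2 K x y f g\<rbrakk>
   \<Longrightarrow> conjugate2 x y f g d \<in> cell2 K (t x) (t y) (one.conjugate x y f) (one.conjugate x y g)"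
  using two.conjugate_in[of x y "(f, g, d)"] by (simp add: bundled_conjugate bundled_cell2_def)

lemma conjugate2_hcomp:
  "\<lbrakk>x \<in> ob K; y \<in> ob K; z \<in> ob K; f \<in> cell1 K x y; g \<in> cell1 K x y;
    h \<in> cell1 K y z; k \<in> cell1 K y z; d \<in> cell2 K x y f g; e \<in> cell2 K y z h k\<rbrakk>
   \<Longrightarrow> conjugate2 x z (comp1 K x y z h f) (comp1 K x y z k g) (hcomp K x y z f g h k e d) =
       hcomp K (t x) (t y) (t z) (one.conjugate x y f) (one.conjugate x y g) (one.conjugate y z h) (one.conjugate y z k)
         (conjugate2 y z h k e) (conjugate2 x y f g d)"
  using two.conjugate_comp[of x y z "(f, g, d)" "(h, k, e)"]
  by (simp add: bundled_conjugate bundled_cell2_def bundled_hcomp_def)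

lemma conjugate2_u:
  "\<lbrakk>x \<in> ob K; y \<in> ob K; f \<in> cell1 K x y; g \<in> cell1 K x y; d \<in> cell2 K x y f g\<rbrakk>
   \<Longrightarrow> hcomp K x (t x) (t y) (u x) (u x) (one.conjugate x y f) (one.conjugate x y g)
         (conjugate2 x y f g d) (id2 K x (t x) (u x)) =
       hcomp K x y (t y) f g (u y) (u y) (id2 K y (t y) (u y)) d"
  using two.conjugate_u[of x y "(f, g, d)"]
  by (simp add: bundled_conjugate bundled_cell2_def bundled_hcomp_def)

lemma v_conjugate2:
  "\<lbrakk>x \<in> ob K; y \<in> ob K; f \<in> cell1 K x y; g \<in> cell1 K x y; d \<in> cell2 K x y f g\<rbrakk>
   \<Longrightarrow> hcomp K (t x) (t y) y (one.conjugate x y f) (one.conjugate x y g) (v y) (v y)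
         (id2 K (t y) y (v y)) (conjugate2 x y f g d) =
       hcomp K (t x) x y (v x) (v x) f g d (id2 K (t x) x (v x))"
  using two.v_conjugate[of x y "(f, g, d)"]
  by (simp add: bundled_conjugate bundled_cell2_def bundled_hcomp_def)

lemma conjugate2_id2:
  "\<lbrakk>x \<in> ob K; y \<in> ob K; f \<in> cell1 K x y\<rbrakk>
   \<Longrightarrow> conjugate2 x y f f (id2 K x y f) = id2 K (t x) (t y) (one.conjugate x y f)"
  by (simp add: conjugate2_def one.conjugate_def hcomp_id2 comp1_in one.t_in one.u_in one.v_in)

lemma conjugate2_vcomp:
  "\<lbrakk>x \<in> ob K; y \<in> ob K; f \<in> cell1 K x y; g \<in> cell1 K x y; h \<in> cell1 K x y;
    d \<in> cell2 K x y f g; e \<in> cell2 K x y g h\<rbrakk>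
   \<Longrightarrow> conjugate2 x y f h (vcomp K x y f g h e d) =
       vcomp K (t x) (t y) (one.conjugate x y f) (one.conjugate x y g) (one.conjugate x y h)
         (conjugate2 x y g h e) (conjugate2 x y f g d)"
  by (simp add: conjugate2_def one.conjugate_def whisker_left_vcomp whisker_right_vcomp id2_in hcomp_in
      comp1_in one.t_in one.u_in one.v_in)

end

text \<open>
  \<open>K\<close> carries operations that \<open>F\<close> transports bijectively, cell set by cell set, to those of the
  2-category \<open>L\<close>.
\<close>

locale locally_bijective_map = L: two_category L
  for L :: "('p, 'n, 'd) two_cat" +
  fixes K :: "('o, 'm, 'c) two_cat" and F :: "('o, 'm, 'c, 'p, 'n, 'd) two_fun"
  assumes F0_in: "x \<in> ob K \<Longrightarrow> F0 F x \<in> ob L"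
    and F1_bij: "\<lbrakk>x \<in> ob K; y \<in> ob K\<rbrakk>
      \<Longrightarrow> bij_betw (F1 F x y) (cell1 K x y) (cell1 L (F0 F x) (F0 F y))"
    and F2_bij: "\<lbrakk>x \<in> ob K; y \<in> ob K; f \<in> cell1 K x y; g \<in> cell1 K x y\<rbrakk>
      \<Longrightarrow> bij_betw (F2 F x y f g) (cell2 K x y f g)
            (cell2 L (F0 F x) (F0 F y) (F1 F x y f) (F1 F x y g))"
    and id1: "x \<in> ob K
      \<Longrightarrow> id1 K x \<in> cell1 K x x \<and> F1 F x x (id1 K x) = id1 L (F0 F x)"
    and comp1: "\<lbrakk>x \<in> ob K; y \<in> ob K; z \<in> ob K; f \<in> cell1 K x y; g \<in> cell1 K y z\<rbrakk>
      \<Longrightarrow> comp1 K x y z g f \<in> cell1 K x z \<and>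
        F1 F x z (comp1 K x y z g f) =
        comp1 L (F0 F x) (F0 F y) (F0 F z) (F1 F y z g) (F1 F x y f)"
    and id2: "\<lbrakk>x \<in> ob K; y \<in> ob K; f \<in> cell1 K x y\<rbrakk>
      \<Longrightarrow> id2 K x y f \<in> cell2 K x y f f \<and>
        F2 F x y f f (id2 K x y f) = id2 L (F0 F x) (F0 F y) (F1 F x y f)"
    and vcomp:
      "\<lbrakk>x \<in> ob K; y \<in> ob K; f \<in> cell1 K x y; g \<in> cell1 K x y; h \<in> cell1 K x y;
        d \<in> cell2 K x y f g; e \<in> cell2 K x y g h\<rbrakk>
       \<Longrightarrow> vcomp K x y f g h e d \<in> cell2 K x y f h \<and>
         F2 F x y f h (vcomp K x y f g h e d) =
         vcomp L (F0 F x) (F0 F y) (F1 F x y f) (F1 F x y g) (F1 F x y h)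
           (F2 F x y g h e) (F2 F x y f g d)"
    and hcomp:
      "\<lbrakk>x \<in> ob K; y \<in> ob K; z \<in> ob K; f \<in> cell1 K x y; g \<in> cell1 K x y;
        h \<in> cell1 K y z; k \<in> cell1 K y z; d \<in> cell2 K x y f g; e \<in> cell2 K y z h k\<rbrakk>
       \<Longrightarrow> hcomp K x y z f g h k e d \<in> cell2 K x z (comp1 K x y z h f) (comp1 K x y z k g) \<and>
         F2 F x z (comp1 K x y z h f) (comp1 K x y z k g) (hcomp K x y z f g h k e d) =
         hcomp L (F0 F x) (F0 F y) (F0 F z) (F1 F x y f) (F1 F x y g) (F1 F y z h) (F1 F y z k)
           (F2 F y z h k e) (F2 F x y f g d)"
begin

lemma F1_in: "\<lbrakk>x \<in> ob K; y \<in> ob K; f \<in> cell1 K x y\<rbrakk> \<Longrightarrow> F1 F x y f \<in> cell1 L (F0 F x) (F0 F y)"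
  using F1_bij bij_betwE by blast

lemma F2_in:
  "\<lbrakk>x \<in> ob K; y \<in> ob K; f \<in> cell1 K x y; g \<in> cell1 K x y; d \<in> cell2 K x y f g\<rbrakk>
   \<Longrightarrow> F2 F x y f g d \<in> cell2 L (F0 F x) (F0 F y) (F1 F x y f) (F1 F x y g)"
  using F2_bij bij_betwE by blast

lemmas F_simps = F0_in F1_in F2_in id1 comp1 id2 vcomp hcomp

sublocale two_functor K L F
  by unfold_locales (simp_all add: F_simps)

lemma cell1_eqI:
  "\<lbrakk>F1 F x y f = F1 F x y g; x \<in> ob K; y \<in> ob K; f \<in> cell1 K x y; g \<in> cell1 K x y\<rbrakk> \<Longrightarrow> f = g"
  using F1_bij[of x y] by (auto simp: bij_betw_def dest: inj_onD)

lemma cell2_eqI: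
  "\<lbrakk>F2 F x y f g d = F2 F x y f g e; x \<in> ob K; y \<in> ob K; f \<in> cell1 K x y; g \<in> cell1 K x y;
    d \<in> cell2 K x y f g; e \<in> cell2 K x y f g\<rbrakk> \<Longrightarrow> d = e"
  using F2_bij[of x y f g] by (auto simp: bij_betw_def dest: inj_onD)

text \<open>Each law holds in \<open>K\<close> because \<open>F\<close> is injective and sends it to the same law of \<open>L\<close>.\<close>

lemma comp1_id1:
  assumes "x \<in> ob K" "y \<in> ob K" "f \<in> cell1 K x y"
  shows "comp1 K x x y f (id1 K x) = f" "comp1 K x y y (id1 K y) f = f"
  by (rule cell1_eqI[of x y]; use assms in \<open>simp add: F_simps L.comp1_id_right L.comp1_id_left\<close>)+

lemma comp1_assoc:
  assumes "x \<in> ob K" "y \<in> ob K" "z \<in> ob K" "w \<in> ob K"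
    "f \<in> cell1 K x y" "g \<in> cell1 K y z" "h \<in> cell1 K z w"
  shows "comp1 K x z w h (comp1 K x y z g f) = comp1 K x y w (comp1 K y z w h g) f"
  by (rule cell1_eqI[of x w]) (use assms in \<open>simp_all add: F_simps L.comp1_assoc\<close>)

lemma two_category_domain: "two_category K"
proof
  fix x y f g d
  assume [simp]: "x \<in> ob K" "y \<in> ob K" "f \<in> cell1 K x y" "g \<in> cell1 K x y" "d \<in> cell2 K x y f g"
  show "vcomp K x y f f g d (id2 K x y f) = d" "vcomp K x y f g g (id2 K x y g) d = d"
    by (rule cell2_eqI[of x y f g]; simp add: F_simps L.vcomp_id_right L.vcomp_id_left)+
  show "hcomp K x x y (id1 K x) (id1 K x) f g d (id2 K x x (id1 K x)) = d"
    using hcomp[of x x y "id1 K x" "id1 K x" f g "id2 K x x (id1 K x)" d]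
    by (intro cell2_eqI[of x y f g]) (simp_all add: comp1_id1 F_simps L.hcomp_id_right)
  show "hcomp K x y y f g (id1 K y) (id1 K y) (id2 K y y (id1 K y)) d = d"
    using hcomp[of x y y f g "id1 K y" "id1 K y" d "id2 K y y (id1 K y)"]
    by (intro cell2_eqI[of x y f g]) (simp_all add: comp1_id1 F_simps L.hcomp_id_left)
next
  fix x y f g h k c d e
  assume "x \<in> ob K" "y \<in> ob K"
    "f \<in> cell1 K x y" "g \<in> cell1 K x y" "h \<in> cell1 K x y" "k \<in> cell1 K x y"
    "c \<in> cell2 K x y f g" "d \<in> cell2 K x y g h" "e \<in> cell2 K x y h k"
  then show "vcomp K x y f h k e (vcomp K x y f g h d c) =
      vcomp K x y f g k (vcomp K x y g h k e d) c"
    by (intro cell2_eqI[of x y f k]) (simp_all add: F_simps L.vcomp_assoc)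
next
  fix x y z w f f' g g' h h' c d e
  assume [simp]: "x \<in> ob K" "y \<in> ob K" "z \<in> ob K" "w \<in> ob K"
    "f \<in> cell1 K x y" "f' \<in> cell1 K x y" "g \<in> cell1 K y z" "g' \<in> cell1 K y z"
    "h \<in> cell1 K z w" "h' \<in> cell1 K z w"
    "c \<in> cell2 K x y f f'" "d \<in> cell2 K y z g g'" "e \<in> cell2 K z w h h'"
  show "hcomp K x z w (comp1 K x y z g f) (comp1 K x y z g' f') h h' e
         (hcomp K x y z f f' g g' d c) =
       hcomp K x y w f f' (comp1 K y z w h g) (comp1 K y z w h' g')
         (hcomp K y z w g g' h h' e d) c"
    using hcomp[of x z w "comp1 K x y z g f" "comp1 K x y z g' f'" h h' "hcomp K x y z f f' g g' d c" e]
      hcomp[of x y w f f' "comp1 K y z w h g" "comp1 K y z w h' g'" c "hcomp K y z w g g' h h' e d"]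
    by (intro cell2_eqI[of x w "comp1 K x y w (comp1 K y z w h g) f"
          "comp1 K x y w (comp1 K y z w h' g') f'"])
      (simp_all add: comp1_assoc F_simps L.hcomp_assoc)
next
  fix x y z f g
  assume "x \<in> ob K" "y \<in> ob K" "z \<in> ob K" "f \<in> cell1 K x y" "g \<in> cell1 K y z"
  then show "hcomp K x y z f f g g (id2 K y z g) (id2 K x y f) = id2 K x z (comp1 K x y z g f)"
    by (intro cell2_eqI[of x z "comp1 K x y z g f" "comp1 K x y z g f"])
      (simp_all add: F_simps L.hcomp_id2)
next
  fix x y z f f' f'' g g' g'' c c' d d'
  assume "x \<in> ob K" "y \<in> ob K" "z \<in> ob K"
    "f \<in> cell1 K x y" "f' \<in> cell1 K x y" "f'' \<in> cell1 K x y"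
    "g \<in> cell1 K y z" "g' \<in> cell1 K y z" "g'' \<in> cell1 K y z"
    "c \<in> cell2 K x y f f'" "c' \<in> cell2 K x y f' f''"
    "d \<in> cell2 K y z g g'" "d' \<in> cell2 K y z g' g''"
  then show "hcomp K x y z f f'' g g'' (vcomp K y z g g' g'' d' d) (vcomp K x y f f' f'' c' c) =
      vcomp K x z (comp1 K x y z g f) (comp1 K x y z g' f') (comp1 K x y z g'' f'')
        (hcomp K x y z f' f'' g' g'' d' c') (hcomp K x y z f f' g g' d c)"
    by (intro cell2_eqI[of x z "comp1 K x y z g f" "comp1 K x y z g'' f''"])
      (simp_all add: F_simps L.interchange)
qed (simp_all add: F_simps comp1_id1 comp1_assoc)

end

text \<open>
  The inverse 2-functor of a locally bijective \<open>F\<close> sends \<open>X\<close> to an object \<open>rep X\<close> with an isomorphism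
  \<open>u X : X \<rightarrow> F (rep X)\<close>, and a cell to the preimage under \<open>F\<close> of its conjugate by these isomorphisms.
\<close>

locale represented_objects = locally_bijective_map L K F +
  conj: two_conjugation L "\<lambda>X. F0 F (rep X)" u v
  for L :: "('p, 'n, 'd) two_cat" and K :: "('o, 'm, 'c) two_cat"
    and F :: "('o, 'm, 'c, 'p, 'n, 'd) two_fun" and rep :: "'p \<Rightarrow> 'o" and u v :: "'p \<Rightarrow> 'n" +
  assumes rep_in: "X \<in> ob L \<Longrightarrow> rep X \<in> ob K"
begin

sublocale K: two_category K by (rule two_category_domain)

definition preimage1 :: "'o \<Rightarrow> 'o \<Rightarrow> 'n \<Rightarrow> 'm" where
  "preimage1 x y = inv_into (cell1 K x y) (F1 F x y)"

definition preimage2 :: "'o \<Rightarrow> 'o \<Rightarrow> 'm \<Rightarrow> 'm \<Rightarrow> 'd \<Rightarrow> 'c" where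
  "preimage2 x y f g = inv_into (cell2 K x y f g) (F2 F x y f g)"

lemma preimage1:
  assumes "x \<in> ob K" "y \<in> ob K" "h \<in> cell1 L (F0 F x) (F0 F y)"
  shows "preimage1 x y h \<in> cell1 K x y" "F1 F x y (preimage1 x y h) = h"
proof -
  have "h \<in> F1 F x y ` cell1 K x y" using F1_bij[of x y] assms by (simp add: bij_betw_def)
  then show "preimage1 x y h \<in> cell1 K x y" "F1 F x y (preimage1 x y h) = h"
    unfolding preimage1_def by (rule inv_into_into, rule f_inv_into_f)
qed

lemma preimage2:
  assumes "x \<in> ob K" "y \<in> ob K" "f \<in> cell1 K x y" "g \<in> cell1 K x y"
    and "e \<in> cell2 L (F0 F x) (F0 F y) (F1 F x y f) (F1 F x y g)"
  shows "preimage2 x y f g e \<in> cell2 K x y f g" "F2 F x y f g (preimage2 x y f g e) = e"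
proof -
  have "e \<in> F2 F x y f g ` cell2 K x y f g"
    using F2_bij[of x y f g] assms by (simp add: bij_betw_def)
  then show "preimage2 x y f g e \<in> cell2 K x y f g" "F2 F x y f g (preimage2 x y f g e) = e"
    unfolding preimage2_def by (rule inv_into_into, rule f_inv_into_f)
qed

definition R1 :: "'p \<Rightarrow> 'p \<Rightarrow> 'n \<Rightarrow> 'm" where
  "R1 X Y f = preimage1 (rep X) (rep Y) (conj.one.conjugate X Y f)"

definition R2 :: "'p \<Rightarrow> 'p \<Rightarrow> 'n \<Rightarrow> 'n \<Rightarrow> 'd \<Rightarrow> 'c" where
  "R2 X Y f g d = preimage2 (rep X) (rep Y) (R1 X Y f) (R1 X Y g) (conj.conjugate2 X Y f g d)"

definition inverse_functor :: "('p, 'n, 'd, 'o, 'm, 'c) two_fun" where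
  "inverse_functor = \<lparr>F0 = rep, F1 = R1, F2 = R2\<rparr>"

lemma R1:
  assumes "X \<in> ob L" "Y \<in> ob L" "f \<in> cell1 L X Y"
  shows "R1 X Y f \<in> cell1 K (rep X) (rep Y)"
    and "F1 F (rep X) (rep Y) (R1 X Y f) = conj.one.conjugate X Y f"
  unfolding R1_def using assms by (simp_all add: preimage1 rep_in conj.one.conjugate_in)

lemma R2:
  assumes "X \<in> ob L" "Y \<in> ob L" "f \<in> cell1 L X Y" "g \<in> cell1 L X Y" "d \<in> cell2 L X Y f g"
  shows "R2 X Y f g d \<in> cell2 K (rep X) (rep Y) (R1 X Y f) (R1 X Y g)"
    and "F2 F (rep X) (rep Y) (R1 X Y f) (R1 X Y g) (R2 X Y f g d) = conj.conjugate2 X Y f g d"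
  unfolding R2_def using assms by (simp_all add: preimage2 rep_in R1 conj.conjugate2_in)

lemmas R_simps = rep_in R1 R2 F_simps L.id1_in L.comp1_in L.id2_in L.vcomp_in L.hcomp_in

lemma R1_id1: "X \<in> ob L \<Longrightarrow> R1 X X (id1 L X) = id1 K (rep X)"
  by (intro cell1_eqI[of "rep X" "rep X"]) (simp_all add: R_simps conj.one.conjugate_idt)

lemma R1_comp1:
  "\<lbrakk>X \<in> ob L; Y \<in> ob L; Z \<in> ob L; f \<in> cell1 L X Y; g \<in> cell1 L Y Z\<rbrakk>
   \<Longrightarrow> R1 X Z (comp1 L X Y Z g f) = comp1 K (rep X) (rep Y) (rep Z) (R1 Y Z g) (R1 X Y f)"
  by (intro cell1_eqI[of "rep X" "rep Z"]) (simp_all add: R_simps conj.one.conjugate_comp)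

lemma two_functor_inverse: "two_functor L K inverse_functor"
proof (unfold_locales; simp add: inverse_functor_def R1_id1 R1_comp1 R_simps)
  show "R2 X Y f f (id2 L X Y f) = id2 K (rep X) (rep Y) (R1 X Y f)"
    if "X \<in> ob L" "Y \<in> ob L" "f \<in> cell1 L X Y" for X Y f
    using that by (intro cell2_eqI[of "rep X" "rep Y" "R1 X Y f" "R1 X Y f"])
      (simp_all add: R_simps conj.conjugate2_id2)
  show "R2 X Y f h (vcomp L X Y f g h e d) =
      vcomp K (rep X) (rep Y) (R1 X Y f) (R1 X Y g) (R1 X Y h) (R2 X Y g h e) (R2 X Y f g d)"
    if "X \<in> ob L" "Y \<in> ob L" "f \<in> cell1 L X Y" "g \<in> cell1 L X Y" "h \<in> cell1 L X Y"
      "d \<in> cell2 L X Y f g" "e \<in> cell2 L X Y g h" for X Y f g h d e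
    using that by (intro cell2_eqI[of "rep X" "rep Y" "R1 X Y f" "R1 X Y h"])
      (simp_all add: R_simps conj.conjugate2_vcomp)
  show "R2 X Z (comp1 L X Y Z h f) (comp1 L X Y Z k g) (hcomp L X Y Z f g h k e d) =
      hcomp K (rep X) (rep Y) (rep Z) (R1 X Y f) (R1 X Y g) (R1 Y Z h) (R1 Y Z k)
        (R2 Y Z h k e) (R2 X Y f g d)"
    if "X \<in> ob L" "Y \<in> ob L" "Z \<in> ob L" "f \<in> cell1 L X Y" "g \<in> cell1 L X Y"
      "h \<in> cell1 L Y Z" "k \<in> cell1 L Y Z" "d \<in> cell2 L X Y f g" "e \<in> cell2 L Y Z h k"
    for X Y Z f g h k d e
    using that R2[of X Z "comp1 L X Y Z h f" "comp1 L X Y Z k g" "hcomp L X Y Z f g h k e d"]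
    by (intro cell2_eqI[of "rep X" "rep Z" "R1 X Z (comp1 L X Y Z h f)" "R1 X Z (comp1 L X Y Z k g)"])
      (simp_all add: R_simps R1_comp1 conj.conjugate2_hcomp)
qed

lemma unit_iso: "two_nat_iso L L id_two_fun (comp_two_fun F inverse_functor) u"
proof
  fix X assume "X \<in> ob L"
  then show "iso1 L (F0 id_two_fun X) (F0 (comp_two_fun F inverse_functor) X) (u X)"
    using conj.one.u_in[of X] conj.one.v_in[of X] conj.one.u_v[of X] conj.one.v_u[of X]
    unfolding iso1_def
    by (intro conjI bexI[of _ "v X"])
      (simp_all add: id_two_fun_def comp_two_fun_def inverse_functor_def)
qed (simp_all add: id_two_fun_def comp_two_fun_def inverse_functor_def R_simps conj.one.conjugate_u
    conj.conjugate2_u)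

definition counit :: "'o \<Rightarrow> 'm" where
  "counit x = preimage1 (rep (F0 F x)) x (v (F0 F x))"

lemma counit:
  assumes "x \<in> ob K"
  shows "counit x \<in> cell1 K (rep (F0 F x)) x" "F1 F (rep (F0 F x)) x (counit x) = v (F0 F x)"
  unfolding counit_def using assms by (simp_all add: preimage1 rep_in F0_in conj.one.v_in)

lemma counit_iso1:
  assumes [simp]: "x \<in> ob K"
  shows "iso1 K (rep (F0 F x)) x (counit x)"
proof -
  let ?r = "rep (F0 F x)"
  define w where "w = preimage1 x ?r (u (F0 F x))"
  have w: "w \<in> cell1 K x ?r" "F1 F x ?r w = u (F0 F x)"
    unfolding w_def by (simp_all add: preimage1 rep_in F0_in conj.one.u_in)
  have "comp1 K ?r x ?r w (counit x) = id1 K ?r"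
    by (rule cell1_eqI[of ?r ?r]) (simp_all add: R_simps w counit conj.one.u_v)
  moreover have "comp1 K x ?r x (counit x) w = id1 K x"
    by (rule cell1_eqI[of x x]) (simp_all add: R_simps w counit conj.one.v_u)
  ultimately show ?thesis using w counit by (auto simp: iso1_def)
qed

lemma counit_iso: "two_nat_iso K K (comp_two_fun inverse_functor F) id_two_fun counit"
proof (unfold_locales; simp add: id_two_fun_def comp_two_fun_def inverse_functor_def counit_iso1)
  fix x y assume xy [simp]: "x \<in> ob K" "y \<in> ob K"
  let ?r = "rep (F0 F x)" let ?q = "rep (F0 F y)"
  let ?R1 = "\<lambda>f. R1 (F0 F x) (F0 F y) (F1 F x y f)"
  have natural1: "comp1 K ?r x y f (counit x) = comp1 K ?r ?q y (counit y) (?R1 f)"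
    if "f \<in> cell1 K x y" for f
    using that by (intro cell1_eqI[of ?r y]) (simp_all add: R_simps counit conj.one.v_conjugate)
  then show "f \<in> cell1 K x y \<Longrightarrow>
      comp1 K ?r x y f (counit x) = comp1 K ?r ?q y (counit y) (?R1 f)" for f .
  fix f g d assume fgd [simp]: "f \<in> cell1 K x y" "g \<in> cell1 K x y" "d \<in> cell2 K x y f g"
  show "hcomp K ?r x y (counit x) (counit x) f g d (id2 K ?r x (counit x)) =
      hcomp K ?r ?q y (?R1 f) (?R1 g) (counit y) (counit y) (id2 K ?q y (counit y))
        (R2 (F0 F x) (F0 F y) (F1 F x y f) (F1 F x y g) (F2 F x y f g d))"
    using hcomp[of ?r ?q y "?R1 f" "?R1 g" "counit y" "counit y"
        "R2 (F0 F x) (F0 F y) (F1 F x y f) (F1 F x y g) (F2 F x y f g d)" "id2 K ?q y (counit y)"]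
    by (intro cell2_eqI[of ?r y "comp1 K ?r x y f (counit x)" "comp1 K ?r x y g (counit x)"])
      (simp_all add: R_simps counit conj.v_conjugate2 flip: natural1)
qed

theorem equivalent: "equivalent_two_categories L K"
  unfolding equivalent_two_categories_def
  using L.two_category_axioms K.two_category_axioms two_functor_inverse two_functor_axioms
    unit_iso counit_iso by blast

end

theorem (in locally_bijective_map) equivalence_if_essentially_surjective:
  assumes ess_surj: "\<And>X. X \<in> ob L \<Longrightarrow> \<exists>x\<in>ob K. \<exists>u. iso1 L X (F0 F x) u"
  shows "equivalent_two_categories L K"
proof -
  have "\<forall>X\<in>ob L. \<exists>x u v. x \<in> ob K \<and> u \<in> cell1 L X (F0 F x) \<and> v \<in> cell1 L (F0 F x) X \<and>
      comp1 L X (F0 F x) X v u = id1 L X \<and> comp1 L (F0 F x) X (F0 F x) u v = id1 L (F0 F x)"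
    using ess_surj unfolding iso1_def by blast
  then obtain rep u v where "\<forall>X\<in>ob L. rep X \<in> ob K \<and> u X \<in> cell1 L X (F0 F (rep X)) \<and>
      v X \<in> cell1 L (F0 F (rep X)) X \<and> comp1 L X (F0 F (rep X)) X (v X) (u X) = id1 L X \<and>
      comp1 L (F0 F (rep X)) X (F0 F (rep X)) (u X) (v X) = id1 L (F0 F (rep X))"
    by metis
  then interpret represented_objects L K F rep u v
    by unfold_locales (simp_all add: F0_in)
  show ?thesis by (rule equivalent)
qed

section \<open>The equivalence of crossed modules and internal categories\<close>

definition kernel_functor ::
    "(('a, 'u, 'b) icat, ('a \<Rightarrow> 'a) \<times> ('a \<Rightarrow> 'a), 'a \<Rightarrow> 'a,
      ('a, 'u, 'b) xmod, ('a \<Rightarrow> 'a) \<times> ('a \<Rightarrow> 'a), 'a \<Rightarrow> 'a) two_fun" where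
  "kernel_functor = \<lparr>
     F0 = kernel_xmod,
     F1 = (\<lambda>G H (f1, f0). (restrict f1 (source_kernel G), f0)),
     F2 = (\<lambda>G H (f1, f0) g \<eta>. \<lambda>x\<in>carrier (ic_ob G). \<eta> x \<ominus>\<^bsub>ic_mor H\<^esub> ide H (f0 x))\<rparr>"

context icat_pair
begin

lemma bij_betw_functors:
  "bij_betw (\<lambda>(f1, f0). (restrict f1 (source_kernel G), f0))
     (internal_functor S G H) (xmod_hom S (kernel_xmod G) (kernel_xmod H))"
proof -
  have "f1 = g1" if f: "(f1, f0) \<in> internal_functor S G H" and g: "(g1, f0) \<in> internal_functor S G H"
    and eq: "restrict f1 (source_kernel G) = restrict g1 (source_kernel G)" for f1 g1 f0
  proof -
    interpret f1: alg_morphism S "ic_mor G" "ic_mor H" f1 by (rule functor_morphisms[OF f])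
    interpret g1: alg_morphism S "ic_mor G" "ic_mor H" g1 by (rule functor_morphisms[OF g])
    show ?thesis
    proof (rule extensionalityI[OF f1.extensional g1.extensional])
      fix e assume e [simp]: "e \<in> carrier (ic_mor G)"
      have in_mor [simp]: "G.kernel_component e \<in> carrier (ic_mor G)"
        by (simp add: G.source_kernelD)
      have "f1 (G.kernel_component e) = g1 (G.kernel_component e)"
        using fun_cong[OF eq, of "G.kernel_component e"] by simp
      then have "f1 (G.kernel_component e \<oplus>\<^bsub>ic_mor G\<^esub> ide G (src G e)) =
          g1 (G.kernel_component e \<oplus>\<^bsub>ic_mor G\<^esub> ide G (src G e))"
        by (simp add: functor_laws[OF f] functor_laws[OF g])
      then show "f1 e = g1 e" by (simp add: G.kernel_component_decompose)
    qed
  qed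
  moreover have "(k, f0) \<in> (\<lambda>(f1, f0). (restrict f1 (source_kernel G), f0)) ` internal_functor S G H"
    if "(k, f0) \<in> xmod_hom S (kernel_xmod G) (kernel_xmod H)" for k f0
    using extend_to_functor[OF that] by (auto intro: rev_image_eqI)
  ultimately show ?thesis
    unfolding bij_betw_def using restrict_functor_to_kernel by (auto simp: inj_on_def) 
qed

lemma bij_betw_homotopies:
  assumes f: "(f1, f0) \<in> internal_functor S G H" and g: "(g1, g0) \<in> internal_functor S G H"
  shows "bij_betw (\<lambda>\<eta>. \<lambda>x\<in>carrier (ic_ob G). \<eta> x \<ominus>\<^bsub>ic_mor H\<^esub> ide H (f0 x))
     (internal_homotopy S G H (f1, f0) (g1, g0))
     (xmod_homotopy S (kernel_xmod G) (kernel_xmod H)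
        (restrict f1 (source_kernel G), f0) (restrict g1 (source_kernel G), g0))"
    (is "bij_betw ?F ?A ?B")
proof -
  interpret f0: alg_morphism S "ic_ob G" "ic_ob H" f0 by (rule functor_morphisms[OF f])
  have homotopyD: "\<eta> \<in> carrier (ic_ob G) \<rightarrow>\<^sub>E carrier (ic_mor H)"
    "x \<in> carrier (ic_ob G) \<Longrightarrow> src H (\<eta> x) = f0 x" if "\<eta> \<in> ?A" for \<eta> x
    using that by (auto simp: internal_homotopy_def alg_hom_def)
  have "?F \<eta> \<in> ?B" if "\<eta> \<in> ?A" for \<eta>
    using internal_homotopy_iff_xmod_homotopy[OF f g homotopyD[OF that]] that by blast
  moreover have "\<eta> = \<theta>" if \<eta>: "\<eta> \<in> ?A" and \<theta>: "\<theta> \<in> ?A" and eq: "?F \<eta> = ?F \<theta>" for \<eta> \<theta>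
  proof (rule PiE_ext[OF homotopyD(1)[OF \<eta>] homotopyD(1)[OF \<theta>]])
    fix x assume x: "x \<in> carrier (ic_ob G)"
    have "\<eta> x \<in> carrier (ic_mor H)" "\<theta> x \<in> carrier (ic_mor H)"
      using homotopyD(1)[OF \<eta>] homotopyD(1)[OF \<theta>] x by auto
    then show "\<eta> x = \<theta> x"
      using fun_cong[OF eq, of x] x
        H.M.add_right_cancel[of "neg (ic_mor H) (ide H (f0 x))" "\<eta> x" "\<theta> x"]
      by (simp add: diff_def)
  qed
  moreover have "d \<in> ?F ` ?A" if d: "d \<in> ?B" for d
  proof -
    define \<eta> where "\<eta> = (\<lambda>x\<in>carrier (ic_ob G). d x \<oplus>\<^bsub>ic_mor H\<^esub> ide H (f0 x))"
    have d_in [simp]: "d x \<in> source_kernel H" if "x \<in> carrier (ic_ob G)" for x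
      using G.xmod_homotopyD(2)[OF d] that by simp
    then have [simp]: "d x \<in> carrier (ic_mor H)" if "x \<in> carrier (ic_ob G)" for x
      using that by (intro H.source_kernelD d_in)
    have "\<eta> \<in> carrier (ic_ob G) \<rightarrow>\<^sub>E carrier (ic_mor H)" by (simp add: \<eta>_def)
    moreover have "src H (\<eta> x) = f0 x" if "x \<in> carrier (ic_ob G)" for x
      using that by (simp add: \<eta>_def H.source_kernelD)
    moreover have "?F \<eta> = d"
      using G.xmod_homotopyD(1)[OF d]
      by (intro extensionalityI[of _ "carrier (ic_ob G)"]) (simp_all add: \<eta>_def diff_def)
    ultimately show ?thesis
      using internal_homotopy_iff_xmod_homotopy[OF f g, of \<eta>] d by (auto intro: rev_image_eqI)
  qed
  ultimately show ?thesis
    unfolding bij_betw_def by (auto simp: inj_on_def)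
qed

lemma internal_homotopyD:
  assumes "\<eta> \<in> internal_homotopy S G H (f1, f0) (g1, g0)" "x \<in> carrier (ic_ob G)"
  shows "\<eta> x \<in> carrier (ic_mor H)" "src H (\<eta> x) = f0 x" "tgt H (\<eta> x) = g0 x"
  using assms by (auto simp: internal_homotopy_def alg_hom_def)

text \<open>
  For the vertical and horizontal composites this gives their naturality and their compatibility with
  the 2-functor at once, by computing \<open>\<eta> - 1\<close> and recognising a composite of homotopies.
\<close>

lemma homotopy_if_kernel_homotopy:
  assumes f: "(f1, f0) \<in> internal_functor S G H" and g: "(g1, g0) \<in> internal_functor S G H"
    and \<eta>: "\<And>x. x \<in> carrier (ic_ob G) \<Longrightarrow> \<eta> x \<in> carrier (ic_mor H) \<and> src H (\<eta> x) = f0 x \<and>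
      \<eta> x \<ominus>\<^bsub>ic_mor H\<^esub> ide H (f0 x) = d x"
    and d: "(\<lambda>x\<in>carrier (ic_ob G). d x) \<in> xmod_homotopy S (kernel_xmod G) (kernel_xmod H)
      (restrict f1 (source_kernel G), f0) (restrict g1 (source_kernel G), g0)"
  shows "(\<lambda>x\<in>carrier (ic_ob G). \<eta> x) \<in> internal_homotopy S G H (f1, f0) (g1, g0)"
    and "(\<lambda>x\<in>carrier (ic_ob G). (\<lambda>x\<in>carrier (ic_ob G). \<eta> x) x \<ominus>\<^bsub>ic_mor H\<^esub> ide H (f0 x)) =
      (\<lambda>x\<in>carrier (ic_ob G). d x)"
proof -
  show *: "(\<lambda>x\<in>carrier (ic_ob G). (\<lambda>x\<in>carrier (ic_ob G). \<eta> x) x \<ominus>\<^bsub>ic_mor H\<^esub> ide H (f0 x)) =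
      (\<lambda>x\<in>carrier (ic_ob G). d x)"
    using \<eta> by (simp cong: restrict_cong)
  show "(\<lambda>x\<in>carrier (ic_ob G). \<eta> x) \<in> internal_homotopy S G H (f1, f0) (g1, g0)"
    by (subst internal_homotopy_iff_xmod_homotopy[OF f g]) (use \<eta> d * in simp_all)
qed

lemma kernel_xmod_map:
  "(f1, f0) \<in> internal_functor S G H
   \<Longrightarrow> xmod_map S (kernel_xmod G) (kernel_xmod H) (restrict f1 (source_kernel G)) f0"
  by unfold_locales
    (simp_all add: G.crossed_module_kernel H.crossed_module_kernel restrict_functor_to_kernel)

lemma kernel_homotopy:
  assumes "(f1, f0) \<in> internal_functor S G H" "(g1, g0) \<in> internal_functor S G H"
    and "\<eta> \<in> internal_homotopy S G H (f1, f0) (g1, g0)"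
  shows "(\<lambda>x\<in>carrier (ic_ob G). \<eta> x \<ominus>\<^bsub>ic_mor H\<^esub> ide H (f0 x))
    \<in> xmod_homotopy S (kernel_xmod G) (kernel_xmod H)
        (restrict f1 (source_kernel G), f0) (restrict g1 (source_kernel G), g0)"
  using bij_betw_homotopies[OF assms(1,2)] assms(3) by (rule bij_betw_apply)

lemma kernel_id2:
  assumes f: "(f1, f0) \<in> internal_functor S G H"
  shows "(\<lambda>x\<in>carrier (ic_ob G). ide H (f0 x)) \<in> internal_homotopy S G H (f1, f0) (f1, f0) \<and>
    (\<lambda>x\<in>carrier (ic_ob G). (\<lambda>x\<in>carrier (ic_ob G). ide H (f0 x)) x \<ominus>\<^bsub>ic_mor H\<^esub> ide H (f0 x)) =
    (\<lambda>x\<in>carrier (ic_ob G). \<zero>\<^bsub>ic_mor H\<^esub>)"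
proof -
  interpret f0: alg_morphism S "ic_ob G" "ic_ob H" f0 by (rule functor_morphisms[OF f])
  show ?thesis
    using G.zero_xmod_homotopy[OF kernel_xmod_map[OF f]]
    by (intro conjI homotopy_if_kernel_homotopy[OF f f]) (simp_all add: diff_def)
qed

lemma kernel_vcomp:
  assumes f: "(f1, f0) \<in> internal_functor S G H" and g: "(g1, g0) \<in> internal_functor S G H"
    and h: "(h1, h0) \<in> internal_functor S G H"
    and d: "d \<in> internal_homotopy S G H (f1, f0) (g1, g0)"
    and e: "e \<in> internal_homotopy S G H (g1, g0) (h1, h0)"
  shows "(\<lambda>x\<in>carrier (ic_ob G). cmp H (e x, d x)) \<in> internal_homotopy S G H (f1, f0) (h1, h0) \<and>
    (\<lambda>x\<in>carrier (ic_ob G).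
       (\<lambda>x\<in>carrier (ic_ob G). cmp H (e x, d x)) x \<ominus>\<^bsub>ic_mor H\<^esub> ide H (f0 x)) =
    (\<lambda>x\<in>carrier (ic_ob G).
       (\<lambda>x\<in>carrier (ic_ob G). e x \<ominus>\<^bsub>ic_mor H\<^esub> ide H (g0 x)) x \<oplus>\<^bsub>ic_mor H\<^esub>
       (\<lambda>x\<in>carrier (ic_ob G). d x \<ominus>\<^bsub>ic_mor H\<^esub> ide H (f0 x)) x)"
proof -
  interpret f0: alg_morphism S "ic_ob G" "ic_ob H" f0 by (rule functor_morphisms[OF f])
  interpret g0: alg_morphism S "ic_ob G" "ic_ob H" g0 by (rule functor_morphisms[OF g])
  note [simp] = internal_homotopyD[OF d] internal_homotopyD[OF e]
  show ?thesis
    using G.vcomp_xmod_homotopy[OF f[THEN kernel_xmod_map] g[THEN kernel_xmod_map]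
        h[THEN kernel_xmod_map] kernel_homotopy[OF f g d] kernel_homotopy[OF g h e]]
    by (intro conjI homotopy_if_kernel_homotopy[OF f h])
      (simp_all add: H.cmp_eq_composite H.composite_def diff_def del: restrict_apply
        add: restrict_apply')
qed

end

context groups_with_operations
begin

lemma identity_internal_functor:
  assumes "internal_category S G"
  shows "(\<lambda>a\<in>carrier (ic_mor G). a, \<lambda>x\<in>carrier (ic_ob G). x) \<in> internal_functor S G G"
proof -
  interpret icat_pair S G G by unfold_locales (rule assms)+
  show ?thesis
    by (rule internal_functorI) (simp_all add: identity_alg_hom G.M.is_alg G.N.is_alg)
qed

lemma compose_internal_functor:
  assumes "internal_category S G" "internal_category S H" "internal_category S I"
    and f: "(f1, f0) \<in> internal_functor S G H" and g: "(g1, g0) \<in> internal_functor S H I"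
  shows "(compose (carrier (ic_mor G)) g1 f1, compose (carrier (ic_ob G)) g0 f0)
    \<in> internal_functor S G I"
proof -
  interpret GH: icat_pair S G H by unfold_locales fact+
  interpret HI: icat_pair S H I by unfold_locales fact+
  interpret GI: icat_pair S G I by unfold_locales
  interpret f1: alg_morphism S "ic_mor G" "ic_mor H" f1 by (rule GH.functor_morphisms[OF f])
  interpret f0: alg_morphism S "ic_ob G" "ic_ob H" f0 by (rule GH.functor_morphisms[OF f])
  interpret g1: alg_morphism S "ic_mor H" "ic_mor I" g1 by (rule HI.functor_morphisms[OF g])
  interpret g0: alg_morphism S "ic_ob H" "ic_ob I" g0 by (rule HI.functor_morphisms[OF g])
  show ?thesis
    by (rule GI.internal_functorI)
      (simp_all add: compose_alg_hom[OF _ f1.hom g1.hom] compose_alg_hom[OF _ f0.hom g0.hom]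
        GH.G.M.is_alg GH.G.N.is_alg compose_eq GH.functor_laws[OF f] HI.functor_laws[OF g])
qed

lemma kernel_hcomp:
  assumes GHI: "internal_category S G" "internal_category S H" "internal_category S I"
    and f: "(f1, f0) \<in> internal_functor S G H" and g: "(g1, g0) \<in> internal_functor S G H"
    and h: "(h1, h0) \<in> internal_functor S H I" and k: "(k1, k0) \<in> internal_functor S H I"
    and d: "d \<in> internal_homotopy S G H (f1, f0) (g1, g0)"
    and e: "e \<in> internal_homotopy S H I (h1, h0) (k1, k0)"
  shows "(\<lambda>x\<in>carrier (ic_ob G). cmp I (e (g0 x), h1 (d x))) \<in> internal_homotopy S G I
      (compose (carrier (ic_mor G)) h1 f1, compose (carrier (ic_ob G)) h0 f0)
      (compose (carrier (ic_mor G)) k1 g1, compose (carrier (ic_ob G)) k0 g0) \<and>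
    (\<lambda>x\<in>carrier (ic_ob G). (\<lambda>x\<in>carrier (ic_ob G). cmp I (e (g0 x), h1 (d x))) x
       \<ominus>\<^bsub>ic_mor I\<^esub> ide I (compose (carrier (ic_ob G)) h0 f0 x)) =
    (\<lambda>x\<in>carrier (ic_ob G).
       (\<lambda>x\<in>carrier (ic_ob H). e x \<ominus>\<^bsub>ic_mor I\<^esub> ide I (h0 x)) (g0 x) \<oplus>\<^bsub>ic_mor I\<^esub>
       restrict h1 (source_kernel H)
         ((\<lambda>x\<in>carrier (ic_ob G). d x \<ominus>\<^bsub>ic_mor H\<^esub> ide H (f0 x)) x))"
proof -
  interpret GH: icat_pair S G H by unfold_locales fact+
  interpret HI: icat_pair S H I by unfold_locales fact+
  interpret GI: icat_pair S G I by unfold_locales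
  interpret f0: alg_morphism S "ic_ob G" "ic_ob H" f0 by (rule GH.functor_morphisms[OF f])
  interpret g0: alg_morphism S "ic_ob G" "ic_ob H" g0 by (rule GH.functor_morphisms[OF g])
  interpret h1: alg_morphism S "ic_mor H" "ic_mor I" h1 by (rule HI.functor_morphisms[OF h])
  interpret h0: alg_morphism S "ic_ob H" "ic_ob I" h0 by (rule HI.functor_morphisms[OF h])
  note [simp] = GH.internal_homotopyD[OF d] HI.internal_homotopyD[OF e]
    HI.functor_laws(1-3)[OF h]
  have kernel: "compose (source_kernel G) (restrict p1 (source_kernel H)) (restrict q1 (source_kernel G)) =
      restrict (compose (carrier (ic_mor G)) p1 q1) (source_kernel G)"
    if "(q1, q0) \<in> internal_functor S G H" for p1 q1 q0
    using GH.functor_laws(4)[OF that] by (auto simp: compose_def GH.G.source_kernelD)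
  have d_in [simp]: "d x \<ominus>\<^bsub>ic_mor H\<^esub> ide H (f0 x) \<in> source_kernel H" if "x \<in> carrier (ic_ob G)" for x
    using that by (simp add: source_kernel_def diff_def)
  have "(\<lambda>x\<in>carrier (ic_ob G).
       (\<lambda>x\<in>carrier (ic_ob H). e x \<ominus>\<^bsub>ic_mor I\<^esub> ide I (h0 x)) (g0 x) \<oplus>\<^bsub>ic_mor I\<^esub>
       restrict h1 (source_kernel H)
         ((\<lambda>x\<in>carrier (ic_ob G). d x \<ominus>\<^bsub>ic_mor H\<^esub> ide H (f0 x)) x))
    \<in> xmod_homotopy S (kernel_xmod G) (kernel_xmod I)
        (restrict (compose (carrier (ic_mor G)) h1 f1) (source_kernel G),
         compose (carrier (ic_ob G)) h0 f0)
        (restrict (compose (carrier (ic_mor G)) k1 g1) (source_kernel G),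
         compose (carrier (ic_ob G)) k0 g0)"
    using hcomp_xmod_homotopy[OF GH.kernel_xmod_map[OF f] GH.kernel_xmod_map[OF g]
        HI.kernel_xmod_map[OF h] HI.kernel_xmod_map[OF k]
        GH.kernel_homotopy[OF f g d] HI.kernel_homotopy[OF h k e]]
    by (simp add: kernel[OF f] kernel[OF g] del: restrict_apply)
  then show ?thesis
    by (intro conjI GI.homotopy_if_kernel_homotopy[OF compose_internal_functor[OF GHI f h]
          compose_internal_functor[OF GHI g k]])
      (auto simp: compose_eq HI.H.cmp_eq_composite HI.H.composite_def h1.map_diff,
       auto simp: diff_def)
qed

theorem locally_bijective_kernel_functor:
  "locally_bijective_map (XMod S) (ICat S :: (('a, 'u, 'b) icat, _, _) two_cat) kernel_functor"
proof -
  interpret XMod: two_category "XMod S :: (('a, 'u, 'b) xmod, _, _) two_cat"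
    by (rule two_category_XMod)
  have pair: "icat_pair S G H" if "internal_category S G" "internal_category S H"
    for G H :: "('a, 'u, 'b) icat"
    by unfold_locales (rule that)+
  show ?thesis
  proof (unfold_locales; clarsimp simp: ICat_def XMod_def kernel_functor_def simp del: restrict_apply)
    fix G :: "('a, 'u, 'b) icat" assume G: "internal_category S G"
    then interpret icat_pair S G G by (intro pair)
    show "crossed_module S (kernel_xmod G)" by (rule G.crossed_module_kernel)
    show "(\<lambda>a\<in>carrier (ic_mor G). a, \<lambda>x\<in>carrier (ic_ob G). x) \<in> internal_functor S G G \<and>
        (\<lambda>a\<in>carrier (ic_mor G) \<inter> source_kernel G. a) = (\<lambda>a\<in>source_kernel G. a)"
      using identity_internal_functor[OF G] by (auto simp: G.source_kernelD)
  next
    fix G H :: "('a, 'u, 'b) icat" assume "internal_category S G" "internal_category S H"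
    then interpret icat_pair S G H by (rule pair)
    show "bij_betw (\<lambda>(f1, f0). (restrict f1 (source_kernel G), f0))
       (internal_functor S G H) (xmod_hom S (kernel_xmod G) (kernel_xmod H))"
      by (rule bij_betw_functors)
    fix f1 f0 assume f: "(f1, f0) \<in> internal_functor S G H"
    show "(\<lambda>x\<in>carrier (ic_ob G). ide H (f0 x)) \<in> internal_homotopy S G H (f1, f0) (f1, f0) \<and>
      (\<lambda>x\<in>carrier (ic_ob G). (\<lambda>x\<in>carrier (ic_ob G). ide H (f0 x)) x \<ominus>\<^bsub>ic_mor H\<^esub> ide H (f0 x)) =
      (\<lambda>x\<in>carrier (ic_ob G). \<zero>\<^bsub>ic_mor H\<^esub>)"
      by (rule kernel_id2[OF f])
    fix g1 g0 assume g: "(g1, g0) \<in> internal_functor S G H"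
    show "bij_betw (\<lambda>\<eta>. \<lambda>x\<in>carrier (ic_ob G). \<eta> x \<ominus>\<^bsub>ic_mor H\<^esub> ide H (f0 x))
     (internal_homotopy S G H (f1, f0) (g1, g0))
     (xmod_homotopy S (kernel_xmod G) (kernel_xmod H)
        (restrict f1 (source_kernel G), f0) (restrict g1 (source_kernel G), g0))"
      by (rule bij_betw_homotopies[OF f g])
    fix h1 h0 d e assume "(h1, h0) \<in> internal_functor S G H"
      "d \<in> internal_homotopy S G H (f1, f0) (g1, g0)"
      "e \<in> internal_homotopy S G H (g1, g0) (h1, h0)"
    then show "(\<lambda>x\<in>carrier (ic_ob G). cmp H (e x, d x)) \<in> internal_homotopy S G H (f1, f0) (h1, h0) \<and>
    (\<lambda>x\<in>carrier (ic_ob G).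
       (\<lambda>x\<in>carrier (ic_ob G). cmp H (e x, d x)) x \<ominus>\<^bsub>ic_mor H\<^esub> ide H (f0 x)) =
    (\<lambda>x\<in>carrier (ic_ob G).
       (\<lambda>x\<in>carrier (ic_ob G). e x \<ominus>\<^bsub>ic_mor H\<^esub> ide H (g0 x)) x \<oplus>\<^bsub>ic_mor H\<^esub>
       (\<lambda>x\<in>carrier (ic_ob G). d x \<ominus>\<^bsub>ic_mor H\<^esub> ide H (f0 x)) x)"
      by (rule kernel_vcomp[OF f g])
  next
    fix G H I :: "('a, 'u, 'b) icat" and f1 f0 g1 g0
    assume GHI: "internal_category S G" "internal_category S H" "internal_category S I"
      and f: "(f1, f0) \<in> internal_functor S G H" and g: "(g1, g0) \<in> internal_functor S H I"
    interpret icat_pair S G H using GHI(1,2) by (rule pair)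
    have "restrict (compose (carrier (ic_mor G)) g1 f1) (source_kernel G) =
        compose (source_kernel G) (restrict g1 (source_kernel H)) (restrict f1 (source_kernel G))"
      using functor_laws(4)[OF f] by (auto simp: compose_def G.source_kernelD)
    then show "(compose (carrier (ic_mor G)) g1 f1, compose (carrier (ic_ob G)) g0 f0)
        \<in> internal_functor S G I \<and>
      restrict (compose (carrier (ic_mor G)) g1 f1) (source_kernel G) =
        compose (source_kernel G) (restrict g1 (source_kernel H)) (restrict f1 (source_kernel G))"
      using compose_internal_functor[OF GHI f g] by blast
  qed (rule kernel_hcomp; assumption)
qed

text \<open>
  The internal category of a crossed module, formed on an extension that defines its actions, has the
  given crossed module as the kernel of its source map, up to the inclusion \<open>i\<close>.
\<close>

lemma iso1_kernel_xmod:
  assumes "xmod_split S X E i p s"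
  shows "\<exists>G. internal_category S G \<and>
    iso1 (XMod S) X (kernel_xmod G) (i, \<lambda>b\<in>carrier (xm_base X). b)"
proof -
  interpret xmod_split S X E i p s by fact
  let ?G = "graph.graph_category" let ?K = "source_kernel graph.graph_category"
  let ?B = "xm_base X"
  interpret C: internal_cat S ?G by (rule internal_cat_graph_category)
  have G [simp]: "ic_mor ?G = E" "ic_ob ?G = ?B" "src ?G = p" "tgt ?G = target" "ide ?G = s"
    by (simp_all add: graph.graph_category_def)
  have in_K: "e \<in> ?K \<longleftrightarrow> e \<in> carrier E \<and> p e = \<zero>\<^bsub>?B\<^esub>" for e
    by (simp add: source_kernel_def)
  have i_K [simp]: "i a \<in> ?K" if "a \<in> carrier (xm_top X)" for a
    using that by (simp add: in_K)
  have K_E [simp]: "e \<in> carrier E" if "e \<in> ?K" for e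
    using that by (simp add: in_K)
  have i_j [simp]: "i (ker_part e) = e" if "e \<in> ?K" for e
    using that by (simp add: in_K i_ker_part diff_def del: K_E)
  have j_i [simp]: "ker_part (i a) = a" if "a \<in> carrier (xm_top X)" for a
    using ker_part_pair[OF that, of "\<zero>\<^bsub>?B\<^esub>"] that by simp
  have target_K: "target e = xm_bd X (ker_part e)" if "e \<in> ?K" for e
    using target_i[of "ker_part e"] that by simp
  let ?i = "(i, \<lambda>b\<in>carrier ?B. b)" let ?j = "(restrict ker_part ?K, \<lambda>b\<in>carrier ?B. b)"
  have "i \<in> alg_hom S (xm_top X) (E\<lparr>carrier := ?K\<rparr>)"
    using i.extensional by (auto simp: alg_hom_def PiE_def)
  then have i_hom: "?i \<in> xmod_hom S X (kernel_xmod ?G)"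
    by (simp add: xmod_hom_def identity_alg_hom B.is_alg i_act i_star)
  have K_closed [simp]: "\<lbrakk>e \<in> ?K; e' \<in> ?K\<rbrakk> \<Longrightarrow> e \<oplus>\<^bsub>E\<^esub> e' \<in> ?K"
    "\<lbrakk>w \<in> un_ops S; e \<in> ?K\<rbrakk> \<Longrightarrow> un E w e \<in> ?K"
    "\<lbrakk>m \<in> bin_ops S; e \<in> ?K; e' \<in> ?K\<rbrakk> \<Longrightarrow> bin E m e e' \<in> ?K"
    "\<lbrakk>b \<in> carrier ?B; e \<in> ?K\<rbrakk> \<Longrightarrow> s b \<oplus>\<^bsub>E\<^esub> e \<ominus>\<^bsub>E\<^esub> s b \<in> ?K"
    "\<lbrakk>m \<in> bin_ops S; b \<in> carrier ?B; e \<in> ?K\<rbrakk> \<Longrightarrow> bin E m (s b) e \<in> ?K" for e e' w m b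
    by (simp_all add: in_K diff_def del: K_E)
  have j_eq_iff: "ker_part e = a \<longleftrightarrow> i a = e" if "e \<in> ?K" "a \<in> carrier (xm_top X)" for e a
    using that by auto
  have "restrict ker_part ?K \<in> alg_hom S (E\<lparr>carrier := ?K\<rparr>) (xm_top X)"
  proof (rule alg_homI)
    show "operation_algebra S (E\<lparr>carrier := ?K\<rparr>)"
      using C.kernel.A.operation_algebra_axioms by simp
  qed (simp_all add: A.operation_algebra_axioms j_eq_iff)
  moreover have "ker_part (s b \<oplus>\<^bsub>E\<^esub> e \<ominus>\<^bsub>E\<^esub> s b) = xm_act X b (ker_part e)"
    "m \<in> bin_ops S \<Longrightarrow> ker_part (bin E m (s b) e) = xm_star X m b (ker_part e)"
    if "b \<in> carrier ?B" "e \<in> ?K" for b e m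
    using that by (simp_all add: j_eq_iff i_act i_star)
  ultimately have j_hom: "?j \<in> xmod_hom S (kernel_xmod ?G) X"
    by (simp add: xmod_hom_def identity_alg_hom B.is_alg target_K)
  have "compose (carrier (xm_top X)) (restrict ker_part ?K) i = (\<lambda>a\<in>carrier (xm_top X). a)"
    by (auto simp: compose_def)
  moreover have "compose ?K i (restrict ker_part ?K) = (\<lambda>e\<in>?K. e)"
    by (auto simp: compose_def)
  moreover have "compose (carrier ?B) (\<lambda>b\<in>carrier ?B. b) (\<lambda>b\<in>carrier ?B. b) = (\<lambda>b\<in>carrier ?B. b)"
    by (auto simp: compose_def)
  ultimately have "iso1 (XMod S) X (kernel_xmod ?G) ?i"
    unfolding iso1_def using i_hom j_hom
    by (intro conjI bexI[of _ ?j]) (simp_all add: XMod_def)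
  then show ?thesis using C.internal_category by blast
qed

theorem kernel_functor_essentially_surjective:
  assumes "crossed_module S X"
  shows "\<exists>G. internal_category S G \<and> (\<exists>u. iso1 (XMod S) X (kernel_xmod G) u)"
  using assms by (meson crossed_module_split iso1_kernel_xmod)

end

theorem theorem3p3:
  fixes S :: "('u, 'b) theory_sig"
  assumes "groups_with_operations S"
    and "infinite (UNIV :: 'a set)"
  shows "equivalent_two_categories
           (XMod S :: (('a, 'u, 'b) xmod, ('a \<Rightarrow> 'a) \<times> ('a \<Rightarrow> 'a), 'a \<Rightarrow> 'a) two_cat)
           (ICat S :: (('a, 'u, 'b) icat, ('a \<Rightarrow> 'a) \<times> ('a \<Rightarrow> 'a), 'a \<Rightarrow> 'a) two_cat)"
proof -
  interpret groups_with_operations S by fact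
  interpret locally_bijective_map "XMod S" "ICat S :: (('a, 'u, 'b) icat, _, _) two_cat"
    kernel_functor by (rule locally_bijective_kernel_functor)
  show ?thesis
  proof (rule equivalence_if_essentially_surjective)
    fix X :: "('a, 'u, 'b) xmod" assume "X \<in> ob (XMod S)"
    then have "crossed_module S X" by (simp add: XMod_def)
    then obtain G u where "internal_category S G" "iso1 (XMod S) X (kernel_xmod G) u"
      using kernel_functor_essentially_surjective by blast
    then show "\<exists>G\<in>ob (ICat S). \<exists>u. iso1 (XMod S) X (F0 kernel_functor G) u"
      by (cases u) (auto simp: ICat_def kernel_functor_def)
  qed
qed

end
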